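(* There is a randomized algorithm with the following guarantee. Let $(P,\mathit{dist})$ be a finite metric space with $N=|P|\ge 2$ points and doubling dimension $d$, where $d$ does not depend on $N$. Given $N$, $d$, and access to $P$ only through a distance oracle that returns $\mathit{dist}(p,q)$ for any $p,q\in P$ in $O(1)$ time, the algorithm outputs the closest-pair distance $\min\{\mathit{dist}(x,y): x,y\in P,\ x\neq y\}$ of $P$, and its expected running time is $O(N\log N)$, where the constant factor in this bound depends only on $d$.
   Context: A metric space $(P,\mathit{dist})$ consists of a non-empty set $P$ and a function $\mathit{dist}:P\times P\to\mathbb{R}$ with $\mathit{dist}(x,x)=0$, $\mathit{dist}(x,y)>0$ for $x\neq y$, $\mathit{dist}(x,y)=\mathit{dist}(y,x)$, and the triangle inequality. For $p\in P$ and $R\ge 0$, $\mathit{ball}_P(p,R)=\{x\in P:\mathit{dist}(p,x)\le R\}$. The doubling dimension of a finite metric space $(P,\mathit{dist})$ is $\log_2\lambda$, where $\lambda$ is the smallest integer such that for every $p\in P$ and every real $R>0$, $\mathit{ball}_P(p,R)$ can be covered by at most $\lambda$ balls $\mathit{ball}_P(q,R/2)$ with centers $q\in P$. Running time is measured in a model where each oracle query and each arithmetic/comparison operation on reals costs $O(1)$. *)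

theory Defs
  imports "HOL-Probability.Probability"
begin

text \<open>A finite metric space with N points is represented, via an (arbitrary) enumeration
  of its points, as a distance function D on the indices 0..N-1.\<close>

definition is_metric :: "(nat \<Rightarrow> nat \<Rightarrow> real) \<Rightarrow> nat \<Rightarrow> bool" where
  "is_metric D N \<longleftrightarrow>
     (\<forall>x<N. D x x = 0) \<and>
     (\<forall>x<N. \<forall>y<N. x \<noteq> y \<longrightarrow> D x y > 0) \<and>
     (\<forall>x<N. \<forall>y<N. D x y = D y x) \<and>
     (\<forall>x<N. \<forall>y<N. \<forall>z<N. D x z \<le> D x y + D y z)"

definition ball_idx :: "(nat \<Rightarrow> nat \<Rightarrow> real) \<Rightarrow> nat \<Rightarrow> nat \<Rightarrow> real \<Rightarrow> nat set" where
  "ball_idx D N p R = {x. x < N \<and> D p x \<le> R}"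

definition doubling_const :: "(nat \<Rightarrow> nat \<Rightarrow> real) \<Rightarrow> nat \<Rightarrow> nat" where
  "doubling_const D N = (LEAST lam::nat. \<forall>p<N. \<forall>R>0. \<exists>Q. Q \<subseteq> {..<N} \<and> card Q \<le> lam \<and>
       ball_idx D N p R \<subseteq> (\<Union>q\<in>Q. ball_idx D N q (R/2)))"

definition doubling_dim :: "(nat \<Rightarrow> nat \<Rightarrow> real) \<Rightarrow> nat \<Rightarrow> real" where
  "doubling_dim D N = log 2 (real (doubling_const D N))"

definition closest_pair :: "(nat \<Rightarrow> nat \<Rightarrow> real) \<Rightarrow> nat \<Rightarrow> real" where
  "closest_pair D N = Min {D x y | x y. x < N \<and> y < N \<and> x \<noteq> y}"

text \<open>Integer registers (unbounded, indirectly addressable), real registers (indirectly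
  addressable), unit cost per instruction. Query r a b stores the oracle answer
  dist(p_(ir a), p_(ir b)) in real register r (error if an index is out of range).
  Coin i writes a fresh uniformly random bit into integer register i.\<close>

datatype instr =
    IConst nat int
  | IAdd nat nat nat | ISub nat nat nat | IMul nat nat nat | IDiv nat nat nat | IMod nat nat nat
  | ILoad nat nat
  | IStore nat nat
  | RConst nat real
  | RAdd nat nat nat | RSub nat nat nat | RMul nat nat nat | RDiv nat nat nat
  | RLoad nat nat
  | RStore nat nat
  | IToR nat nat
  | JmpILess nat nat nat
  | JmpRLess nat nat nat
  | Jmp nat
  | Query nat nat nat
  | Coin nat
  | Halt nat

datatype cfg = Cfg nat "nat \<Rightarrow> int" "nat \<Rightarrow> real" nat | Done real | Err

fun exec_instr :: "instr \<Rightarrow> (nat \<Rightarrow> nat \<Rightarrow> real) \<Rightarrow> nat \<Rightarrow> (nat \<Rightarrow> bool) \<Rightarrow>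
    nat \<Rightarrow> (nat \<Rightarrow> int) \<Rightarrow> (nat \<Rightarrow> real) \<Rightarrow> nat \<Rightarrow> cfg" where
  "exec_instr (IConst i c) D N cs pc I R k = Cfg (Suc pc) (I(i := c)) R k"
| "exec_instr (IAdd i a b) D N cs pc I R k = Cfg (Suc pc) (I(i := I a + I b)) R k"
| "exec_instr (ISub i a b) D N cs pc I R k = Cfg (Suc pc) (I(i := I a - I b)) R k"
| "exec_instr (IMul i a b) D N cs pc I R k = Cfg (Suc pc) (I(i := I a * I b)) R k"
| "exec_instr (IDiv i a b) D N cs pc I R k = Cfg (Suc pc) (I(i := I a div I b)) R k"
| "exec_instr (IMod i a b) D N cs pc I R k = Cfg (Suc pc) (I(i := I a mod I b)) R k"
| "exec_instr (ILoad i j) D N cs pc I R k =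
     (if I j < 0 then Err else Cfg (Suc pc) (I(i := I (nat (I j)))) R k)"
| "exec_instr (IStore i j) D N cs pc I R k =
     (if I j < 0 then Err else Cfg (Suc pc) (I(nat (I j) := I i)) R k)"
| "exec_instr (RConst i c) D N cs pc I R k = Cfg (Suc pc) I (R(i := c)) k"
| "exec_instr (RAdd i a b) D N cs pc I R k = Cfg (Suc pc) I (R(i := R a + R b)) k"
| "exec_instr (RSub i a b) D N cs pc I R k = Cfg (Suc pc) I (R(i := R a - R b)) k"
| "exec_instr (RMul i a b) D N cs pc I R k = Cfg (Suc pc) I (R(i := R a * R b)) k"
| "exec_instr (RDiv i a b) D N cs pc I R k = Cfg (Suc pc) I (R(i := R a / R b)) k"
| "exec_instr (RLoad i j) D N cs pc I R k =
     (if I j < 0 then Err else Cfg (Suc pc) I (R(i := R (nat (I j)))) k)"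
| "exec_instr (RStore i j) D N cs pc I R k =
     (if I j < 0 then Err else Cfg (Suc pc) I (R(nat (I j) := R i)) k)"
| "exec_instr (IToR i j) D N cs pc I R k = Cfg (Suc pc) I (R(i := real_of_int (I j))) k"
| "exec_instr (JmpILess i j t) D N cs pc I R k =
     Cfg (if I i < I j then t else Suc pc) I R k"
| "exec_instr (JmpRLess i j t) D N cs pc I R k =
     Cfg (if R i < R j then t else Suc pc) I R k"
| "exec_instr (Jmp t) D N cs pc I R k = Cfg t I R k"
| "exec_instr (Query r a b) D N cs pc I R k =
     (if 0 \<le> I a \<and> I a < int N \<and> 0 \<le> I b \<and> I b < int N
      then Cfg (Suc pc) I (R(r := D (nat (I a)) (nat (I b)))) k else Err)"
| "exec_instr (Coin i) D N cs pc I R k =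
     Cfg (Suc pc) (I(i := (if cs k then 1 else 0))) R (Suc k)"
| "exec_instr (Halt i) D N cs pc I R k = Done (R i)"

fun step :: "instr list \<Rightarrow> (nat \<Rightarrow> nat \<Rightarrow> real) \<Rightarrow> nat \<Rightarrow> (nat \<Rightarrow> bool) \<Rightarrow> cfg \<Rightarrow> cfg" where
  "step prog D N cs (Cfg pc I R k) =
     (if pc < length prog then exec_instr (prog ! pc) D N cs pc I R k else Err)"
| "step prog D N cs (Done x) = Done x"
| "step prog D N cs Err = Err"

definition init_cfg :: "nat \<Rightarrow> real \<Rightarrow> cfg" where
  "init_cfg N d = Cfg 0 ((\<lambda>_. 0)(0 := int N)) ((\<lambda>_. 0)(0 := d)) 0"

definition run :: "instr list \<Rightarrow> (nat \<Rightarrow> nat \<Rightarrow> real) \<Rightarrow> nat \<Rightarrow> real \<Rightarrow> (nat \<Rightarrow> bool) \<Rightarrow> nat \<Rightarrow> cfg" where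
  "run prog D N d cs n = (step prog D N cs ^^ n) (init_cfg N d)"

definition is_done :: "cfg \<Rightarrow> bool" where
  "is_done c \<longleftrightarrow> (\<exists>x. c = Done x)"

definition run_time :: "instr list \<Rightarrow> (nat \<Rightarrow> nat \<Rightarrow> real) \<Rightarrow> nat \<Rightarrow> real \<Rightarrow> (nat \<Rightarrow> bool) \<Rightarrow> enat" where
  "run_time prog D N d cs =
     (if \<exists>n. is_done (run prog D N d cs n)
      then enat (LEAST n. is_done (run prog D N d cs n)) else \<infinity>)"

definition run_output :: "instr list \<Rightarrow> (nat \<Rightarrow> nat \<Rightarrow> real) \<Rightarrow> nat \<Rightarrow> real \<Rightarrow> (nat \<Rightarrow> bool) \<Rightarrow> real option" where
  "run_output prog D N d cs =
     (if \<exists>n x. run prog D N d cs n = Done x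
      then Some (THE x. \<exists>n. run prog D N d cs n = Done x) else None)"

definition coins :: "(nat \<Rightarrow> bool) measure" where
  "coins = (\<Pi>\<^sub>M i\<in>(UNIV::nat set). measure_pmf (bernoulli_pmf (1/2)))"

definition expected_time :: "instr list \<Rightarrow> (nat \<Rightarrow> nat \<Rightarrow> real) \<Rightarrow> nat \<Rightarrow> real \<Rightarrow> ennreal" where
  "expected_time prog D N d = (\<integral>\<^sup>+ cs. ennreal_of_enat (run_time prog D N d cs) \<partial>coins)"

end

theory Submission
  imports Defs
begin

text \<open>The algorithm keeps a queue of point sets, at least one of which contains a closest pair unless
  its distance has already been recorded. A large set \<open>s\<close> of \<open>n\<close> points is split by a random sphere: for
  random \<open>p, q\<close> in \<open>s\<close>, the annulus around \<open>p\<close> between the radii \<open>R = D p q\<close> and \<open>2 * R\<close> is cut into \<open>T\<close>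
  (polylogarithmically many) shells of width \<open>w = R / T\<close>, a random one is selected, and \<open>s\<close> is replaced by
  the points inside the outer sphere and the points outside the inner sphere of this shell.
  If a constant fraction of \<open>s\<close> lies inside, then by packing two of these points have distance at most
  \<open>w\<close>, hence no closest pair is separated. With constant probability both parts are also
  smaller than \<open>s\<close> by a constant factor and the shell contains only \<open>O(n / log n)\<close> points; only such splits are carried out.
  Each of them lowers the potential \<open>\<Sum>s. (A * n * log n + B)\<close> by \<open>\<Omega>(n)\<close>, which pays for the expected number of
  attempts. Sets whose size is bounded in terms of the dimension are searched by brute force.

  Correctness and running time are bounded together, by charging an infinite cost for a wrong
  output.\<close>

subsection \<open>Expected cost of a program\<close>

text \<open>The tension lies in the number \<open>T\<close> of shells. The points of the chosen
  shell are duplicated, and each duplicate adds a multiple of \<open>log n\<close> to the potential,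
  so only \<open>n / (4 * c * K)\<close> of them are affordable, where \<open>K\<close> is about
  \<open>log n\<close>; averaging over the shells then asks for \<open>T\<close> of order
  \<open>log n\<close>. Thin shells make the packing argument harder: two points at distance at most
  \<open>R / T\<close> are forced only among more than \<open>L ^ (k + 2)\<close> points, where
  \<open>T = 2 ^ k\<close>. For constant \<open>L\<close> this number is polylogarithmic in
  \<open>n\<close>, hence below \<open>n / (2 * c)\<close> except for sets of bounded size. Covering
  balls may be centred anywhere in the whole space, so one \<open>L\<close> serves all subsets. The
  acceptance tests depend only on counted sizes and imply that no closest pair is separated, hence
  chance influences only the time. Expected cost is derived by a weakest precondition that carries a
  budget, so coin tosses are averaged locally and the measure on coin sequences is needed only to
  justify this.\<close>

fun path_cost :: "instr list \<Rightarrow> (nat \<Rightarrow> nat \<Rightarrow> real) \<Rightarrow> nat \<Rightarrow> real \<Rightarrow> nat \<Rightarrow> cfg \<Rightarrow> (nat \<Rightarrow> bool) \<Rightarrow> ennreal" where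
  "path_cost prog D N r n (Done x) cs = (if x = r then 0 else \<infinity>)"
| "path_cost prog D N r n Err cs = \<infinity>"
| "path_cost prog D N r 0 (Cfg pc I R k) cs = 0"
| "path_cost prog D N r (Suc n) (Cfg pc I R k) cs =
     1 + path_cost prog D N r n (step prog D N cs (Cfg pc I R k)) cs"

text \<open>The average is taken at every step, which is harmless because only \<open>Coin\<close>
  reads a bit: for any other instruction both successors agree. Exhausted fuel counts as cost 0, so
  the values increase with \<open>n\<close> towards the full expected cost.\<close>

fun exp_cost :: "instr list \<Rightarrow> (nat \<Rightarrow> nat \<Rightarrow> real) \<Rightarrow> nat \<Rightarrow> real \<Rightarrow> nat \<Rightarrow> cfg \<Rightarrow> ennreal" where
  "exp_cost prog D N r n (Done x) = (if x = r then 0 else \<infinity>)"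
| "exp_cost prog D N r n Err = \<infinity>"
| "exp_cost prog D N r 0 (Cfg pc I R k) = 0"
| "exp_cost prog D N r (Suc n) (Cfg pc I R k) =
     1 + (exp_cost prog D N r n (step prog D N (\<lambda>_. True) (Cfg pc I R k)) +
          exp_cost prog D N r n (step prog D N (\<lambda>_. False) (Cfg pc I R k))) / 2"

lemma ennreal_average_same: "(x + x) / 2 = (x :: ennreal)"
proof (cases x)
  case (real r)
  then show ?thesis
    by (simp flip: ennreal_plus add: divide_ennreal ennreal_numeral[symmetric] del: ennreal_numeral)
qed (simp add: ennreal_top_divide)

text \<open>Coins are independent and identically distributed, so the expected cost does not depend
  on how many have been used. Moving the counter makes this precise and allows it to be reset to
  0.\<close>

fun set_counter :: "nat \<Rightarrow> cfg \<Rightarrow> cfg" where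
  "set_counter j (Cfg pc I R k) = Cfg pc I R (j + k)"
| "set_counter j (Done x) = Done x"
| "set_counter j Err = Err"

lemma step_shift:
  "step prog D N cs (set_counter j c) = set_counter j (step prog D N (\<lambda>i. cs (j + i)) c)"
proof (cases c)
  case (Cfg pc I R k)
  then show ?thesis by (cases "prog ! pc") auto
qed auto

lemma path_cost_shift:
  "path_cost prog D N r n (set_counter j c) cs = path_cost prog D N r n c (\<lambda>i. cs (j + i))"
proof (induction n arbitrary: c)
  case 0
  show ?case by (cases c) auto
next
  case (Suc n)
  show ?case
  proof (cases c)
    case (Cfg pc I R k)
    show ?thesis
      using Suc[of "step prog D N (\<lambda>i. cs (j + i)) c"] step_shift[of prog D N cs j c]
      unfolding Cfg by simp
  qed auto
qed

lemma exp_cost_shift: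
  "exp_cost prog D N r n (set_counter j c) = exp_cost prog D N r n c"
proof (induction n arbitrary: c)
  case 0
  show ?case by (cases c) auto
next
  case (Suc n)
  show ?case
  proof (cases c)
    case (Cfg pc I R k)
    show ?thesis
      using Suc[of "step prog D N (\<lambda>i. True) c"] step_shift[of prog D N "\<lambda>i. True" j c]
        Suc[of "step prog D N (\<lambda>i. False) c"] step_shift[of prog D N "\<lambda>i. False" j c]
      unfolding Cfg by simp
  qed auto
qed

lemma step_cong: "(\<And>pc I R k. c = Cfg pc I R k \<Longrightarrow> cs k = cs' k) \<Longrightarrow>
    step prog D N cs c = step prog D N cs' c"
proof (cases c)
  case (Cfg pc I R k)
  moreover assume "\<And>pc I R k. c = Cfg pc I R k \<Longrightarrow> cs k = cs' k"
  ultimately show ?thesis by (cases "prog ! pc") auto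
qed auto

lemma sets_coins [measurable_cong]:
  "sets coins = sets (\<Pi>\<^sub>M i\<in>(UNIV::nat set). count_space UNIV)"
  unfolding coins_def by (intro sets_PiM_cong) auto

lemma measurable_coin [measurable]: "(\<lambda>cs. cs k) \<in> coins \<rightarrow>\<^sub>M count_space UNIV"
  by measurable

lemma measurable_path_cost [measurable]:
  "path_cost prog D N r n c \<in> borel_measurable coins"
proof (induction n arbitrary: c)
  case 0
  show ?case by (cases c) auto
next
  case (Suc n)
  show ?case
  proof (cases c)
    case (Cfg pc I R k)
    have "path_cost prog D N r n (step prog D N cs c) cs =
        (if cs k then path_cost prog D N r n (step prog D N (\<lambda>_. True) c) cs
         else path_cost prog D N r n (step prog D N (\<lambda>_. False) c) cs)" for cs
      using step_cong[of c cs "\<lambda>_. True" prog D N] step_cong[of c cs "\<lambda>_. False" prog D N]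
      by (auto simp: Cfg)
    then have eq: "path_cost prog D N r (Suc n) c =
        (\<lambda>cs. 1 + (if cs k then path_cost prog D N r n (step prog D N (\<lambda>_. True) c) cs
         else path_cost prog D N r n (step prog D N (\<lambda>_. False) c) cs))"
      unfolding Cfg by (auto simp: fun_eq_iff)
    note [measurable] = Suc
    show ?thesis unfolding eq by measurable
  qed auto
qed

lemma sequence_space_bernoulli: "sequence_space (measure_pmf (bernoulli_pmf (1/2)))"
  by unfold_locales

text \<open>An infinite bit sequence is a first bit followed by an independent sequence with the
  same law (\<open>PiM_iter\<close>); integrating out the first bit leaves the mean of two
  integrals.\<close>

lemma nn_integral_coins_split:
  assumes [measurable]: "f \<in> borel_measurable coins"
  shows "(\<integral>\<^sup>+ cs. f cs \<partial>coins) =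
    ((\<integral>\<^sup>+ cs. f (case_nat True cs) \<partial>coins) + (\<integral>\<^sup>+ cs. f (case_nat False cs) \<partial>coins)) / 2"
proof -
  let ?B = "measure_pmf (bernoulli_pmf (1/2))"
  interpret sequence_space ?B by (rule sequence_space_bernoulli)
  have [measurable]: "f \<in> borel_measurable S"
    using assms by (simp add: coins_def)
  have "(\<integral>\<^sup>+ cs. f cs \<partial>coins) = (\<integral>\<^sup>+ cs. f cs \<partial>distr (?B \<Otimes>\<^sub>M S) S (\<lambda>(s, \<omega>). case_nat s \<omega>))"
    unfolding coins_def PiM_iter ..
  also have "\<dots> = (\<integral>\<^sup>+ p. f (case_nat (fst p) (snd p)) \<partial>(?B \<Otimes>\<^sub>M S))"
    by (subst nn_integral_distr) (auto simp: split_beta')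
  also have "\<dots> = (\<integral>\<^sup>+ b. \<integral>\<^sup>+ cs. f (case_nat b cs) \<partial>S \<partial>?B)"
    by (subst P.nn_integral_fst[symmetric]) auto
  also have "\<dots> = ((\<integral>\<^sup>+ cs. f (case_nat True cs) \<partial>S) + (\<integral>\<^sup>+ cs. f (case_nat False cs) \<partial>S)) * ennreal (1/2)"
    by (simp add: distrib_right)
  also have "\<dots> = ((\<integral>\<^sup>+ cs. f (case_nat True cs) \<partial>S) + (\<integral>\<^sup>+ cs. f (case_nat False cs) \<partial>S)) / 2"
    by (simp add: divide_ennreal_def ennreal_divide_numeral[symmetric] inverse_ennreal[symmetric])
  finally show ?thesis unfolding coins_def .
qed

lemma prob_space_coins: "prob_space coins"
  unfolding coins_def by (rule prob_space_PiM) (rule measure_pmf.prob_space_axioms)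

lemma nn_integral_path_cost_shift:
  "(\<integral>\<^sup>+ cs. path_cost prog D N r n (set_counter j c) cs \<partial>coins) =
   (\<integral>\<^sup>+ cs. path_cost prog D N r n c cs \<partial>coins)"
proof (induction j)
  case 0
  then show ?case by (cases c) auto
next
  case (Suc j)
  have "set_counter (Suc j) c = set_counter 1 (set_counter j c)" by (cases c) auto
  then have "(\<integral>\<^sup>+ cs. path_cost prog D N r n (set_counter (Suc j) c) cs \<partial>coins) =
     (\<integral>\<^sup>+ cs. path_cost prog D N r n (set_counter 1 (set_counter j c)) cs \<partial>coins)" by simp
  also have "\<dots> = (\<integral>\<^sup>+ cs. path_cost prog D N r n (set_counter j c) cs \<partial>coins)"
    by (subst nn_integral_coins_split)
      (simp_all add: path_cost_shift[of _ _ _ _ _ 1] ennreal_average_same plus_1_eq_Suc del: One_nat_def)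
  finally show ?case using Suc by simp
qed

lemma nn_integral_path_cost:
  "(\<integral>\<^sup>+ cs. path_cost prog D N r n c cs \<partial>coins) = exp_cost prog D N r n c"
proof (induction n arbitrary: c)
  case 0
  show ?case by (cases c) (auto simp: prob_space.emeasure_space_1[OF prob_space_coins])
next
  case (Suc n)
  interpret prob_space coins by (rule prob_space_coins)
  show ?case
  proof (cases c)
    case Cfg0: (Cfg pc I R k0)
    \<comment> \<open>With the counter at 0, the bit that this step may read is the first one, so
      \<open>nn_integral_coins_split\<close> applies.\<close>
    define c0 where "c0 = Cfg pc I R 0"
    have c: "c = set_counter k0 c0" by (simp add: c0_def Cfg0)
    have step1: "(\<integral>\<^sup>+ cs. path_cost prog D N r (Suc n) c0 cs \<partial>coins) =
        1 + (\<integral>\<^sup>+ cs. path_cost prog D N r n (step prog D N cs c0) cs \<partial>coins)"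
    proof -
      have "path_cost prog D N r n (step prog D N cs c0) cs =
        (if cs 0 then path_cost prog D N r n (step prog D N (\<lambda>_. True) c0) cs
         else path_cost prog D N r n (step prog D N (\<lambda>_. False) c0) cs)" for cs
        using step_cong[of c0 cs "\<lambda>_. True" prog D N] step_cong[of c0 cs "\<lambda>_. False" prog D N]
        by (auto simp: c0_def)
      then have [measurable]: "(\<lambda>cs. path_cost prog D N r n (step prog D N cs c0) cs) \<in> borel_measurable coins"
        by simp
      have "path_cost prog D N r (Suc n) c0 cs =
          1 + path_cost prog D N r n (step prog D N cs c0) cs" for cs
        by (simp add: c0_def)
      then show ?thesis by (simp add: nn_integral_add emeasure_space_1)
    qed
    have "(\<integral>\<^sup>+ cs. path_cost prog D N r n (step prog D N cs c0) cs \<partial>coins) =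
       (exp_cost prog D N r n (step prog D N (\<lambda>_. True) c0) +
        exp_cost prog D N r n (step prog D N (\<lambda>_. False) c0)) / 2"
    proof (cases "\<exists>i. prog ! pc = Coin i \<and> pc < length prog")
      case False
      then have *: "step prog D N cs c0 = step prog D N (\<lambda>_. True) c0" for cs
        by (cases "prog ! pc") (auto simp: c0_def)
      show ?thesis
        unfolding *[of "\<lambda>_. False"] by (subst *) (simp add: Suc ennreal_average_same)
    next
      case True
      then obtain i where i: "prog ! pc = Coin i" "pc < length prog" by blast
      define d where "d b = Cfg (Suc pc) (I(i := (if b then 1 else 0))) R 0" for b :: bool
      have st: "step prog D N cs c0 = set_counter 1 (d (cs 0))" for cs
        using i by (simp add: c0_def d_def)
      have m: "(\<lambda>cs. path_cost prog D N r n (set_counter 1 (d (cs 0))) cs) \<in> borel_measurable coins"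
      proof -
        have "path_cost prog D N r n (set_counter 1 (d (cs 0))) cs =
          (if cs 0 then path_cost prog D N r n (set_counter 1 (d True)) cs
           else path_cost prog D N r n (set_counter 1 (d False)) cs)" for cs by (cases "cs 0") simp_all
        then show ?thesis by simp
      qed
      show ?thesis
        unfolding st
        by (subst nn_integral_coins_split[OF m])
          (simp only: path_cost_shift, simp add: Suc exp_cost_shift)
    qed
    then show ?thesis
      unfolding c nn_integral_path_cost_shift exp_cost_shift step1
      by (simp add: c0_def)
  qed (auto simp: emeasure_space_1)
qed

lemma path_cost_mono: "path_cost prog D N r n c cs \<le> path_cost prog D N r (Suc n) c cs"
proof (induction n arbitrary: c)
  case 0
  show ?case by (cases c) auto
next
  case (Suc n)
  show ?case
    by (cases c) (auto intro!: add_left_mono Suc simp del: step.simps)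
qed

lemma exp_cost_mono: "exp_cost prog D N r n c \<le> exp_cost prog D N r (Suc n) c"
proof (induction n arbitrary: c)
  case 0
  show ?case by (cases c) auto
next
  case (Suc n)
  show ?case
    by (cases c) (auto intro!: add_left_mono add_mono divide_right_mono_ennreal Suc simp del: step.simps)
qed

lemma path_cost_run:
  assumes "\<And>m. m < n \<Longrightarrow> \<not> is_done ((step prog D N cs ^^ m) c)"
  shows "of_nat n \<le> path_cost prog D N r n c cs"
  using assms
proof (induction n arbitrary: c)
  case (Suc n)
  show ?case
  proof (cases c)
    case (Cfg pc I R k)
    have "of_nat n \<le> path_cost prog D N r n (step prog D N cs c) cs"
    proof (rule Suc.IH)
      fix m assume "m < n"
      then show "\<not> is_done ((step prog D N cs ^^ m) (step prog D N cs c))"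
        using Suc.prems[of "Suc m"] by (simp add: funpow_swap1)
    qed
    then show ?thesis by (simp add: Cfg add_left_mono)
  next
    case (Done x)
    then show ?thesis using Suc.prems[of 0] by (auto simp: is_done_def)
  qed auto
qed auto

lemma path_cost_correct:
  assumes "(step prog D N cs ^^ n) c = Done x" "path_cost prog D N r n c cs \<noteq> \<infinity>"
  shows "x = r"
  using assms
proof (induction n arbitrary: c)
  case 0
  then show ?case by (auto split: if_splits)
next
  case (Suc n)
  show ?case
  proof (cases c)
    case (Cfg pc I R k)
    show ?thesis
      by (rule Suc.IH[of "step prog D N cs c"])
        (use Suc.prems in \<open>auto simp: Cfg funpow_swap1 simp del: step.simps\<close>)
  next
    case (Done y)
    have "(step prog D N cs ^^ m) (Done y) = Done y" for m by (induction m) auto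
    then show ?thesis using Suc.prems Done by (auto split: if_splits)
  next
    case Err
    then show ?thesis using Suc.prems by auto
  qed
qed

text \<open>A bound valid for every amount of fuel passes to the supremum \<open>F\<close> by
  monotone convergence. \<open>F\<close> is infinite on runs that fail, diverge or give a wrong
  answer, so its finite expectation yields almost sure correctness as well as the time
  bound.\<close>

lemma exp_cost_bound:
  assumes "\<And>n. exp_cost prog D N r n (init_cfg N d) \<le> ennreal B"
  shows "AE cs in coins. run_output prog D N d cs = Some r"
    and "expected_time prog D N d \<le> ennreal B"
proof -
  define F where "F cs = (SUP n. path_cost prog D N r n (init_cfg N d) cs)" for cs
  have [measurable]: "F \<in> borel_measurable coins" unfolding F_def by measurable
  have "(\<integral>\<^sup>+ cs. F cs \<partial>coins) = (SUP n. \<integral>\<^sup>+ cs. path_cost prog D N r n (init_cfg N d) cs \<partial>coins)"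
    unfolding F_def
    by (rule nn_integral_monotone_convergence_SUP) (auto intro!: incseq_SucI path_cost_mono simp: le_fun_def)
  also have "\<dots> \<le> ennreal B"
    using assms by (auto intro!: SUP_least simp: nn_integral_path_cost)
  finally have int: "(\<integral>\<^sup>+ cs. F cs \<partial>coins) \<le> ennreal B" .
  have time: "ennreal_of_enat (run_time prog D N d cs) \<le> F cs" for cs
  proof (cases "\<exists>n. is_done (run prog D N d cs n)")
    case True
    define m where "m = (LEAST n. is_done (run prog D N d cs n))"
    have "of_nat m \<le> path_cost prog D N r m (init_cfg N d) cs"
      using not_less_Least[of _ "\<lambda>n. is_done (run prog D N d cs n)"]
      by (intro path_cost_run) (auto simp: m_def run_def)
    also have "\<dots> \<le> F cs" unfolding F_def by (rule SUP_upper) auto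
    finally show ?thesis using True by (simp add: run_time_def m_def[symmetric])
  next
    case False
    then have *: "of_nat n \<le> path_cost prog D N r n (init_cfg N d) cs" for n
      by (intro path_cost_run) (auto simp: run_def)
    have "of_nat n \<le> F cs" for n
      unfolding F_def by (rule order_trans[OF *]) (rule SUP_upper, simp)
    then have "F cs = \<infinity>"
      using ennreal_Ex_less_of_nat[of "F cs"] by (force simp: not_le[symmetric] less_top)
    then show ?thesis by simp
  qed
  show "expected_time prog D N d \<le> ennreal B"
    unfolding expected_time_def by (rule order_trans[OF nn_integral_mono int]) (rule time)
  have "(\<integral>\<^sup>+ cs. F cs \<partial>coins) \<noteq> \<infinity>" using int by (auto simp: top_unique)
  then have "AE cs in coins. F cs \<noteq> \<infinity>" by (intro nn_integral_PInf_AE) auto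
  then show "AE cs in coins. run_output prog D N d cs = Some r"
  proof eventually_elim
    case (elim cs)
    have ans: "x = r" if "run prog D N d cs n = Done x" for n x
    proof (rule path_cost_correct)
      show "(step prog D N cs ^^ n) (init_cfg N d) = Done x" using that by (simp add: run_def)
      have "path_cost prog D N r n (init_cfg N d) cs \<le> F cs" unfolding F_def by (rule SUP_upper) auto
      then show "path_cost prog D N r n (init_cfg N d) cs \<noteq> \<infinity>" using elim by (auto simp: top_unique)
    qed
    have "ennreal_of_enat (run_time prog D N d cs) \<noteq> \<infinity>"
      using time[of cs] elim by (auto simp: top_unique)
    then have "run_time prog D N d cs \<noteq> \<infinity>" by (cases "run_time prog D N d cs") auto
    then have "\<exists>n. is_done (run prog D N d cs n)" by (auto simp: run_time_def split: if_splits)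
    then obtain n x where n: "run prog D N d cs n = Done x" by (auto simp: is_done_def)
    then have "(THE x. \<exists>n. run prog D N d cs n = Done x) = r"
      using ans by (intro the_equality) auto
    then show ?case using n by (auto simp: run_output_def)
  qed
qed


section \<open>Structured commands and weakest preconditions with a cost budget\<close>

datatype com =
    Skip
  | Basic instr
  | Seq com com (infixr ";;" 60)
  | IfI nat nat com com
  | IfR nat nat com com
  | WhileI nat nat com
  | WhileR nat nat com

primrec com_size :: "com \<Rightarrow> nat" where
  "com_size Skip = 0"
| "com_size (Basic b) = 1"
| "com_size (c1 ;; c2) = com_size c1 + com_size c2"
| "com_size (IfI i j c1 c2) = com_size c1 + com_size c2 + 2"
| "com_size (IfR i j c1 c2) = com_size c1 + com_size c2 + 2"
| "com_size (WhileI i j c) = com_size c + 3"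
| "com_size (WhileR i j c) = com_size c + 3"

text \<open>Jump targets are absolute, hence the address \<open>a\<close>. In a conditional the code
  of the second branch stands first and must jump over the other, so it costs one instruction more;
  leaving a loop costs two, the failed test and a jump. The preconditions below count
  accordingly.\<close>

primrec compile :: "nat \<Rightarrow> com \<Rightarrow> instr list" where
  "compile a Skip = []"
| "compile a (Basic b) = [b]"
| "compile a (c1 ;; c2) = compile a c1 @ compile (a + com_size c1) c2"
| "compile a (IfI i j c1 c2) =
     JmpILess i j (a + com_size c2 + 2) # compile (a + 1) c2 @
     Jmp (a + com_size c1 + com_size c2 + 2) # compile (a + com_size c2 + 2) c1"
| "compile a (IfR i j c1 c2) =
     JmpRLess i j (a + com_size c2 + 2) # compile (a + 1) c2 @
     Jmp (a + com_size c1 + com_size c2 + 2) # compile (a + com_size c2 + 2) c1"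
| "compile a (WhileI i j c) =
     JmpILess i j (a + 2) # Jmp (a + com_size c + 3) # compile (a + 2) c @ [Jmp a]"
| "compile a (WhileR i j c) =
     JmpRLess i j (a + 2) # Jmp (a + com_size c + 3) # compile (a + 2) c @ [Jmp a]"

lemma length_compile [simp]: "length (compile a c) = com_size c"
  by (induction c arbitrary: a) auto

type_synonym state_pred = "(nat \<Rightarrow> int) \<Rightarrow> (nat \<Rightarrow> real) \<Rightarrow> real \<Rightarrow> bool"

text \<open>For \<open>Coin\<close>, the budgets \<open>y\<close> and \<open>2 * (x - 1) - y\<close>
  of the two outcomes have mean \<open>x - 1\<close>, which is what remains after paying for the
  toss. Jumps and \<open>Halt\<close> fall under the final \<open>False\<close>: control flow enters
  only through structured commands and the assembly of \<open>closest_pair_prog\<close>.\<close>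

fun basic_wp :: "(nat \<Rightarrow> nat \<Rightarrow> real) \<Rightarrow> nat \<Rightarrow> instr \<Rightarrow> state_pred \<Rightarrow> state_pred" where
  "basic_wp D N (IConst i c) Q I R x = Q (I(i := c)) R (x - 1)"
| "basic_wp D N (IAdd i a b) Q I R x = Q (I(i := I a + I b)) R (x - 1)"
| "basic_wp D N (ISub i a b) Q I R x = Q (I(i := I a - I b)) R (x - 1)"
| "basic_wp D N (IMul i a b) Q I R x = Q (I(i := I a * I b)) R (x - 1)"
| "basic_wp D N (IDiv i a b) Q I R x = Q (I(i := I a div I b)) R (x - 1)"
| "basic_wp D N (IMod i a b) Q I R x = Q (I(i := I a mod I b)) R (x - 1)"
| "basic_wp D N (ILoad i j) Q I R x = (0 \<le> I j \<and> Q (I(i := I (nat (I j)))) R (x - 1))"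
| "basic_wp D N (IStore i j) Q I R x = (0 \<le> I j \<and> Q (I(nat (I j) := I i)) R (x - 1))"
| "basic_wp D N (RConst i c) Q I R x = Q I (R(i := c)) (x - 1)"
| "basic_wp D N (RAdd i a b) Q I R x = Q I (R(i := R a + R b)) (x - 1)"
| "basic_wp D N (RMul i a b) Q I R x = Q I (R(i := R a * R b)) (x - 1)"
| "basic_wp D N (RDiv i a b) Q I R x = Q I (R(i := R a / R b)) (x - 1)"
| "basic_wp D N (IToR i j) Q I R x = Q I (R(i := real_of_int (I j))) (x - 1)"
| "basic_wp D N (Query r a b) Q I R x =
     (0 \<le> I a \<and> I a < int N \<and> 0 \<le> I b \<and> I b < int N \<and>
      Q I (R(r := D (nat (I a)) (nat (I b)))) (x - 1))"
| "basic_wp D N (Coin i) Q I R x =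
     (\<exists>y. Q (I(i := 0)) R y \<and> Q (I(i := 1)) R (2 * (x - 1) - y))"
| "basic_wp D N _ Q I R x = False"

text \<open>The third argument of a state predicate is a budget for the expected remaining cost; at a coin
  toss it may be distributed unevenly over the two outcomes.\<close>

primrec wp :: "(nat \<Rightarrow> nat \<Rightarrow> real) \<Rightarrow> nat \<Rightarrow> com \<Rightarrow> state_pred \<Rightarrow> state_pred" where
  "wp D N Skip Q = Q"
| "wp D N (Basic b) Q = basic_wp D N b Q"
| "wp D N (c1 ;; c2) Q = wp D N c1 (wp D N c2 Q)"
| "wp D N (IfI i j c1 c2) Q = (\<lambda>I R x. if I i < I j then wp D N c1 Q I R (x - 1)
     else wp D N c2 (\<lambda>I R x. Q I R (x - 1)) I R (x - 1))"
| "wp D N (IfR i j c1 c2) Q = (\<lambda>I R x. if R i < R j then wp D N c1 Q I R (x - 1)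
     else wp D N c2 (\<lambda>I R x. Q I R (x - 1)) I R (x - 1))"
| "wp D N (WhileI i j c) Q = lfp (\<lambda>X I R x. if I i < I j
     then wp D N c (\<lambda>I R x. X I R (x - 1)) I R (x - 1) else Q I R (x - 2))"
| "wp D N (WhileR i j c) Q = lfp (\<lambda>X I R x. if R i < R j
     then wp D N c (\<lambda>I R x. X I R (x - 1)) I R (x - 1) else Q I R (x - 2))"

lemma basic_wp_mono:
  "basic_wp D N b Q I R x \<Longrightarrow> (\<And>I R x. Q I R x \<Longrightarrow> Q' I R x) \<Longrightarrow> basic_wp D N b Q' I R x"
  by (cases b) auto

lemma wp_mono:
  "wp D N c Q I R x \<Longrightarrow> (\<And>I R x. Q I R x \<Longrightarrow> Q' I R x) \<Longrightarrow> wp D N c Q' I R x"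
proof (induction c arbitrary: Q Q' I R x)
  case (Basic b)
  then show ?case by (auto intro: basic_wp_mono)
next
  case (Seq c1 c2)
  show ?case using Seq.prems Seq.IH(2)[of Q _ _ _ Q'] by (auto intro: Seq.IH(1))
next
  case (IfI i j c1 c2)
  show ?case using IfI.prems
    by (auto intro: IfI.IH(1)[of Q] IfI.IH(2)[of "\<lambda>I R x. Q I R (x - 1)"] split: if_splits)
next
  case (IfR i j c1 c2)
  show ?case using IfR.prems
    by (auto intro: IfR.IH(1)[of Q] IfR.IH(2)[of "\<lambda>I R x. Q I R (x - 1)"] split: if_splits)
next
  case (WhileI i j c)
  have "wp D N (WhileI i j c) Q \<le> wp D N (WhileI i j c) Q'"
    unfolding wp.simps using WhileI.prems(2) by (intro lfp_mono) (auto simp: le_fun_def)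
  then show ?case using WhileI.prems(1) by (auto simp: le_fun_def)
next
  case (WhileR i j c)
  have "wp D N (WhileR i j c) Q \<le> wp D N (WhileR i j c) Q'"
    unfolding wp.simps using WhileR.prems(2) by (intro lfp_mono) (auto simp: le_fun_def)
  then show ?case using WhileR.prems(1) by (auto simp: le_fun_def)
qed auto

text \<open>Being a least fixed point, the precondition of a loop demands termination for all
  outcomes of the coins. Loops are therefore verified by one unfolding and an induction on the
  remaining work.\<close>

lemma wp_WhileI:
  "wp D N (WhileI i j c) Q I R x = (if I i < I j
     then wp D N c (\<lambda>I R x. wp D N (WhileI i j c) Q I R (x - 1)) I R (x - 1) else Q I R (x - 2))"
  unfolding wp.simps by (subst lfp_unfold) (auto simp: mono_def le_fun_def intro: wp_mono)

lemma wp_WhileR: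
  "wp D N (WhileR i j c) Q I R x = (if R i < R j
     then wp D N c (\<lambda>I R x. wp D N (WhileR i j c) Q I R (x - 1)) I R (x - 1) else Q I R (x - 2))"
  unfolding wp.simps by (subst lfp_unfold) (auto simp: mono_def le_fun_def intro: wp_mono)

lemmas wp_simps = wp.simps(1-5) basic_wp.simps

section \<open>Soundness of the preconditions for compiled code\<close>

fun code_at :: "instr list \<Rightarrow> nat \<Rightarrow> instr list \<Rightarrow> bool" where
  "code_at prog a [] = True"
| "code_at prog a (b # bs) = (a < length prog \<and> prog ! a = b \<and> code_at prog (Suc a) bs)"

lemma code_at_append:
  "code_at prog a (xs @ ys) \<longleftrightarrow> code_at prog a xs \<and> code_at prog (a + length xs) ys"
  by (induction xs arbitrary: a) auto

lemma code_at_prefix: "code_at (xs @ ys @ zs) (length xs) ys"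
proof (induction ys arbitrary: xs)
  case (Cons y ys)
  show ?case using Cons[of "xs @ [y]"] by simp
qed simp

context
  fixes prog :: "instr list" and D :: "nat \<Rightarrow> nat \<Rightarrow> real" and N :: nat and r :: real
begin

text \<open>Nonnegativity is demanded because \<open>ennreal\<close> turns a negative budget into 0,
  which would make the averaging at a coin unsound. The coin counter is quantified since state
  predicates do not see it.\<close>

definition cost_le :: "nat \<Rightarrow> nat \<Rightarrow> state_pred" where
  "cost_le n pc I R x \<longleftrightarrow> 0 \<le> x \<and> (\<forall>k. exp_cost prog D N r n (Cfg pc I R k) \<le> ennreal x)"

lemma cost_le_weaken: "cost_le n pc I R x \<Longrightarrow> x \<le> y \<Longrightarrow> cost_le n pc I R y"
  unfolding cost_le_def by (meson ennreal_leI order_trans)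

lemma cost_le_average:
  assumes "\<And>k. \<exists>k'. step prog D N (\<lambda>_. True) (Cfg pc I R k) = Cfg pc1 I1 R1 k'"
    and "\<And>k. \<exists>k'. step prog D N (\<lambda>_. False) (Cfg pc I R k) = Cfg pc0 I0 R0 k'"
    and c: "cost_le n pc1 I1 R1 x1" "cost_le n pc0 I0 R0 x0"
    and x: "x1 + x0 = 2 * (x - 1)"
  shows "cost_le (Suc n) pc I R x"
proof -
  have "exp_cost prog D N r (Suc n) (Cfg pc I R k) \<le> ennreal x" for k
  proof -
    obtain k1 k0 where k: "step prog D N (\<lambda>_. True) (Cfg pc I R k) = Cfg pc1 I1 R1 k1"
      "step prog D N (\<lambda>_. False) (Cfg pc I R k) = Cfg pc0 I0 R0 k0"
      using assms(1,2)[of k] by blast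
    have "exp_cost prog D N r (Suc n) (Cfg pc I R k) =
        1 + (exp_cost prog D N r n (Cfg pc1 I1 R1 k1) + exp_cost prog D N r n (Cfg pc0 I0 R0 k0)) / 2"
      by (simp only: exp_cost.simps k)
    also have "\<dots> \<le> 1 + (ennreal x1 + ennreal x0) / 2"
      using c unfolding cost_le_def
      by (intro add_left_mono divide_right_mono_ennreal add_mono) auto
    also have "\<dots> = ennreal (1 + (x1 + x0) / 2)"
      using c unfolding cost_le_def
      by (simp add: ennreal_plus[symmetric] divide_ennreal ennreal_numeral[symmetric]
          ennreal_1[symmetric] del: ennreal_plus ennreal_numeral ennreal_1)
    also have "1 + (x1 + x0) / 2 = x" using x by (simp add: field_simps)
    finally show ?thesis .
  qed
  moreover have "0 \<le> x" using x c unfolding cost_le_def by simp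
  ultimately show ?thesis unfolding cost_le_def by blast
qed

text \<open>Executing an instruction uses a unit of fuel, but less fuel never costs more. Dropping
  that unit keeps the same \<open>n\<close> before and after a command, so the rules
  compose.\<close>

lemma cost_le_Suc: "cost_le (Suc n) pc I R x \<Longrightarrow> cost_le n pc I R x"
  unfolding cost_le_def using exp_cost_mono order_trans by blast

lemma cost_le_step:
  assumes "\<And>cs k. step prog D N cs (Cfg pc I R k) = Cfg pc' I' R' k"
    and "cost_le n pc' I' R' (x - 1)"
  shows "cost_le (Suc n) pc I R x"
  by (rule cost_le_average[OF _ _ assms(2) assms(2)]) (auto simp only: assms(1) mult_2)

lemma basic_wp_sound:
  assumes "basic_wp D N b Q I R x" "pc < length prog" "prog ! pc = b"
    and Q: "\<And>I R x. Q I R x \<Longrightarrow> cost_le n (Suc pc) I R x"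
  shows "cost_le n pc I R x"
proof (rule cost_le_Suc, cases "\<exists>i. b = Coin i")
  case True
  then obtain i y where i: "b = Coin i" and 0: "Q (I(i := 0)) R y"
    and 1: "Q (I(i := 1)) R (2 * (x - 1) - y)"
    using assms(1) by auto
  show "cost_le (Suc n) pc I R x"
    by (rule cost_le_average[OF _ _ Q[OF 1] Q[OF 0]]) (use assms(2,3) i in auto)
next
  case False
  then show "cost_le (Suc n) pc I R x"
    using assms by (cases b) (auto intro!: cost_le_step[OF _ Q])
qed

lemma cost_le_Jmp:
  assumes "pc < length prog" "prog ! pc = Jmp t" "cost_le n t I R (x - 1)"
  shows "cost_le n pc I R x"
  by (rule cost_le_Suc, rule cost_le_step[OF _ assms(3)]) (simp add: assms)

lemma cost_le_JmpI:
  assumes "pc < length prog" "prog ! pc = JmpILess i j t"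
    "cost_le n (if I i < I j then t else Suc pc) I R (x - 1)"
  shows "cost_le n pc I R x"
  by (rule cost_le_Suc, rule cost_le_step[OF _ assms(3)]) (simp add: assms)

lemma cost_le_JmpR:
  assumes "pc < length prog" "prog ! pc = JmpRLess i j t"
    "cost_le n (if R i < R j then t else Suc pc) I R (x - 1)"
  shows "cost_le n pc I R x"
  by (rule cost_le_Suc, rule cost_le_step[OF _ assms(3)]) (simp add: assms)

lemma wp_sound:
  assumes "wp D N c Q I R x" "code_at prog a (compile a c)"
    and "\<And>I R x. Q I R x \<Longrightarrow> cost_le n (a + com_size c) I R x"
  shows "cost_le n a I R x"
  using assms
proof (induction c arbitrary: a Q I R x)
  case Skip
  then show ?case by simp
next
  case (Basic b)
  then show ?case by (auto intro: basic_wp_sound)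
next
  case (Seq c1 c2)
  show ?case
  proof (rule Seq.IH(1))
    show "wp D N c1 (wp D N c2 Q) I R x" using Seq.prems by simp
    show "code_at prog a (compile a c1)" using Seq.prems by (simp add: code_at_append)
    fix I R x assume "wp D N c2 Q I R x"
    then show "cost_le n (a + com_size c1) I R x"
      by (rule Seq.IH(2)) (use Seq.prems in \<open>simp_all add: code_at_append add.assoc\<close>)
  qed
next
  case (IfI i j c1 c2)
  note code = IfI.prems(2)[simplified, simplified code_at_append, simplified]
  show ?case
  proof (cases "I i < I j")
    case True
    have "cost_le n (a + com_size c2 + 2) I R (x - 1)"
      by (rule IfI.IH(1)[of Q]) (use True IfI.prems code in \<open>simp_all add: add.commute add.left_commute\<close>)
    then show ?thesis by - (rule cost_le_JmpI[where x = x and i = i and j = j], use True code in \<open>auto simp: add.commute add.left_commute\<close>)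
  next
    case False
    have "cost_le n (a + 1) I R (x - 1)"
    proof (rule IfI.IH(2)[of "\<lambda>I R x. Q I R (x - 1)"])
      show "wp D N c2 (\<lambda>I R x. Q I R (x - 1)) I R (x - 1)" using IfI.prems False by simp
      fix I R x assume "Q I R (x - 1)"
      then show "cost_le n (a + 1 + com_size c2) I R x"
        by - (rule cost_le_Jmp[where t = "a + com_size c1 + com_size c2 + 2"], use code IfI.prems(3)[of I R "x - 1"] in \<open>auto simp: add.commute add.left_commute\<close>)
    qed (use code in simp)
    then show ?thesis by - (rule cost_le_JmpI[where x = x and i = i and j = j], use False code in \<open>auto\<close>)
  qed
next
  case (IfR i j c1 c2)
  note code = IfR.prems(2)[simplified, simplified code_at_append, simplified]
  show ?case
  proof (cases "R i < R j")
    case True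
    have "cost_le n (a + com_size c2 + 2) I R (x - 1)"
      by (rule IfR.IH(1)[of Q]) (use True IfR.prems code in \<open>simp_all add: add.commute add.left_commute\<close>)
    then show ?thesis by - (rule cost_le_JmpR[where x = x and i = i and j = j], use True code in \<open>auto simp: add.commute add.left_commute\<close>)
  next
    case False
    have "cost_le n (a + 1) I R (x - 1)"
    proof (rule IfR.IH(2)[of "\<lambda>I R x. Q I R (x - 1)"])
      show "wp D N c2 (\<lambda>I R x. Q I R (x - 1)) I R (x - 1)" using IfR.prems False by simp
      fix I R x assume "Q I R (x - 1)"
      then show "cost_le n (a + 1 + com_size c2) I R x"
        by - (rule cost_le_Jmp[where t = "a + com_size c1 + com_size c2 + 2"], use code IfR.prems(3)[of I R "x - 1"] in \<open>auto simp: add.commute add.left_commute\<close>)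
    qed (use code in simp)
    then show ?thesis by - (rule cost_le_JmpR[where x = x and i = i and j = j], use False code in \<open>auto\<close>)
  qed
next
  case (WhileI i j c)
  note code = WhileI.prems(2)[simplified, simplified code_at_append, simplified]
  \<comment> \<open>\<open>cost_le n a\<close> is closed under a test followed by an iteration or an
    exit, so it contains the least fixed point.\<close>
  have "wp D N (WhileI i j c) Q \<le> cost_le n a"
    unfolding wp.simps
  proof (rule lfp_lowerbound, intro le_funI le_boolI)
    fix I R x
    assume h: "if I i < I j then wp D N c (\<lambda>I R x. cost_le n a I R (x - 1)) I R (x - 1) else Q I R (x - 2)"
    show "cost_le n a I R x"
    proof (cases "I i < I j")
      case True
      have "cost_le n (a + 2) I R (x - 1)"
      proof (rule WhileI.IH[of "\<lambda>I R x. cost_le n a I R (x - 1)"])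
        fix I R x assume "cost_le n a I R (x - 1)"
        then show "cost_le n (a + 2 + com_size c) I R x"
          by - (rule cost_le_Jmp[where t = a], use code in \<open>auto simp: add.commute add.left_commute\<close>)
      qed (use True h code in simp_all)
      then show ?thesis by - (rule cost_le_JmpI[where x = x and i = i and j = j], use True code in \<open>auto\<close>)
    next
      case False
      then have "cost_le n (a + com_size c + 3) I R (x - 2)" using h WhileI.prems(3) by (simp add: add.commute add.left_commute)
      then have "cost_le n (Suc a) I R (x - 1)"
        by - (rule cost_le_Jmp[where t = "a + com_size c + 3"], use code in \<open>auto simp: add.commute add.left_commute\<close>)
      then show ?thesis by - (rule cost_le_JmpI[where x = x and i = i and j = j], use False code in \<open>auto\<close>)
    qed
  qed
  then show ?case using WhileI.prems(1) by (auto simp: le_fun_def)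
next
  case (WhileR i j c)
  note code = WhileR.prems(2)[simplified, simplified code_at_append, simplified]
  have "wp D N (WhileR i j c) Q \<le> cost_le n a"
    unfolding wp.simps
  proof (rule lfp_lowerbound, intro le_funI le_boolI)
    fix I R x
    assume h: "if R i < R j then wp D N c (\<lambda>I R x. cost_le n a I R (x - 1)) I R (x - 1) else Q I R (x - 2)"
    show "cost_le n a I R x"
    proof (cases "R i < R j")
      case True
      have "cost_le n (a + 2) I R (x - 1)"
      proof (rule WhileR.IH[of "\<lambda>I R x. cost_le n a I R (x - 1)"])
        fix I R x assume "cost_le n a I R (x - 1)"
        then show "cost_le n (a + 2 + com_size c) I R x"
          by - (rule cost_le_Jmp[where t = a], use code in \<open>auto simp: add.commute add.left_commute\<close>)
      qed (use True h code in simp_all)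
      then show ?thesis by - (rule cost_le_JmpR[where x = x and i = i and j = j], use True code in \<open>auto\<close>)
    next
      case False
      then have "cost_le n (a + com_size c + 3) I R (x - 2)" using h WhileR.prems(3) by (simp add: add.commute add.left_commute)
      then have "cost_le n (Suc a) I R (x - 1)"
        by - (rule cost_le_Jmp[where t = "a + com_size c + 3"], use code in \<open>auto simp: add.commute add.left_commute\<close>)
      then show ?thesis by - (rule cost_le_JmpR[where x = x and i = i and j = j], use False code in \<open>auto\<close>)
    qed
  qed
  then show ?case using WhileR.prems(1) by (auto simp: le_fun_def)
qed

end

subsection \<open>Separating spheres in doubling metrics\<close>

lemma two_powr_doubling_dim:
  assumes m: "is_metric D N" and N: "0 < N"
  shows "real (doubling_const D N) = 2 powr doubling_dim D N"
    and "0 \<le> doubling_dim D N"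
    and "\<forall>p<N. \<forall>R>0. \<exists>Q. Q \<subseteq> {..<N} \<and> card Q \<le> doubling_const D N \<and>
       ball_idx D N p R \<subseteq> (\<Union>q\<in>Q. ball_idx D N q (R/2))"
proof -
  let ?P = "\<lambda>lam::nat. \<forall>p<N. \<forall>R>0. \<exists>Q. Q \<subseteq> {..<N} \<and> card Q \<le> lam \<and>
       ball_idx D N p R \<subseteq> (\<Union>q\<in>Q. ball_idx D N q (R/2))"
  \<comment> \<open>Taking every point as a centre always gives a cover, so the least constant
    exists and has the covering property itself.\<close>
  have "?P N"
  proof (intro allI impI)
    fix p R assume "p < N" "(R::real) > 0"
    then show "\<exists>Q. Q \<subseteq> {..<N} \<and> card Q \<le> N \<and>
       ball_idx D N p R \<subseteq> (\<Union>q\<in>Q. ball_idx D N q (R/2))"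
      using m by (intro exI[of _ "{..<N}"]) (auto simp: ball_idx_def is_metric_def)
  qed
  then show P: "?P (doubling_const D N)" unfolding doubling_const_def by (rule LeastI)
  have "doubling_const D N \<noteq> 0"
  proof
    assume 0: "doubling_const D N = 0"
    from P[rule_format, OF N, of 1, simplified] obtain Q where
      "Q \<subseteq> {..<N}" "card Q \<le> 0" "ball_idx D N 0 1 \<subseteq> (\<Union>q\<in>Q. ball_idx D N q (1/2))"
      unfolding 0 by auto
    moreover have "0 \<in> ball_idx D N 0 1" using N m by (auto simp: ball_idx_def is_metric_def)
    moreover have "finite Q" using \<open>Q \<subseteq> {..<N}\<close> finite_subset by blast
    ultimately show False by auto
  qed
  then show "real (doubling_const D N) = 2 powr doubling_dim D N" "0 \<le> doubling_dim D N"
    unfolding doubling_dim_def by (auto simp: Suc_leI)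
qed

text \<open>Among the elements \<open>U\<close> violating the condition take one with the largest
  value: its sublevel set contains all of \<open>U\<close>, yet has fewer than half of the elements
  of \<open>B\<close>.\<close>

lemma card_upper_half:
  fixes f :: "'a \<Rightarrow> real"
  assumes "finite B"
  shows "card B \<le> 2 * card {q\<in>B. card B \<le> 2 * card {x\<in>B. f x \<le> f q}}"
proof -
  define U where "U = {q\<in>B. 2 * card {x\<in>B. f x \<le> f q} < card B}"
  have "finite U" using assms by (simp add: U_def)
  have "2 * card U \<le> card B"
  proof (cases "U = {}")
    case False
    then have "Max (f ` U) \<in> f ` U" using \<open>finite U\<close> by (intro Max_in) auto
    then obtain q where q: "q \<in> U" "f q = Max (f ` U)" by auto
    then have "f x \<le> f q" if "x \<in> U" for x using that \<open>finite U\<close> by simp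
    then have "card U \<le> card {x\<in>B. f x \<le> f q}"
      using assms by (intro card_mono) (auto simp: U_def)
    then show ?thesis using q(1) by (auto simp: U_def)
  qed simp
  moreover have "{q\<in>B. card B \<le> 2 * card {x\<in>B. f x \<le> f q}} = B - U"
    by (auto simp: U_def)
  moreover have "card (B - U) = card B - card U"
    using \<open>finite U\<close> by (intro card_Diff_subset) (auto simp: U_def)
  ultimately show ?thesis by simp
qed

text \<open>Any upper bound \<open>L\<close> on the doubling constant will do; the program works
  with a power of two. The centres \<open>Q\<close> range over the whole space, so no argument needs
  the doubling dimension of a subset.\<close>

locale doubling_metric =
  fixes D :: "nat \<Rightarrow> nat \<Rightarrow> real" and N L :: nat
  assumes metric: "is_metric D N"
    and doubling: "\<And>p R. p < N \<Longrightarrow> 0 < R \<Longrightarrow>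
      \<exists>Q. Q \<subseteq> {..<N} \<and> card Q \<le> L \<and> ball_idx D N p R \<subseteq> (\<Union>q\<in>Q. ball_idx D N q (R/2))"
begin

lemma dist_refl: "x < N \<Longrightarrow> D x x = 0"
  and dist_pos: "x < N \<Longrightarrow> y < N \<Longrightarrow> x \<noteq> y \<Longrightarrow> 0 < D x y"
  and dist_sym: "x < N \<Longrightarrow> y < N \<Longrightarrow> D x y = D y x"
  and dist_triangle: "x < N \<Longrightarrow> y < N \<Longrightarrow> z < N \<Longrightarrow> D x z \<le> D x y + D y z"
  using metric unfolding is_metric_def by auto

lemma dist_nonneg: "x < N \<Longrightarrow> y < N \<Longrightarrow> 0 \<le> D x y"
  using dist_refl dist_pos by (metis less_eq_real_def)

lemma L_pos: "0 < N \<Longrightarrow> 0 < L"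
proof -
  assume N: "0 < N"
  obtain Q where Q: "Q \<subseteq> {..<N}" "card Q \<le> L" "ball_idx D N 0 1 \<subseteq> (\<Union>q\<in>Q. ball_idx D N q (1/2))"
    using doubling[OF N, of 1] by auto
  moreover have "0 \<in> ball_idx D N 0 1" using N dist_refl by (auto simp: ball_idx_def)
  moreover have "finite Q" using Q(1) finite_subset by blast
  ultimately show ?thesis by (cases "L = 0") auto
qed

lemma doubling_iterate:
  assumes "p < N" "0 < R"
  shows "\<exists>Q. Q \<subseteq> {..<N} \<and> card Q \<le> L ^ m \<and> ball_idx D N p R \<subseteq> (\<Union>q\<in>Q. ball_idx D N q (R / 2 ^ m))"
proof (induction m)
  case 0
  show ?case using assms by (intro exI[of _ "{p}"]) auto
next
  case (Suc m)
  then obtain Q where Q: "Q \<subseteq> {..<N}" "card Q \<le> L ^ m"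
    "ball_idx D N p R \<subseteq> (\<Union>q\<in>Q. ball_idx D N q (R / 2 ^ m))" by blast
  have "\<forall>q\<in>Q. \<exists>Q'. Q' \<subseteq> {..<N} \<and> card Q' \<le> L \<and>
      ball_idx D N q (R / 2 ^ m) \<subseteq> (\<Union>q'\<in>Q'. ball_idx D N q' (R / 2 ^ m / 2))"
    by (intro ballI doubling) (use Q(1) assms in auto)
  from bchoice[OF this] obtain F where F: "\<And>q. q \<in> Q \<Longrightarrow> F q \<subseteq> {..<N} \<and> card (F q) \<le> L \<and>
      ball_idx D N q (R / 2 ^ m) \<subseteq> (\<Union>q'\<in>F q. ball_idx D N q' (R / 2 ^ m / 2))" by blast
  have finQ: "finite Q" using Q(1) finite_subset by blast
  have "card (\<Union>q\<in>Q. F q) \<le> (\<Sum>q\<in>Q. card (F q))" by (rule card_UN_le[OF finQ])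
  also have "\<dots> \<le> (\<Sum>q\<in>Q. L)" using F by (intro sum_mono) auto
  also have "\<dots> = card Q * L" by simp
  also have "\<dots> \<le> L ^ Suc m" using Q(2) by (simp add: mult.commute mult_left_mono)
  finally have "card (\<Union>q\<in>Q. F q) \<le> L ^ Suc m" .
  moreover have "ball_idx D N p R \<subseteq> (\<Union>q'\<in>(\<Union>q\<in>Q. F q). ball_idx D N q' (R / 2 ^ Suc m))"
  proof
    fix x assume "x \<in> ball_idx D N p R"
    then obtain q where q: "q \<in> Q" "x \<in> ball_idx D N q (R / 2 ^ m)" using Q(3) by blast
    then obtain q' where "q' \<in> F q" "x \<in> ball_idx D N q' (R / 2 ^ m / 2)" using F by blast
    then show "x \<in> (\<Union>q'\<in>(\<Union>q\<in>Q. F q). ball_idx D N q' (R / 2 ^ Suc m))"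
      using q by (auto simp: field_simps)
  qed
  ultimately show ?case using F by (intro exI[of _ "\<Union>q\<in>Q. F q"]) auto
qed

text \<open>Pigeonhole: \<open>L ^ m\<close> balls of radius \<open>R / 2 ^ m\<close> cover
  \<open>S\<close>, so two of its points share one.\<close>

lemma packing:
  assumes "p < N" "0 < R" "S \<subseteq> ball_idx D N p R" "L ^ m < card S"
  shows "\<exists>x\<in>S. \<exists>y\<in>S. x \<noteq> y \<and> D x y \<le> 2 * (R / 2 ^ m)"
proof -
  obtain Q where Q: "Q \<subseteq> {..<N}" "card Q \<le> L ^ m"
    "ball_idx D N p R \<subseteq> (\<Union>q\<in>Q. ball_idx D N q (R / 2 ^ m))"
    using doubling_iterate[OF assms(1,2)] by blast
  have finQ: "finite Q" using Q(1) finite_subset by blast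
  have "\<forall>x\<in>S. \<exists>q\<in>Q. x \<in> ball_idx D N q (R / 2 ^ m)" using Q(3) assms(3) by blast
  then obtain f where f: "\<And>x. x \<in> S \<Longrightarrow> f x \<in> Q \<and> x \<in> ball_idx D N (f x) (R / 2 ^ m)" by metis
  have "\<not> inj_on f S"
  proof
    assume "inj_on f S"
    then have "card S \<le> card Q" using f finQ by (intro card_inj_on_le[of f]) auto
    then show False using assms(4) Q(2) by simp
  qed
  then obtain x y where xy: "x \<in> S" "y \<in> S" "x \<noteq> y" "f x = f y" by (auto simp: inj_on_def)
  have "D x y \<le> D x (f x) + D (f x) y"
    using f[OF xy(1)] f[OF xy(2)] Q(1) xy by (intro dist_triangle) (auto simp: ball_idx_def)
  also have "D x (f x) = D (f x) x"
    using f[OF xy(1)] Q(1) by (intro dist_sym) (auto simp: ball_idx_def)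
  also have "D (f x) x + D (f x) y \<le> 2 * (R / 2 ^ m)"
    using f[OF xy(1)] f[OF xy(2)] xy(4) by (auto simp: ball_idx_def)
  finally show ?thesis using xy by blast
qed

text \<open>Let \<open>r\<close> be the smallest radius of a ball around a point of \<open>S\<close> that contains a
  \<open>1/c\<close> fraction of \<open>S\<close>. If \<open>p\<close> and \<open>q\<close> both lie in such a ball, then the ball of radius
  \<open>2 * D p q \<le> 4 * r\<close> around \<open>p\<close> is covered by \<open>L ^ 4\<close> balls that are too small to contain this
  fraction. The ball of radius \<open>D p q\<close> is large if moreover \<open>q\<close> is in the farther half as seen
  from \<open>p\<close>.\<close>

lemma many_good_pairs:
  assumes S: "S \<subseteq> {..<N}" and c: "2 * L ^ 4 \<le> c" "c < card S"
  obtains G where "G \<subseteq> S \<times> S" "(card S)\<^sup>2 \<le> 2 * c\<^sup>2 * card G"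
    "\<And>p q. (p, q) \<in> G \<Longrightarrow> card S \<le> 2 * c * card {x\<in>S. D p x \<le> D p q}"
    "\<And>p q. (p, q) \<in> G \<Longrightarrow> 2 * card {x\<in>S. D p x \<le> 2 * D p q} \<le> card S"
proof -
  have finS: "finite S" using S finite_subset by blast
  define cnt where "cnt s r = card {x\<in>S. D s x \<le> r}" for s r
  \<comment> \<open>It suffices to look for the minimal radius among the finitely many distances
    within \<open>S\<close>: by \<open>attained\<close>, a ball can be shrunk to its farthest point
    in \<open>S\<close> without losing points.\<close>
  define X where "X = {D s x | s x. s \<in> S \<and> x \<in> S \<and> card S \<le> c * cnt s (D s x)}"
  have cnt_mono: "cnt s r \<le> cnt s r'" if "r \<le> r'" for s r r'
    unfolding cnt_def using that finS by (intro card_mono) auto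
  have L0: "0 < L" using L_pos S c by (cases "N = 0") auto
  have c0: "2 \<le> c"
  proof -
    have "1 \<le> L ^ 4" using L0 by simp
    then show ?thesis using c by linarith
  qed
  have attained: "\<exists>x\<in>S. D s x \<le> r \<and> cnt s (D s x) = cnt s r" if "s \<in> S" "card S \<le> c * cnt s r" for s r
  proof -
    define Y where "Y = {x\<in>S. D s x \<le> r}"
    have "card Y \<noteq> 0" using that(2) c(2) unfolding cnt_def Y_def[symmetric] by (metis mult_0_right not_less0 order_less_le_trans)
    then have "Y \<noteq> {}" by auto
    have "finite Y" using finS by (simp add: Y_def)
    have "Max (D s ` Y) \<in> D s ` Y" using \<open>Y \<noteq> {}\<close> \<open>finite Y\<close> by (intro Max_in) auto
    then obtain x where x: "x \<in> Y" "D s x = Max (D s ` Y)" by auto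
    then have "D s y \<le> D s x" if "y \<in> Y" for y using that \<open>finite Y\<close> by simp
    then have "{y\<in>S. D s y \<le> D s x} = Y" using x by (auto simp: Y_def)
    then show ?thesis using x(1) by (auto simp: cnt_def Y_def)
  qed
  have finX: "finite X"
    by (rule finite_subset[of _ "(\<lambda>(s, x). D s x) ` (S \<times> S)"]) (auto simp: X_def finS)
  obtain s0 where "s0 \<in> S" using c by fastforce
  have "X \<noteq> {}"
  proof -
    have "{x\<in>S. D s0 x \<le> Max (D s0 ` S)} = S" using finS by auto
    then have "cnt s0 (Max (D s0 ` S)) = card S" by (simp add: cnt_def)
    then have "card S \<le> c * cnt s0 (Max (D s0 ` S))" using c0 by simp
    from attained[OF \<open>s0 \<in> S\<close> this] obtain x where "x \<in> S"
      "cnt s0 (D s0 x) = cnt s0 (Max (D s0 ` S))" by blast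
    then show ?thesis using \<open>s0 \<in> S\<close> \<open>card S \<le> c * cnt s0 (Max (D s0 ` S))\<close>
      unfolding X_def by fastforce
  qed
  define r where "r = Min X"
  have "r \<in> X" unfolding r_def using finX \<open>X \<noteq> {}\<close> by (rule Min_in)
  then obtain s x where s: "s \<in> S" "x \<in> S" "r = D s x" "card S \<le> c * cnt s r"
    unfolding X_def by auto
  have small: "c * cnt t r' < card S" if t: "t \<in> S" "r' < r" for t r'
  proof (rule ccontr)
    assume "\<not> ?thesis"
    then have big: "card S \<le> c * cnt t r'" by simp
    then obtain x where "x \<in> S" "D t x \<le> r'" "cnt t (D t x) = cnt t r'"
      using attained[OF t(1) big] by blast
    then have "D t x \<in> X" unfolding X_def using t(1) big by (intro CollectI exI[of _ t] exI[of _ x]) auto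
    then have "r \<le> D t x" unfolding r_def using finX by simp
    then show False using \<open>D t x \<le> r'\<close> t(2) by simp
  qed
  \<comment> \<open>Otherwise the extremal ball would contain only its centre \<open>s\<close>,
    whereas it has at least \<open>card S / c > 1\<close> points.\<close>
  have rpos: "0 < r"
  proof (rule ccontr)
    assume "\<not> 0 < r"
    then have "r \<le> 0" by simp
    have "{y\<in>S. D s y \<le> r} \<subseteq> {s}"
      using dist_pos[of s] s(1) S \<open>r \<le> 0\<close> by force
    then have "cnt s r \<le> card {s}" unfolding cnt_def by (intro card_mono) auto
    then have "c * cnt s r \<le> c * 1" by (intro mult_le_mono) auto
    then show False using s(4) c by linarith
  qed
  define B where "B = {y\<in>S. D s y \<le> r}"
  have finB: "finite B" using finS by (simp add: B_def)
  have BS: "B \<subseteq> S" by (auto simp: B_def)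
  have cB: "card S \<le> c * card B" using s(4) by (simp add: cnt_def B_def)
  define H where "H p = {q\<in>B. card B \<le> 2 * card {x\<in>B. D p x \<le> D p q}}" for p
  define G where "G = Sigma B H"
  have "G \<subseteq> S \<times> S" using BS by (auto simp: G_def H_def)
  moreover have "(card S)\<^sup>2 \<le> 2 * c\<^sup>2 * card G"
  proof -
    have "card B * card B = (\<Sum>p\<in>B. card B)" by simp
    also have "\<dots> \<le> (\<Sum>p\<in>B. 2 * card (H p))"
      unfolding H_def by (intro sum_mono card_upper_half finB)
    also have "\<dots> = 2 * card G"
      unfolding G_def using finB by (subst card_SigmaI) (auto simp: H_def sum_distrib_left)
    finally have *: "card B * card B \<le> 2 * card G" .
    have "(card S)\<^sup>2 \<le> (c * card B)\<^sup>2" using cB by (rule power_mono) simp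
    also have "\<dots> = c\<^sup>2 * (card B * card B)" by (simp add: power2_eq_square)
    also have "\<dots> \<le> c\<^sup>2 * (2 * card G)" using * by (rule mult_left_mono) simp
    finally show ?thesis by (simp add: ac_simps)
  qed
  moreover have "card S \<le> 2 * c * card {x\<in>S. D p x \<le> D p q}" if "(p, q) \<in> G" for p q
  proof -
    have "card B \<le> 2 * card {x\<in>B. D p x \<le> D p q}" using that by (auto simp: G_def H_def)
    also have "\<dots> \<le> 2 * card {x\<in>S. D p x \<le> D p q}"
      using finS BS by (intro mult_left_mono card_mono) auto
    finally have "c * card B \<le> c * (2 * card {x\<in>S. D p x \<le> D p q})" by (rule mult_left_mono) simp
    then show ?thesis using cB by (simp only: ac_simps)
  qed
  moreover have "2 * card {x\<in>S. D p x \<le> 2 * D p q} \<le> card S" if "(p, q) \<in> G" for p q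
  proof -
    have pq: "p \<in> S" "q \<in> S" "D s p \<le> r" "D s q \<le> r" using that by (auto simp: G_def H_def B_def)
    then have N: "p < N" "q < N" "s < N" using S s by auto
    have "D p q \<le> D p s + D s q" using N by (intro dist_triangle)
    also have "\<dots> \<le> 2 * r" using pq dist_sym N by auto
    finally have pq2: "2 * D p q \<le> 4 * r" by simp
    obtain Q where Q: "Q \<subseteq> {..<N}" "card Q \<le> L ^ 4"
      "ball_idx D N p (4 * r) \<subseteq> (\<Union>q\<in>Q. ball_idx D N q (4 * r / 2 ^ 4))"
      using doubling_iterate[OF N(1), of "4 * r" 4] rpos by auto
    have finQ: "finite Q" using Q(1) finite_subset by blast
    \<comment> \<open>Minimality of \<open>r\<close> speaks only about centres in \<open>S\<close>,
      which the centre of a covering ball need not be. Recentring at a point \<open>t\<close> of the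
      piece doubles its radius \<open>r / 4\<close> to \<open>r / 2 < r\<close>; three halvings
      would only give \<open>r\<close>, whence the exponent 4.\<close>
    have piece: "c * card (S \<inter> ball_idx D N q (4 * r / 2 ^ 4)) \<le> card S" if "q \<in> Q" for q
    proof (cases "S \<inter> ball_idx D N q (4 * r / 2 ^ 4) = {}")
      case False
      then obtain t where t: "t \<in> S" "t < N" "D q t \<le> r / 4" by (auto simp: ball_idx_def)
      have "q < N" using that Q(1) by auto
      have "S \<inter> ball_idx D N q (4 * r / 2 ^ 4) \<subseteq> {x\<in>S. D t x \<le> r / 2}"
      proof (safe)
        fix x assume x: "x \<in> S" "x \<in> ball_idx D N q (4 * r / 2 ^ 4)"
        then have "D t x \<le> D t q + D q x" using t \<open>q < N\<close> by (intro dist_triangle) (auto simp: ball_idx_def)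
        then show "D t x \<le> r / 2" using t x dist_sym[OF t(2) \<open>q < N\<close>] by (auto simp: ball_idx_def)
      qed
      then have "card (S \<inter> ball_idx D N q (4 * r / 2 ^ 4)) \<le> cnt t (r / 2)"
        unfolding cnt_def using finS by (intro card_mono) auto
      then have "c * card (S \<inter> ball_idx D N q (4 * r / 2 ^ 4)) \<le> c * cnt t (r / 2)"
        by (rule mult_left_mono) simp
      also have "\<dots> < card S" using small[OF t(1), of "r / 2"] rpos by simp
      finally show ?thesis by simp
    qed simp
    have "{x\<in>S. D p x \<le> 2 * D p q} \<subseteq> (\<Union>q\<in>Q. S \<inter> ball_idx D N q (4 * r / 2 ^ 4))"
      using Q(3) pq2 S by (fastforce simp: ball_idx_def)
    then have "card {x\<in>S. D p x \<le> 2 * D p q} \<le> card (\<Union>q\<in>Q. S \<inter> ball_idx D N q (4 * r / 2 ^ 4))"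
      using finQ finS by (intro card_mono) auto
    also have "\<dots> \<le> (\<Sum>q\<in>Q. card (S \<inter> ball_idx D N q (4 * r / 2 ^ 4)))" by (rule card_UN_le[OF finQ])
    finally have "c * card {x\<in>S. D p x \<le> 2 * D p q} \<le> c * (\<Sum>q\<in>Q. card (S \<inter> ball_idx D N q (4 * r / 2 ^ 4)))"
      by (rule mult_left_mono) simp
    also have "\<dots> = (\<Sum>q\<in>Q. c * card (S \<inter> ball_idx D N q (4 * r / 2 ^ 4)))" by (rule sum_distrib_left)
    also have "\<dots> \<le> (\<Sum>q\<in>Q. card S)" using piece by (intro sum_mono) auto
    also have "\<dots> = card Q * card S" by simp
    also have "\<dots> \<le> L ^ 4 * card S" using Q(2) by (rule mult_right_mono) simp
    finally have *: "c * card {x\<in>S. D p x \<le> 2 * D p q} \<le> L ^ 4 * card S" .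
    have "L ^ 4 * (2 * card {x\<in>S. D p x \<le> 2 * D p q}) \<le> c * card {x\<in>S. D p x \<le> 2 * D p q}"
      using mult_right_mono[OF c(1), of "card {x\<in>S. D p x \<le> 2 * D p q}"] by (simp add: ac_simps)
    then have "L ^ 4 * (2 * card {x\<in>S. D p x \<le> 2 * D p q}) \<le> L ^ 4 * card S" using * by (rule order_trans)
    then show ?thesis using L0 by simp
  qed
  ultimately show ?thesis by (rule that)
qed

end

section \<open>Random shells: acceptance probability, separation and potential\<close>

text \<open>The increments of \<open>g\<close> add up to at most \<open>n\<close>, so at most
  \<open>m\<close> of them exceed \<open>n / m\<close>, and this is at most half of all
  \<open>T\<close>.\<close>

lemma sparse_steps:
  fixes g :: "nat \<Rightarrow> nat"
  assumes "mono g" "g T \<le> n" "2 * m \<le> T" "0 < n"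
  shows "T \<le> 2 * card {j\<in>{..<T}. m * (g (Suc j) - g j) \<le> n}"
proof -
  define bad where "bad = {j\<in>{..<T}. n < m * (g (Suc j) - g j)}"
  have "card bad * n = (\<Sum>j\<in>bad. n)" by simp
  also have "\<dots> \<le> (\<Sum>j\<in>bad. m * (g (Suc j) - g j))" by (rule sum_mono) (auto simp: bad_def)
  also have "\<dots> \<le> (\<Sum>j<T. m * (g (Suc j) - g j))" by (rule sum_mono2) (auto simp: bad_def)
  also have "\<dots> = m * (\<Sum>j<T. g (Suc j) - g j)" by (rule sum_distrib_left[symmetric])
  also have "(\<Sum>j<T. g (Suc j) - g j) = g T - g 0"
  proof (induction T)
    case (Suc T)
    then show ?case using monoD[OF \<open>mono g\<close>, of 0 T] monoD[OF \<open>mono g\<close>, of T "Suc T"] by simp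
  qed simp
  also have "m * (g T - g 0) \<le> m * n" using assms(2) by (intro mult_left_mono) auto
  finally have "card bad \<le> m" using \<open>0 < n\<close> by simp
  moreover have "{j\<in>{..<T}. m * (g (Suc j) - g j) \<le> n} = {..<T} - bad" by (auto simp: bad_def)
  moreover have "card ({..<T} - bad) = T - card bad"
    by (subst card_Diff_subset) (auto simp: bad_def)
  ultimately show ?thesis using assms(3) by simp
qed

definition inner_part :: "(nat \<Rightarrow> nat \<Rightarrow> real) \<Rightarrow> nat list \<Rightarrow> nat \<Rightarrow> real \<Rightarrow> nat list" where
  "inner_part D s p \<theta> = filter (\<lambda>x. \<not> \<theta> < D p x) s"

definition outer_part :: "(nat \<Rightarrow> nat \<Rightarrow> real) \<Rightarrow> nat list \<Rightarrow> nat \<Rightarrow> real \<Rightarrow> nat list" where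
  "outer_part D s p \<theta> = filter (\<lambda>x. \<theta> < D p x) s"

text \<open>This is a radius: it runs from \<open>D p q\<close> at \<open>j = 0\<close> to
  \<open>2 * D p q\<close> at \<open>j = T\<close> in equal steps. The shell with index
  \<open>j\<close> lies between the radii for \<open>j\<close> and \<open>Suc j\<close>.\<close>

definition shell :: "(nat \<Rightarrow> nat \<Rightarrow> real) \<Rightarrow> nat \<Rightarrow> nat \<Rightarrow> nat \<Rightarrow> nat \<Rightarrow> real" where
  "shell D p q T j = D p q + real j * (D p q / real T)"

text \<open>The first test provides enough points for the packing argument and for the drop of the
  potential, the second makes the logarithm of the inner part smaller by 1, the third bounds the
  points that end up in both parts.\<close>

definition accept :: "(nat \<Rightarrow> nat \<Rightarrow> real) \<Rightarrow> nat \<Rightarrow> nat \<Rightarrow> nat list \<Rightarrow> nat \<Rightarrow> nat \<Rightarrow> nat \<Rightarrow> nat \<Rightarrow> bool" where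
  "accept D c m s p q T j \<longleftrightarrow>
     (let n = length s; a = length (inner_part D s p (shell D p q T j));
          b = length (inner_part D s p (shell D p q T (Suc j)))
      in n \<le> 2 * c * a \<and> 2 * b \<le> n \<and> m * (b - a) \<le> n)"

lemma length_parts: "length (inner_part D s p \<theta>) + length (outer_part D s p \<theta>) = length s"
  unfolding inner_part_def outer_part_def using sum_length_filter_compl[of "\<lambda>x. \<theta> < D p x" s] by simp

lemma length_inner_part:
  "distinct s \<Longrightarrow> length (inner_part D s p \<theta>) = card {x\<in>set s. D p x \<le> \<theta>}"
  unfolding inner_part_def by (simp add: distinct_length_filter not_less Int_def conj_commute)

context doubling_metric
begin

lemma accept_pair:
  assumes s: "distinct s" "set s \<subseteq> {..<N}" and pq: "p \<in> set s" "q \<in> set s"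
    and c: "2 * c * L ^ (k + 2) < length s" and T: "T = 2 ^ k" "j < T"
    and acc: "accept D c m s p q T j"
    and xy: "x \<in> set s" "y \<in> set s"
    and min: "\<And>u v. u \<in> set s \<Longrightarrow> v \<in> set s \<Longrightarrow> u \<noteq> v \<Longrightarrow> D x y \<le> D u v"
  shows "{x, y} \<subseteq> set (inner_part D s p (shell D p q T (Suc j))) \<or> {x, y} \<subseteq> set (outer_part D s p (shell D p q T j))"
proof -
  define \<rho> where "\<rho> = shell D p q T j"
  define w where "w = D p q / real T"
  define A where "A = {x\<in>set s. D p x \<le> \<rho>}"
  have N: "p < N" "q < N" "x < N" "y < N" using s pq xy by auto
  have \<rho>: "shell D p q T (Suc j) = \<rho> + w" "\<rho> = D p q + real j * w"
    by (auto simp: shell_def \<rho>_def w_def add_divide_distrib distrib_right)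
  have "length s \<le> 2 * c * card A"
    using acc s(1) by (simp add: accept_def Let_def length_inner_part A_def \<rho>_def)
  then have "2 * c * L ^ (k + 2) < 2 * c * card A" using c by linarith
  then have cA: "L ^ (k + 2) < card A" by simp
  have "0 < L" using L_pos N by simp
  \<comment> \<open>The draw may yield \<open>p = q\<close>. Then all radii are 0 and the inner ball
    is a single point, too small for the first test.\<close>
  have "0 < D p q"
  proof (rule ccontr)
    assume "\<not> 0 < D p q"
    then have "D p q = 0" using dist_nonneg[OF N(1,2)] by simp
    then have "\<rho> = 0" by (simp add: \<rho>(2) w_def)
    then have "A \<subseteq> {p}" using dist_pos[OF N(1)] s by (force simp: A_def)
    then have "card A \<le> card {p}" by (intro card_mono) auto
    moreover have "1 \<le> L ^ (k + 2)" using \<open>0 < L\<close> by simp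
    ultimately show False using cA by simp
  qed
  have "real j * w \<le> real T * w" using T(2) \<open>0 < D p q\<close> by (intro mult_right_mono) (auto simp: w_def)
  also have "real T * w = D p q" using T by (simp add: w_def)
  finally have \<rho>2: "\<rho> \<le> 2 * D p q" by (simp add: \<rho>(2))
  have "A \<subseteq> ball_idx D N p (2 * D p q)" using s \<rho>2 by (auto simp: A_def ball_idx_def)
  \<comment> \<open>The 2 in the exponent \<open>k + 2\<close> absorbs one factor 2 from the radius
    \<open>2 * D p q\<close> and one from \<open>packing\<close>, which leaves exactly
    \<open>w\<close>.\<close>
  from packing[OF N(1) _ this cA] \<open>0 < D p q\<close> obtain u v where
    uv: "u \<in> A" "v \<in> A" "u \<noteq> v" "D u v \<le> 2 * (2 * D p q / 2 ^ (k + 2))" by auto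
  have "D x y \<le> D u v" using uv by (intro min) (auto simp: A_def)
  also have "\<dots> \<le> w" using uv(4) by (simp add: w_def T field_simps)
  finally have xyw: "D x y \<le> w" .
  \<comment> \<open>Distances from \<open>p\<close> differ by at most \<open>w\<close>: if one point
    lies beyond the outer sphere, the other lies beyond the inner one, and both are in the outer
    part.\<close>
  have "D p x \<le> D p y + D x y" "D p y \<le> D p x + D x y"
    using dist_triangle[of p y x] dist_triangle[of p x y] dist_sym[of x y] N by auto
  then show ?thesis
    using xyw xy unfolding \<rho> \<rho>_def[symmetric] inner_part_def outer_part_def by auto
qed

text \<open>The factor 16 is a product: \<open>P * P\<close> exceeds the number of pairs by at most
  4, one pair in \<open>2 * c\<^sup>2\<close> is good, and for a good pair at least half of the
  shells pass the third test. The other two tests hold for all shells of a good pair.\<close>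

lemma many_accepted:
  assumes s: "distinct s" "set s \<subseteq> {..<N}" and c: "2 * L ^ 4 \<le> c" "2 * c < length s"
    and P: "length s \<le> P" "P \<le> 2 * length s" and T: "2 * m \<le> T" "0 < T"
  shows "P * P * T \<le> 16 * c\<^sup>2 * card {z\<in>{..<P * P * T}.
    accept D c m s (s ! (z mod P mod length s)) (s ! (z div P mod P mod length s)) T (z div P div P)}"
    (is "_ \<le> _ * card ?Z")
proof -
  define n where "n = length s"
  have n: "card (set s) = n" "0 < n" using s c by (auto simp: distinct_card n_def)
  obtain G where G: "G \<subseteq> set s \<times> set s" "n\<^sup>2 \<le> 2 * c\<^sup>2 * card G"
    "\<And>p q. (p, q) \<in> G \<Longrightarrow> n \<le> 2 * c * card {x\<in>set s. D p x \<le> D p q}"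
    "\<And>p q. (p, q) \<in> G \<Longrightarrow> 2 * card {x\<in>set s. D p x \<le> 2 * D p q} \<le> n"
    by (rule many_good_pairs[OF s(2) c(1)]) (use c n n_def in auto)
  have finG: "finite G" by (rule finite_subset[OF G(1)]) auto
  define J where "J pq = {j\<in>{..<T}. accept D c m s (fst pq) (snd pq) T j}" for pq
  have J: "T \<le> 2 * card (J pq)" if "pq \<in> G" for pq
  proof -
    obtain p q where pq: "pq = (p, q)" "(p, q) \<in> G" using \<open>pq \<in> G\<close> by (metis prod.exhaust)
    have N: "p < N" "q < N" using pq G(1) s(2) by auto
    define g where "g j = card {x\<in>set s. D p x \<le> shell D p q T j}" for j
    have shell_mono: "shell D p q T i \<le> shell D p q T j" if "i \<le> j" for i j
      unfolding shell_def using that dist_nonneg[OF N] by (intro add_left_mono mult_right_mono) auto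
    have g_mono: "mono g"
    proof (rule monoI)
      fix i j :: nat assume "i \<le> j"
      then show "g i \<le> g j" unfolding g_def
        using shell_mono[of i j] by (intro card_mono) auto
    qed
    have shell_ends: "shell D p q T 0 = D p q" "shell D p q T T = 2 * D p q"
      using T by (auto simp: shell_def)
    have "g T \<le> n" unfolding g_def n(1)[symmetric] by (rule card_mono) auto
    then have "T \<le> 2 * card {j\<in>{..<T}. m * (g (Suc j) - g j) \<le> n}"
      by (intro sparse_steps g_mono T n)
    also have "{j\<in>{..<T}. m * (g (Suc j) - g j) \<le> n} \<subseteq> J pq"
    proof
      fix j assume j: "j \<in> {j\<in>{..<T}. m * (g (Suc j) - g j) \<le> n}"
      have "n \<le> 2 * c * g 0" using G(3)[OF pq(2)] by (simp add: g_def shell_ends)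
      also have "\<dots> \<le> 2 * c * g j" using g_mono by (intro mult_left_mono) (auto simp: mono_def)
      finally have 1: "n \<le> 2 * c * g j" .
      have "2 * g (Suc j) \<le> 2 * g T" using g_mono j by (intro mult_left_mono) (auto simp: mono_def)
      also have "\<dots> \<le> n" using G(4)[OF pq(2)] by (simp add: g_def shell_ends)
      finally show "j \<in> J pq" using 1 j s(1)
        by (simp add: J_def pq(1) accept_def Let_def length_inner_part g_def n_def)
    qed
    then have "card {j\<in>{..<T}. m * (g (Suc j) - g j) \<le> n} \<le> card (J pq)"
      by (intro card_mono) (auto simp: J_def)
    finally show ?thesis by simp
  qed
  have "\<forall>x\<in>set s. \<exists>i<n. s ! i = x" by (auto simp: in_set_conv_nth n_def)
  then obtain idx where idx: "\<And>x. x \<in> set s \<Longrightarrow> idx x < n \<and> s ! idx x = x" by metis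
  \<comment> \<open>Numbers below \<open>P * P * T\<close> are read as digits in base
    \<open>P\<close>. Several digits decode to the same index modulo \<open>length s\<close>;
    counting only the digit equal to the index loses at most the factor allowed by
    \<open>P \<le> 2 * length s\<close>.\<close>
  define enc where "enc = (\<lambda>((p, q), j). idx p + P * (idx q + P * j))"
  have "0 < P" using n P unfolding n_def by linarith
  have dec: "enc ((p, q), j) mod P mod n = idx p" "enc ((p, q), j) div P mod P mod n = idx q"
    "enc ((p, q), j) div P div P = j" if "p \<in> set s" "q \<in> set s" for p q j
  proof -
    have "idx p < n" "idx q < n" "n \<le> P" using idx that P by (auto simp: n_def)
    then show "enc ((p, q), j) mod P mod n = idx p" "enc ((p, q), j) div P mod P mod n = idx q"
      "enc ((p, q), j) div P div P = j" using \<open>0 < P\<close> by (auto simp: enc_def)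
  qed
  have "card (Sigma G J) \<le> card ?Z"
  proof (rule card_inj_on_le[of enc])
    show "inj_on enc (Sigma G J)"
    proof (rule inj_onI)
      fix u v assume "u \<in> Sigma G J" "v \<in> Sigma G J" "enc u = enc v"
      moreover obtain p q j where u: "u = ((p, q), j)" by (metis prod.exhaust)
      moreover obtain p' q' j' where v: "v = ((p', q'), j')" by (metis prod.exhaust)
      ultimately have h: "(p, q) \<in> G" "(p', q') \<in> G" "enc ((p, q), j) = enc ((p', q'), j')" by auto
      then have set: "p \<in> set s" "q \<in> set s" "p' \<in> set s" "q' \<in> set s" using G(1) by auto
      have "idx p = idx p'" "idx q = idx q'" "j = j'"
        using dec[OF set(1,2), of j] dec[OF set(3,4), of j'] h(3) by auto
      then show "u = v" using idx set unfolding u v by metis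
    qed
    show "enc ` Sigma G J \<subseteq> ?Z"
    proof
      fix z assume "z \<in> enc ` Sigma G J"
      then obtain p q j where h: "(p, q) \<in> G" "j \<in> J (p, q)" and z: "z = enc ((p, q), j)" by auto
      then have set: "p \<in> set s" "q \<in> set s" using G(1) by auto
      have "enc ((p, q), j) < P * P * T"
      proof -
        have "idx p < P" "idx q < P" "j < T" using idx set P h by (auto simp: n_def J_def dest: order_less_le_trans)
        then have "idx q + P * j < P * T"
          using mult_le_mono2[of "Suc j" T P] by (simp del: mult_le_cancel1)
        then have "P * Suc (idx q + P * j) \<le> P * (P * T)" by (intro mult_le_mono2) simp
        then show ?thesis using \<open>idx p < P\<close> by (simp add: enc_def mult.assoc)
      qed
      then show "z \<in> ?Z" unfolding z
        using h(2) set dec[OF set, of j] idx by (simp add: J_def n_def[symmetric])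
    qed
  qed auto
  also have "card (Sigma G J) = (\<Sum>pq\<in>G. card (J pq))"
    using finG by (intro card_SigmaI) (auto simp: J_def)
  finally have Z: "(\<Sum>pq\<in>G. card (J pq)) \<le> card ?Z" .
  have "card G * T = (\<Sum>pq\<in>G. T)" by simp
  also have "\<dots> \<le> (\<Sum>pq\<in>G. 2 * card (J pq))" by (rule sum_mono) (rule J)
  also have "\<dots> \<le> 2 * card ?Z" using Z by (simp add: sum_distrib_left[symmetric])
  finally have GT: "card G * T \<le> 2 * card ?Z" .
  have "P * P * T \<le> (2 * n) * (2 * n) * T" using P by (intro mult_le_mono) (auto simp: n_def)
  also have "\<dots> = 4 * T * n\<^sup>2" by (simp add: power2_eq_square)
  also have "\<dots> \<le> 4 * T * (2 * c\<^sup>2 * card G)" using G(2) by (rule mult_left_mono) simp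
  also have "\<dots> = 8 * c\<^sup>2 * (card G * T)" by simp
  also have "\<dots> \<le> 8 * c\<^sup>2 * (2 * card ?Z)" using GT by (rule mult_left_mono) simp
  finally show ?thesis by simp
qed

end

text \<open>The \<open>b \<ge> n / (2 * c)\<close> points inside the outer sphere move to a set of
  at most half the size and gain 1 each. The \<open>b - a \<le> n / (4 * c * K)\<close> duplicates
  cost at most \<open>log 2 n \<le> K\<close> each. This leaves a gain of
  \<open>n / (4 * c)\<close>.\<close>

lemma accept_potential:
  assumes acc: "accept D c m s p q T j" and n: "length s \<le> 2 ^ K" "0 < length s"
    and m: "m = 4 * c * K" and mono: "D p q \<ge> 0"
  defines "f \<equiv> \<lambda>n::nat. real n * log 2 (real n)"
  shows "f (length (inner_part D s p (shell D p q T (Suc j)))) + f (length (outer_part D s p (shell D p q T j)))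
    \<le> f (length s) - real (length s) / (4 * real c)"
proof -
  define n where "n = length s"
  define a where "a = length (inner_part D s p (shell D p q T j))"
  define b where "b = length (inner_part D s p (shell D p q T (Suc j)))"
  define e where "e = length (outer_part D s p (shell D p q T j))"
  have e: "a + e = n" unfolding a_def e_def n_def by (rule length_parts)
  have h: "n \<le> 2 * c * a" "2 * b \<le> n" "m * (b - a) \<le> n"
    using acc by (auto simp: accept_def Let_def a_def b_def n_def)
  have n0: "0 < n" using assms by (simp add: n_def)
  have c0: "0 < c" using h n0 by (cases c) auto
  have shell_mono: "shell D p q T j \<le> shell D p q T (Suc j)"
    unfolding shell_def using mono by (intro add_left_mono mult_right_mono) auto
  have ab: "a \<le> b"
  proof -
    have "inner_part D s p (shell D p q T j) = filter (\<lambda>x. \<not> shell D p q T j < D p x) (inner_part D s p (shell D p q T (Suc j)))"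
      unfolding inner_part_def filter_filter using shell_mono by (intro filter_cong) auto
    then show ?thesis unfolding a_def b_def by (metis length_filter_le)
  qed
  have "0 < a" using h n0 by (cases a) auto
  have "log 2 b \<le> log 2 (n / 2)" using h(2) \<open>0 < a\<close> ab by (subst log_le_cancel_iff) auto
  also have "\<dots> = log 2 n - 1" using n0 by (simp add: log_divide)
  finally have "f b \<le> b * (log 2 n - 1)" unfolding f_def by (rule mult_left_mono) simp
  moreover have "f e \<le> e * log 2 n"
  proof (cases "e = 0")
    case False
    then have "log 2 e \<le> log 2 n" using e by (subst log_le_cancel_iff) auto
    then show ?thesis unfolding f_def by (rule mult_left_mono) simp
  qed (simp add: f_def)
  ultimately have 1: "f b + f e \<le> (b + e) * log 2 n - b" by (simp add: algebra_simps)
  have logn: "log 2 n \<le> K"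
  proof -
    have "real n \<le> 2 ^ K" using n(1) by (metis n_def of_nat_le_iff of_nat_numeral of_nat_power)
    then show ?thesis using n0 by (simp add: log_le_iff powr_realpow)
  qed
  have "real (b + e) = real n + real (b - a)" using e ab by (simp add: of_nat_diff)
  then have "(b + e) * log 2 n = f n + real (b - a) * log 2 n" by (simp add: f_def algebra_simps)
  also have "real (b - a) * log 2 n \<le> real (b - a) * K" using logn by (rule mult_left_mono) simp
  also have "real (b - a) * K \<le> n / (4 * c)"
  proof -
    have "real (m * (b - a)) \<le> real n" using h(3) by (rule of_nat_mono)
    then show ?thesis using c0 by (simp add: m field_simps del: of_nat_diff)
  qed
  finally have 2: "(b + e) * log 2 n \<le> f n + n / (4 * c)" by simp
  have "real n \<le> real (2 * c * a)" using h(1) by (rule of_nat_mono)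
  also have "\<dots> \<le> 2 * c * real b" using ab by (simp add: mult_left_mono)
  finally have "real n / (2 * c) \<le> b" using c0 by (simp add: field_simps)
  then have "f b + f e \<le> f n + n / (4 * c) - n / (2 * c)" using 1 2 by simp
  also have "\<dots> = f n - n / (4 * c)" by (simp add: field_simps)
  finally show ?thesis unfolding b_def e_def n_def by simp
qed

text \<open>Meant for \<open>L = 2 ^ a\<close>: since \<open>2 ^ k = O(K)\<close>, the power
  \<open>(2 ^ a) ^ k = (2 ^ k) ^ a\<close> is polynomial in \<open>K\<close>, hence polylogarithmic
  in \<open>n\<close>. The threshold depends on \<open>a\<close>, so it is constant only because the
  dimension is fixed.\<close>

lemma polylog_eventually_small:
  fixes e E a :: nat
  shows "\<exists>n0. \<forall>n K k::nat. n0 \<le> n \<longrightarrow> n \<le> 2 ^ K \<longrightarrow> 2 ^ K < 2 * n \<longrightarrow> 2 ^ k \<le> e * K \<longrightarrow> E * (2 ^ a) ^ k < n"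
proof -
  have lim: "(\<lambda>K::nat. real K ^ a * (1/2) ^ K) \<longlonglongrightarrow> 0"
  proof -
    have "((\<lambda>K::nat. (real K * ln 2) ^ a / exp (real K * ln 2)) \<longlonglongrightarrow> 0)"
      by (rule filterlim_compose[OF tendsto_power_div_exp_0])
        (auto intro!: filterlim_tendsto_pos_mult_at_top[OF tendsto_const] filterlim_real_sequentially simp: mult.commute[of _ "ln 2"])
    then have "((\<lambda>K::nat. (1 / ln 2) ^ a * ((real K * ln 2) ^ a / exp (real K * ln 2))) \<longlonglongrightarrow> (1 / ln 2) ^ a * 0)"
      by (rule tendsto_mult_left)
    moreover have "(1 / ln 2) ^ a * ((real K * ln 2) ^ a / exp (real K * ln 2)) = real K ^ a * (1/2) ^ K" for K
      by (simp add: exp_of_nat_mult power_mult_distrib power_one_over)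
    ultimately show ?thesis by simp
  qed
  \<comment> \<open>The 2 in the denominator accounts for \<open>2 ^ K < 2 * n\<close>; the added 1
    keeps it positive when \<open>E\<close> or \<open>e\<close> is 0.\<close>
  have "\<forall>\<^sub>F K in sequentially. real K ^ a * (1/2) ^ K < 1 / (2 * (E * e ^ a) + 1)"
    by (rule order_tendstoD(2)[OF lim]) (simp add: add.commute[of _ 1] add_pos_nonneg)
  then obtain K0 where K0: "\<And>K. K \<ge> K0 \<Longrightarrow> real K ^ a * (1/2) ^ K < 1 / (2 * (E * e ^ a) + 1)"
    by (auto simp: eventually_sequentially)
  show ?thesis
  proof (intro exI[of _ "2 ^ K0"] allI impI)
    fix n K k :: nat
    assume h: "2 ^ K0 \<le> n" "n \<le> 2 ^ K" "2 ^ K < 2 * n" "(2::nat) ^ k \<le> e * K"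
    have "(2::nat) ^ K0 \<le> 2 ^ K" using h by linarith
    then have "K0 \<le> K" by simp
    have pos: "0 < 2 * (real E * real e ^ a) + 1" by (simp add: add.commute[of _ 1] add_pos_nonneg)
    have "real K ^ a * (1/2) ^ K * (2 * (real E * real e ^ a) + 1) < 1"
      using K0[OF \<open>K0 \<le> K\<close>] pos by (simp only: pos_less_divide_eq of_nat_add of_nat_1 of_nat_numeral of_nat_mult of_nat_power)
    then have "(2 * (real E * real e ^ a) + 1) * real K ^ a < 2 ^ K"
      by (simp add: power_one_over field_simps)
    then have "real ((2 * (E * e ^ a) + 1) * K ^ a) < real (2 ^ K)" by (simp add: algebra_simps)
    then have "(2 * (E * e ^ a) + 1) * K ^ a < 2 ^ K" unfolding of_nat_less_iff .
    then have "2 * (E * (e * K) ^ a) < 2 * n" using h(3) by (simp add: algebra_simps power_mult_distrib)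
    moreover have "E * (2 ^ a) ^ k \<le> E * (e * K) ^ a"
    proof -
      have "((2::nat) ^ a) ^ k = (2 ^ k) ^ a" by (simp add: power_mult[symmetric] mult.commute)
      also have "\<dots> \<le> (e * K) ^ a" using h(4) by (rule power_mono) simp
      finally show ?thesis by (rule mult_left_mono) simp
    qed
    ultimately show "E * (2 ^ a) ^ k < n" by linarith
  qed
qed

subsection \<open>The program\<close>

text \<open>Integer registers: 1, 2, 3 and 4 hold \<open>1\<close>, \<open>2\<close>, \<open>L = 2 ^ \<lceil>d\<rceil>\<close> and \<open>2 * c\<close> for \<open>c = 2 * L ^ 4\<close>; 5 and 6 are
  the head and tail of the queue, which is stored from address 40 on, each set preceded by its size, and whose
  memory is never reused; 7 is the size \<open>n\<close> of the first set; 8 and 9 hold \<open>K\<close> and \<open>P = 2 ^ K \<ge> n\<close>;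
  10 and 11 hold \<open>T = 2 ^ k \<ge> 8 * c * K\<close> and \<open>L ^ (k + 2)\<close>; 12 holds \<open>4 * c * K\<close>.
  A single random number below \<open>P * P * T\<close> in register 13 encodes \<open>p\<close>, \<open>q\<close> (registers 18, 19) and
  the index \<open>j\<close> of the shell (20); 23 and 24 count the two parts. The remaining registers are scratch.
  Real register 1 holds the smallest distance recorded so far; 4 and 5 are the two radii of the shell.\<close>

definition keep_com :: com where
  "keep_com = Basic (IStore 17 21) ;; Basic (IAdd 21 21 1)"

definition filter_step :: "bool \<Rightarrow> nat \<Rightarrow> com" where
  "filter_step b th =
     Basic (ILoad 17 16) ;; Basic (Query 6 18 17) ;;
      IfR th 6 (if b then keep_com else Skip) (if b then Skip else keep_com) ;;
      Basic (IAdd 16 16 1)"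

definition filter_loop :: "bool \<Rightarrow> nat \<Rightarrow> com" where
  "filter_loop b th = WhileI 16 26 (filter_step b th)"

text \<open>Register \<open>st\<close> holds the address of the new set. Its size is known only
  after the loop, from the write pointer in 21, and is then stored in the cell left free in front of
  the points.\<close>

definition filter_com :: "bool \<Rightarrow> nat \<Rightarrow> nat \<Rightarrow> nat \<Rightarrow> com" where
  "filter_com b th st cn =
     Basic (IAdd 21 st 1) ;; Basic (IAdd 16 5 1) ;; Basic (IAdd 26 16 7) ;;
     filter_loop b th ;;
     Basic (ISub cn 21 st) ;; Basic (ISub cn cn 1) ;; Basic (IStore cn st)"

text \<open>There is no instruction that copies a register, so copies are made by adding a zero,
  here and for integers in \<open>commit_com\<close> and \<open>split_com\<close>.\<close>

definition min_step :: com where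
  "min_step =
     Basic (ILoad 19 25) ;; Basic (Query 6 17 19) ;;
      IfR 6 1 (Basic (RConst 7 0) ;; Basic (RAdd 1 6 7)) Skip ;;
      Basic (IAdd 25 25 1)"

definition min_loop :: com where
  "min_loop = WhileI 25 26 min_step"

definition pairs_step :: com where
  "pairs_step =
     Basic (ILoad 17 16) ;; Basic (IAdd 25 16 1) ;; min_loop ;; Basic (IAdd 16 16 1)"

definition pairs_loop :: com where
  "pairs_loop = WhileI 16 26 pairs_step"

definition brute_com :: com where
  "brute_com = Basic (IAdd 26 5 7) ;; Basic (IAdd 26 26 1) ;; Basic (IAdd 16 5 1) ;;
     pairs_loop ;; Basic (IAdd 5 5 7) ;; Basic (IAdd 5 5 1)"

definition coin_step :: com where
  "coin_step =
     Basic (Coin 15) ;; Basic (IMul 13 13 2) ;; Basic (IAdd 13 13 15) ;; Basic (IMul 14 14 2)"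

definition coin_loop :: com where
  "coin_loop = WhileI 14 21 coin_step"

text \<open>All of \<open>P\<close> and \<open>T\<close> are powers of two, so fair bits give an
  exactly uniform number below \<open>P * P * T\<close> without rejection.\<close>

definition coins_com :: com where
  "coins_com = Basic (IMul 21 9 9) ;; Basic (IMul 21 21 10) ;; Basic (IConst 14 1) ;;
     Basic (IConst 13 0) ;; coin_loop"

definition decode_com :: com where
  "decode_com =
     Basic (IMod 17 13 9) ;; Basic (IMod 17 17 7) ;; Basic (IAdd 17 17 5) ;; Basic (IAdd 17 17 1) ;;
     Basic (ILoad 18 17) ;; Basic (IDiv 13 13 9) ;;
     Basic (IMod 17 13 9) ;; Basic (IMod 17 17 7) ;; Basic (IAdd 17 17 5) ;; Basic (IAdd 17 17 1) ;;
     Basic (ILoad 19 17) ;; Basic (IDiv 20 13 9) ;;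
     Basic (Query 2 18 19) ;; Basic (IToR 6 10) ;; Basic (RDiv 3 2 6) ;;
     Basic (IToR 6 20) ;; Basic (RMul 6 6 3) ;; Basic (RAdd 4 2 6) ;; Basic (RAdd 5 4 3)"

text \<open>Both parts have already been written beyond the tail. Acceptance only moves head and
  tail of the queue; rejection leaves them, so the parts are overwritten by the next attempt. The
  number of points inside the inner sphere is recovered by subtracting the size of the outer
  part.\<close>

definition commit_com :: com where
  "commit_com =
     Basic (ISub 15 7 24) ;; Basic (IMul 17 4 15) ;;
     IfI 17 7 Skip
      (Basic (IMul 17 23 2) ;;
       IfI 7 17 Skip
        (Basic (ISub 17 23 15) ;; Basic (IMul 17 17 12) ;;
         IfI 7 17 Skip
          (Basic (IAdd 5 5 7) ;; Basic (IAdd 5 5 1) ;; Basic (IConst 15 0) ;; Basic (IAdd 6 21 15))))"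

definition split_com :: com where
  "split_com = coins_com ;; decode_com ;; filter_com False 5 6 23 ;;
     Basic (IConst 15 0) ;; Basic (IAdd 22 21 15) ;; filter_com True 4 22 24 ;; commit_com"

definition bits_step :: com where
  "bits_step =
     Basic (IMul 9 9 2) ;; Basic (IAdd 8 8 1)"

definition bits_loop :: com where
  "bits_loop = WhileI 9 7 bits_step"

definition shells_step :: com where
  "shells_step =
     Basic (IMul 10 10 2) ;; Basic (IMul 11 11 3)"

definition shells_loop :: com where
  "shells_loop = WhileI 10 14 shells_step"

text \<open>The machine has neither logarithms nor powers. Doubling loops find \<open>P\<close> and
  \<open>T\<close>, and register 11 gains a factor \<open>L\<close> with each doubling of
  \<open>T\<close>, ending at \<open>L ^ (k + 2)\<close>. The target \<open>8 * c * K\<close> for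
  \<open>T\<close> is twice the \<open>m\<close> of \<open>accept\<close>, as
  \<open>sparse_steps\<close> requires.\<close>

definition size_com :: com where
  "size_com = Basic (ILoad 7 5) ;; Basic (IConst 8 0) ;; Basic (IConst 9 1) ;; bits_loop ;;
     Basic (IMul 12 4 8) ;; Basic (IMul 12 12 2) ;; Basic (IMul 14 12 2) ;;
     Basic (IConst 10 1) ;; Basic (IMul 11 3 3) ;; shells_loop ;; Basic (IMul 22 4 11)"

definition body_com :: com where
  "body_com = size_com ;; IfI 22 7 split_com brute_com"

definition dim_step :: com where
  "dim_step =
     Basic (IAdd 15 15 1) ;; Basic (IMul 3 3 2) ;; Basic (IToR 6 15)"

definition dim_loop :: com where
  "dim_loop = WhileR 6 0 dim_step"

definition points_step :: com where
  "points_step =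
     Basic (IStore 16 6) ;; Basic (IAdd 6 6 1) ;; Basic (IAdd 16 16 1)"

definition points_loop :: com where
  "points_loop = WhileI 16 0 points_step"

text \<open>The recorded distance starts as that of the points 0 and 1 (register 1 contains the
  constant 1), so it is never below the closest-pair distance.\<close>

definition init_com :: com where
  "init_com = Basic (IConst 1 1) ;; Basic (IConst 2 2) ;; Basic (IConst 3 1) ;; Basic (IConst 15 0) ;;
     Basic (IToR 6 15) ;; dim_loop ;;
     Basic (IMul 4 3 3) ;; Basic (IMul 4 4 4) ;; Basic (IMul 4 4 2) ;; Basic (IMul 4 4 2) ;;
     Basic (IConst 16 0) ;; Basic (Query 1 16 1) ;;
     Basic (IConst 5 40) ;; Basic (IStore 0 5) ;; Basic (IConst 6 41) ;; points_loop"

text \<open>The main loop is made of raw jumps. Endless rejection has probability 0 but is possible,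
  so \<open>WhileI\<close>, whose precondition demands termination for all outcomes, does not fit;
  the loop is treated by induction on the fuel.\<close>

definition closest_pair_prog :: "instr list" where
  "closest_pair_prog = (let a = com_size init_com in
     compile 0 init_com @ [JmpILess 5 6 (a + 2), Halt 1] @ compile (a + 2) body_com @ [Jmp a])"

section \<open>Specifications of the loops\<close>

declare wp.simps(6,7) [simp del]

lemmas min_loop_unfold = wp_WhileI[of D N 25 26 "min_step", folded min_loop_def] for D N
lemmas pairs_loop_unfold = wp_WhileI[of D N 16 26 "pairs_step", folded pairs_loop_def] for D N
lemmas coin_loop_unfold = wp_WhileI[of D N 14 21 "coin_step", folded coin_loop_def] for D N
lemmas bits_loop_unfold = wp_WhileI[of D N 9 7 "bits_step", folded bits_loop_def] for D N
lemmas shells_loop_unfold = wp_WhileI[of D N 10 14 "shells_step", folded shells_loop_def] for D N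
lemmas dim_loop_unfold = wp_WhileR[of D N 6 0 "dim_step", folded dim_loop_def] for D N
lemmas points_loop_unfold = wp_WhileI[of D N 16 0 "points_step", folded points_loop_def] for D N
lemmas filter_loop_unfold = wp_WhileI[of D N 16 26 "filter_step b th", folded filter_loop_def] for D N b th

text \<open>All loop rules have this shape: \<open>Q\<close> is arbitrary, and the last assumption
  lists what it may rely on in the final state. The budget left is only bounded from below, since
  branches differ in cost. The bounds on \<open>a\<close> and \<open>u\<close> keep the output apart
  from the registers and the unread input.\<close>

lemma filter_loop_wp:
  assumes "I 16 = int a" "I 26 = int (a + length xs)" "\<forall>i<length xs. I (a + i) = int (xs ! i)"
    and "set xs \<subseteq> {..<N}" "I 18 = int p" "p < N" "I 21 = int u" "I 1 = 1"
    and "40 \<le> a" "a + length xs \<le> u" "th \<noteq> 6"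
    and "ys = filter (\<lambda>z. (R th < D p z) = b) xs"
    and K: "\<And>I' R' y. (\<And>m. m \<notin> {16, 17, 21} \<Longrightarrow> m < u \<Longrightarrow> I' m = I m) \<Longrightarrow>
       (\<forall>i<length ys. I' (u + i) = int (ys ! i)) \<Longrightarrow> I' 21 = int (u + length ys) \<Longrightarrow>
       (\<And>z. z \<noteq> 6 \<Longrightarrow> R' z = R z) \<Longrightarrow> x - (9 * real (length xs) + 2) \<le> y \<Longrightarrow> Q I' R' y"
  shows "wp D N (filter_loop b th) Q I R x"
  using assms
proof (induction xs arbitrary: I R x a u ys)
  case Nil
  show ?case
    by (subst filter_loop_unfold) (use Nil.prems in simp)
next
  case (Cons z xs)
  have z: "z < N" "I a = int z" using Cons.prems(3,4) by (auto dest: spec[of _ 0])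
  have lt: "I 16 < I 26" using Cons.prems(1,2) by simp
  have rest: "\<forall>i<length xs. I (Suc a + i) = int (xs ! i)"
  proof (intro allI impI)
    fix i assume "i < length xs"
    then show "I (Suc a + i) = int (xs ! i)" using Cons.prems(3)[rule_format, of "Suc i"] by simp
  qed
  let ?R = "R(6 := D p z)"
  have skip: "wp D N (filter_loop b th) Q (I(17 := int z, 16 := int a + 1)) ?R y"
    if "\<not> (R th < D p z) = b" "x - 9 \<le> y" for y
  proof (rule Cons.IH[where a = "Suc a" and u = u and ys = ys])
    show "ys = filter (\<lambda>z. (?R th < D p z) = b) xs" using Cons.prems(11,12) that by auto
    fix I' R' y'
    assume h: "\<And>m. m \<notin> {16, 17, 21} \<Longrightarrow> m < u \<Longrightarrow> I' m = (I(17 := int z, 16 := int a + 1)) m"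
      "\<forall>i<length ys. I' (u + i) = int (ys ! i)" "I' 21 = int (u + length ys)"
      "\<And>z'. z' \<noteq> 6 \<Longrightarrow> R' z' = ?R z'" "y - (9 * real (length xs) + 2) \<le> y'"
    show "Q I' R' y'"
      by (rule Cons.prems(13)) (use h that in auto)
  qed (use Cons.prems rest in auto)
  have keep: "wp D N (filter_loop b th) Q (I(17 := int z, u := int z, 21 := int u + 1, 16 := int a + 1)) ?R y"
    if "(R th < D p z) = b" "x - 9 \<le> y" for y
  proof (rule Cons.IH[where a = "Suc a" and u = "Suc u" and ys = "filter (\<lambda>z. (?R th < D p z) = b) xs"])
    have ys: "ys = z # filter (\<lambda>z. (?R th < D p z) = b) xs" using Cons.prems(11,12) that by auto
    fix I' R' y'
    assume h: "\<And>m. m \<notin> {16, 17, 21} \<Longrightarrow> m < Suc u \<Longrightarrow>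
        I' m = (I(17 := int z, u := int z, 21 := int u + 1, 16 := int a + 1)) m"
      "\<forall>i<length (filter (\<lambda>z. (?R th < D p z) = b) xs). I' (Suc u + i) = int (filter (\<lambda>z. (?R th < D p z) = b) xs ! i)"
      "I' 21 = int (Suc u + length (filter (\<lambda>z. (?R th < D p z) = b) xs))"
      "\<And>z'. z' \<noteq> 6 \<Longrightarrow> R' z' = ?R z'" "y - (9 * real (length xs) + 2) \<le> y'"
    have "I' u = int z" using h(1)[of u] Cons.prems(9,10) by simp
    then have "\<forall>i<length ys. I' (u + i) = int (ys ! i)"
      using h(2) unfolding ys by (auto simp: nth_Cons split: nat.split)
    then show "Q I' R' y'"
      by (rule Cons.prems(13)[rotated]) (use h that ys in auto)
  qed (use Cons.prems rest in auto)
  show ?case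
    using skip keep lt z Cons.prems(1-11)
    by (subst filter_loop_unfold) (cases b; simp add: wp_simps filter_step_def keep_com_def)
qed

lemma min_loop_wp:
  assumes "I 25 = int a" "I 26 = int (a + length xs)" "\<forall>i<length xs. I (a + i) = int (xs ! i)"
    and "set xs \<subseteq> {..<N}" "I 17 = int v" "v < N" "I 1 = 1" "40 \<le> a"
    and K: "\<And>I' R' y. (\<And>m. m \<notin> {19, 25} \<Longrightarrow> I' m = I m) \<Longrightarrow> (\<And>z. z \<notin> {1, 6, 7} \<Longrightarrow> R' z = R z) \<Longrightarrow>
       R' 1 = fold (\<lambda>u. min (D v u)) xs (R 1) \<Longrightarrow> x - (8 * real (length xs) + 2) \<le> y \<Longrightarrow> Q I' R' y"
  shows "wp D N min_loop Q I R x"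
  using assms
proof (induction xs arbitrary: I R x a)
  case Nil
  show ?case by (subst min_loop_unfold) (use Nil.prems in simp)
next
  case (Cons z xs)
  have z: "z < N" "I a = int z" using Cons.prems(3,4) by (auto dest: spec[of _ 0])
  have rest: "\<forall>i<length xs. I (Suc a + i) = int (xs ! i)"
  proof (intro allI impI)
    fix i assume "i < length xs"
    then show "I (Suc a + i) = int (xs ! i)" using Cons.prems(3)[rule_format, of "Suc i"] by simp
  qed
  have IH: "wp D N min_loop Q (I(19 := int z, 25 := int a + 1)) R' y"
    if "R' 1 = min (D v z) (R 1)" "\<And>z. z \<notin> {1, 6, 7} \<Longrightarrow> R' z = R z" "x - 8 \<le> y" for y R'
  proof (rule Cons.IH[where a = "Suc a"])
    fix I'' R'' y'
    assume h: "\<And>m. m \<notin> {19, 25} \<Longrightarrow> I'' m = (I(19 := int z, 25 := int a + 1)) m"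
      "\<And>z. z \<notin> {1, 6, 7} \<Longrightarrow> R'' z = R' z" "R'' 1 = fold (\<lambda>u. min (D v u)) xs (R' 1)"
      "y - (8 * real (length xs) + 2) \<le> y'"
    show "Q I'' R'' y'" by (rule Cons.prems(9)) (use h that in auto)
  qed (use Cons.prems rest in auto)
  show ?case
    using z Cons.prems(1-8)
    by (subst min_loop_unfold) (auto simp add: wp_simps min_step_def intro!: IH split: if_splits)
qed

fun pairs_min :: "(nat \<Rightarrow> nat \<Rightarrow> real) \<Rightarrow> nat list \<Rightarrow> real \<Rightarrow> real" where
  "pairs_min D [] \<delta> = \<delta>"
| "pairs_min D (v # xs) \<delta> = pairs_min D xs (fold (\<lambda>u. min (D v u)) xs \<delta>)"

lemma pairs_loop_wp:
  assumes "I 16 = int a" "I 26 = int (a + length xs)" "\<forall>i<length xs. I (a + i) = int (xs ! i)"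
    and "set xs \<subseteq> {..<N}" "I 1 = 1" "40 \<le> a" "length xs \<le> n"
    and K: "\<And>I' R' y. (\<And>m. m \<notin> {16, 17, 19, 25} \<Longrightarrow> I' m = I m) \<Longrightarrow>
       R' 1 = pairs_min D xs (R 1) \<Longrightarrow> x - ((8 * real n + 7) * real (length xs) + 2) \<le> y \<Longrightarrow> Q I' R' y"
  shows "wp D N pairs_loop Q I R x"
  using assms
proof (induction xs arbitrary: I R x a)
  case Nil
  show ?case by (subst pairs_loop_unfold) (use Nil.prems in simp)
next
  case (Cons z xs)
  have z: "z < N" "I a = int z" using Cons.prems(3,4) by (auto dest: spec[of _ 0])
  have rest: "\<forall>i<length xs. I (Suc a + i) = int (xs ! i)"
  proof (intro allI impI)
    fix i assume "i < length xs"
    then show "I (Suc a + i) = int (xs ! i)" using Cons.prems(3)[rule_format, of "Suc i"] by simp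
  qed
  have inner: "wp D N min_loop (wp D N (Basic (IAdd 16 16 1)) (\<lambda>I R x. wp D N pairs_loop Q I R (x - 1)))
      (I(17 := int z, 25 := int a + 1)) R (x - 3)"
  proof (rule min_loop_wp[where a = "Suc a" and xs = xs and v = z])
    fix I' y and R' :: "nat \<Rightarrow> real"
    assume h: "\<And>m. m \<notin> {19, 25} \<Longrightarrow> I' m = (I(17 := int z, 25 := int a + 1)) m"
      "R' 1 = fold (\<lambda>u. min (D z u)) xs (R 1)" "x - 3 - (8 * real (length xs) + 2) \<le> y"
    have I': "I' 16 = int a" "I' 26 = int (Suc a + length xs)" "I' 1 = 1"
      using h(1) Cons.prems(1,2,5) by simp_all
    have len: "real (length xs) \<le> real n" using Cons.prems(7) by simp
    have "wp D N pairs_loop Q (I'(16 := int a + 1)) R' (y - 1 - 1)"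
    proof (rule Cons.IH[where a = "Suc a"])
      show "\<forall>i<length xs. (I'(16 := int a + 1)) (Suc a + i) = int (xs ! i)"
        using rest h(1) Cons.prems(6) by auto
      fix I'' y' and R'' :: "nat \<Rightarrow> real"
      assume h2: "\<And>m. m \<notin> {16, 17, 19, 25} \<Longrightarrow> I'' m = (I'(16 := int a + 1)) m"
        "R'' 1 = pairs_min D xs (R' 1)" "y - 1 - 1 - ((8 * real n + 7) * real (length xs) + 2) \<le> y'"
      show "Q I'' R'' y'"
      proof (rule Cons.prems(8))
        show "I'' m = I m" if "m \<notin> {16, 17, 19, 25}" for m using h2(1) h(1) that by auto
        show "R'' 1 = pairs_min D (z # xs) (R 1)" using h2(2) h(2) by simp
        show "x - ((8 * real n + 7) * real (length (z # xs)) + 2) \<le> y'"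
          using h2(3) h(3) len by (simp add: algebra_simps)
      qed
    qed (use I' Cons.prems(4-7) in auto)
    then show "wp D N (Basic (IAdd 16 16 1)) (\<lambda>I R x. wp D N pairs_loop Q I R (x - 1)) I' R' y"
      using I' by (simp add: wp_simps)
  qed (use z rest Cons.prems(1-6) in auto)
  show ?case
    using z Cons.prems(1-6) inner
    by (subst pairs_loop_unfold) (simp add: wp_simps pairs_step_def)
qed

text \<open>\<open>f z'\<close> is the budget reserved for the outcome \<open>z'\<close>. The
  requirement is its mean plus 6 per bit, so different outcomes may be given different
  budgets.\<close>

lemma coin_loop_wp:
  assumes "I 14 = 2 ^ e" "I 21 = 2 ^ (e + r)" "I 2 = 2" "I 13 = int z"
    and x: "x = 6 * real r + 2 + (\<Sum>z'<2 ^ r. f z') / 2 ^ r"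
    and K: "\<And>I' z'. z' < 2 ^ r \<Longrightarrow> (\<And>m. m \<notin> {13, 14, 15} \<Longrightarrow> I' m = I m) \<Longrightarrow>
       I' 13 = int (z * 2 ^ r + z') \<Longrightarrow> Q I' R (f z')"
  shows "wp D N coin_loop Q I R x"
  using assms
proof (induction r arbitrary: I x z e f)
  case 0
  show ?case by (subst coin_loop_unfold) (use 0 in simp)
next
  case (Suc r)
  have lt: "I 14 < I 21" unfolding Suc.prems(1,2) by (rule power_strict_increasing) auto
  let ?I = "\<lambda>b. I(15 := int b, 13 := int z * 2 + int b, 14 := 2 ^ e * 2)"
  let ?x = "\<lambda>b. 6 * real r + 2 + (\<Sum>z'<2 ^ r. f (b * 2 ^ r + z')) / 2 ^ r"
  have IH: "wp D N coin_loop Q (?I b) R (?x b)" if "b < 2" for b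
  proof (rule Suc.IH[where e = "Suc e" and z = "2 * z + b" and f = "\<lambda>z'. f (b * 2 ^ r + z')"])
    fix I' z'
    assume h: "z' < 2 ^ r" "\<And>m. m \<notin> {13, 14, 15} \<Longrightarrow> I' m = ?I b m"
      "I' 13 = int ((2 * z + b) * 2 ^ r + z')"
    show "Q I' R (f (b * 2 ^ r + z'))"
    proof (rule Suc.prems(6))
      have "b * 2 ^ r + z' < (b + 1) * 2 ^ r" using h(1) by simp
      also have "\<dots> \<le> 2 * 2 ^ r" using that by (intro mult_right_mono) auto
      finally show "b * 2 ^ r + z' < 2 ^ Suc r" by simp
    qed (use h in \<open>auto simp: algebra_simps\<close>)
  qed (use Suc.prems(2,3) in \<open>auto simp: algebra_simps\<close>)
  have split: "(\<Sum>z'<2 ^ Suc r. f z') = (\<Sum>z'<2 ^ r. f (0 * 2 ^ r + z')) + (\<Sum>z'<2 ^ r. f (1 * 2 ^ r + z'))"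
  proof -
    have "(\<Sum>z'<2 ^ Suc r. f z') = (\<Sum>z'<2 ^ r + 2 ^ r. f z')" by (simp add: mult_2)
    also have "\<dots> = (\<Sum>z'<2 ^ r. f z') + (\<Sum>z'\<in>{2 ^ r..<2 ^ r + 2 ^ r}. f z')"
      using sum.atLeastLessThan_concat[of 0 "2 ^ r" "2 ^ r + 2 ^ r" f] by (simp add: lessThan_atLeast0)
    also have "(\<Sum>z'\<in>{2 ^ r..<2 ^ r + 2 ^ r}. f z') = (\<Sum>z'<2 ^ r. f (1 * 2 ^ r + z'))"
      using sum.shift_bounds_nat_ivl[of f 0 "2 ^ r" "2 ^ r"] by (simp add: lessThan_atLeast0 add.commute)
    finally show ?thesis by simp
  qed
  \<comment> \<open>The first bit splits the mean of \<open>f\<close> into the means over its two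
    halves. Of the 6 instructions per round, 4 come after the toss, whence the witness
    \<open>x0 + 4\<close> below.\<close>
  define x0 x1 where "x0 = ?x 0" and "x1 = ?x 1"
  have avg: "x1 = 2 * x - 12 - x0"
    unfolding Suc.prems(5) split x0_def x1_def by (simp add: field_simps)
  have 0: "wp D N coin_loop Q (I(15 := 0, 13 := int z * 2, 14 := 2 ^ e * 2)) R x0"
    using IH[of 0] unfolding x0_def by simp
  have 1: "wp D N coin_loop Q (I(15 := 1, 13 := int z * 2 + 1, 14 := 2 ^ e * 2)) R (2 * x - 12 - x0)"
    using IH[of 1] unfolding avg[symmetric] x1_def by simp
  show ?case
    using lt Suc.prems(1,3,4) 0 1
    by (subst coin_loop_unfold)
      (auto simp add: wp_simps coin_step_def algebra_simps intro!: exI[of _ "x0 + 4"])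
qed

lemma bits_loop_wp:
  assumes "I 9 = 2 ^ e" "I 8 = int e" "I 7 = int n" "I 1 = 1" "I 2 = 2"
    and K: "\<And>I' y k. e \<le> k \<Longrightarrow> n \<le> 2 ^ k \<Longrightarrow> k = e \<or> 2 ^ k < 2 * n \<Longrightarrow>
       (\<And>m. m \<notin> {8, 9} \<Longrightarrow> I' m = I m) \<Longrightarrow> I' 9 = 2 ^ k \<Longrightarrow> I' 8 = int k \<Longrightarrow>
       x - (4 * (real k - real e) + 2) \<le> y \<Longrightarrow> Q I' R y"
  shows "wp D N bits_loop Q I R x"
  using assms
proof (induction "n - 2 ^ e" arbitrary: e I x rule: less_induct)
  case less
  show ?case
  proof (cases "2 ^ e < n")
    case False
    then have "\<not> I 9 < I 7" using less.prems(1,3) by (simp flip: of_nat_less_iff)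
    moreover have "Q I R (x - 2)"
      by (rule less.prems(6)[of e]) (use False less.prems in auto)
    ultimately show ?thesis by (subst bits_loop_unfold) simp
  next
    case True
    then have lt: "I 9 < I 7" using less.prems(1,3) by (simp flip: of_nat_less_iff)
    have "wp D N bits_loop Q (I(9 := 2 ^ e * 2, 8 := int e + 1)) R (x - 4)"
    proof (rule less.hyps[of "Suc e"])
      show "n - 2 ^ Suc e < n - 2 ^ e" using True by (simp add: diff_less_mono2)
      fix I' y k
      assume h: "Suc e \<le> k" "n \<le> 2 ^ k" "k = Suc e \<or> 2 ^ k < 2 * n"
        "\<And>m. m \<notin> {8, 9} \<Longrightarrow> I' m = (I(9 := 2 ^ e * 2, 8 := int e + 1)) m"
        "I' 9 = 2 ^ k" "I' 8 = int k" "x - 4 - (4 * (real k - real (Suc e)) + 2) \<le> y"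
      show "Q I' R y"
        by (rule less.prems(6)[of k]) (use h True in auto)
    qed (use less.prems in auto)
    then show ?thesis using lt less.prems(1-5)
      by (subst bits_loop_unfold) (simp add: wp_simps bits_step_def)
  qed
qed

lemma shells_loop_wp:
  assumes "I 10 = 2 ^ e" "I 11 = int (L ^ (e + 2))" "I 14 = int n" "I 2 = 2" "I 3 = int L"
    and K: "\<And>I' y k. e \<le> k \<Longrightarrow> n \<le> 2 ^ k \<Longrightarrow> k = e \<or> 2 ^ k < 2 * n \<Longrightarrow>
       (\<And>m. m \<notin> {10, 11} \<Longrightarrow> I' m = I m) \<Longrightarrow> I' 10 = 2 ^ k \<Longrightarrow> I' 11 = int (L ^ (k + 2)) \<Longrightarrow>
       x - (4 * (real k - real e) + 2) \<le> y \<Longrightarrow> Q I' R y"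
  shows "wp D N shells_loop Q I R x"
  using assms
proof (induction "n - 2 ^ e" arbitrary: e I x rule: less_induct)
  case less
  show ?case
  proof (cases "2 ^ e < n")
    case False
    then have "\<not> I 10 < I 14" using less.prems(1,3) by (simp flip: of_nat_less_iff)
    moreover have "Q I R (x - 2)"
      by (rule less.prems(6)[of e]) (use False less.prems in auto)
    ultimately show ?thesis by (subst shells_loop_unfold) simp
  next
    case True
    then have lt: "I 10 < I 14" using less.prems(1,3) by (simp flip: of_nat_less_iff)
    have "wp D N shells_loop Q (I(10 := 2 ^ e * 2, 11 := int (L ^ (e + 2)) * int L)) R (x - 4)"
    proof (rule less.hyps[of "Suc e"])
      show "n - 2 ^ Suc e < n - 2 ^ e" using True by (simp add: diff_less_mono2)
      fix I' y k
      assume h: "Suc e \<le> k" "n \<le> 2 ^ k" "k = Suc e \<or> 2 ^ k < 2 * n"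
        "\<And>m. m \<notin> {10, 11} \<Longrightarrow> I' m = (I(10 := 2 ^ e * 2, 11 := int (L ^ (e + 2)) * int L)) m"
        "I' 10 = 2 ^ k" "I' 11 = int (L ^ (k + 2))" "x - 4 - (4 * (real k - real (Suc e)) + 2) \<le> y"
      show "Q I' R y"
        by (rule less.prems(6)[of k]) (use h True in auto)
    qed (use less.prems in auto)
    then show ?thesis using lt less.prems(1-5)
      by (subst shells_loop_unfold) (simp add: wp_simps shells_step_def)
  qed
qed

lemma dim_loop_wp:
  assumes "R 6 = real e" "I 15 = int e" "I 3 = 2 ^ e" "I 1 = 1" "I 2 = 2" "R 0 = d" "e = 0 \<or> real e < d + 1"
    and K: "\<And>I' R' y. (\<And>m. m \<notin> {3, 15} \<Longrightarrow> I' m = I m) \<Longrightarrow> I' 3 = 2 ^ nat \<lceil>d\<rceil> \<Longrightarrow>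
       x - (5 * (real (nat \<lceil>d\<rceil>) - real e) + 2) \<le> y \<Longrightarrow> Q I' R' y"
  shows "wp D N dim_loop Q I R x"
  using assms
proof (induction "nat \<lceil>d\<rceil> - e" arbitrary: e I R x rule: less_induct)
  case less
  show ?case
  proof (cases "real e < d")
    case False
    then have "nat \<lceil>d\<rceil> = e" using less.prems(7) by linarith
    then show ?thesis
      by (subst dim_loop_unfold) (use False less.prems in auto)
  next
    case True
    have "wp D N dim_loop Q (I(15 := int e + 1, 3 := 2 ^ e * 2)) (R(6 := real e + 1)) (x - 5)"
    proof (rule less.hyps[of "Suc e"])
      show "nat \<lceil>d\<rceil> - Suc e < nat \<lceil>d\<rceil> - e" using True by linarith
      fix I' R' y
      assume h: "\<And>m. m \<notin> {3, 15} \<Longrightarrow> I' m = (I(15 := int e + 1, 3 := 2 ^ e * 2)) m"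
        "I' 3 = 2 ^ nat \<lceil>d\<rceil>" "x - 5 - (5 * (real (nat \<lceil>d\<rceil>) - real (Suc e)) + 2) \<le> y"
      show "Q I' R' y" by (rule less.prems(8)) (use h in auto)
    qed (use less.prems True in auto)
    then show ?thesis using True less.prems(1-6)
      by (subst dim_loop_unfold) (simp add: wp_simps dim_step_def)
  qed
qed

lemma points_loop_wp:
  assumes "I 16 = int e" "I 6 = int (41 + e)" "I 0 = int N" "I 1 = 1" "e \<le> N"
    and K: "\<And>I' y. (\<And>m. m \<notin> {6, 16} \<Longrightarrow> m < 41 + e \<Longrightarrow> I' m = I m) \<Longrightarrow> I' 6 = int (41 + N) \<Longrightarrow>
       (\<And>i. e \<le> i \<Longrightarrow> i < N \<Longrightarrow> I' (41 + i) = int i) \<Longrightarrow>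
       x - (5 * (real N - real e) + 2) \<le> y \<Longrightarrow> Q I' R y"
  shows "wp D N points_loop Q I R x"
  using assms
proof (induction "N - e" arbitrary: e I x)
  case 0
  then show ?case by (subst points_loop_unfold) auto
next
  case (Suc l)
  have lt: "I 16 < I 0" using Suc.prems Suc.hyps(2) by simp
  have "wp D N points_loop Q (I(41 + e := int e, 6 := int (41 + e) + 1, 16 := int e + 1)) R (x - 5)"
  proof (rule Suc.hyps(1)[of "Suc e"])
    fix I' y
    assume h: "\<And>m. m \<notin> {6, 16} \<Longrightarrow> m < 41 + Suc e \<Longrightarrow>
        I' m = (I(41 + e := int e, 6 := int (41 + e) + 1, 16 := int e + 1)) m"
      "I' 6 = int (41 + N)" "\<And>i. Suc e \<le> i \<Longrightarrow> i < N \<Longrightarrow> I' (41 + i) = int i"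
      "x - 5 - (5 * (real N - real (Suc e)) + 2) \<le> y"
    show "Q I' R y"
    proof (rule Suc.prems(6))
      fix i assume i: "e \<le> i" "i < N"
      show "I' (41 + i) = int i"
      proof (cases "i = e")
        case True
        then show ?thesis using h(1)[of "41 + e"] by simp
      qed (use h(3) i in auto)
    qed (use h in auto)
  qed (use Suc.prems Suc.hyps(2) in auto)
  then show ?case using lt Suc.prems(1-5)
    by (subst points_loop_unfold) (simp add: wp_simps points_step_def nat_add_distrib)
qed

section \<open>Minimum over all pairs of a list\<close>

lemma fold_min_props:
  fixes f :: "nat \<Rightarrow> real"
  shows "fold (\<lambda>u. min (f u)) xs \<delta> \<le> \<delta>"
    and "u \<in> set xs \<Longrightarrow> fold (\<lambda>u. min (f u)) xs \<delta> \<le> f u"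
    and "fold (\<lambda>u. min (f u)) xs \<delta> \<in> insert \<delta> (f ` set xs)"
proof (induction xs arbitrary: \<delta>)
  case (Cons z xs)
  { case 1 show ?case using Cons(1)[of "min (f z) \<delta>"] by simp }
  { case 2
    show ?case
    proof (cases "u = z")
      case True
      then show ?thesis using Cons(1)[of "min (f z) \<delta>"] by simp
    qed (use 2 Cons(2)[of "min (f z) \<delta>"] in simp) }
  { case 3 show ?case using Cons(3)[of "min (f z) \<delta>"] by (auto simp: min_def split: if_splits) }
qed auto

lemma pairs_min_le: "pairs_min D s \<delta> \<le> \<delta>"
proof (induction s arbitrary: \<delta>)
  case (Cons v s)
  show ?case using order_trans[OF Cons fold_min_props(1)] by simp
qed simp

lemma pairs_min_le_dist:
  "x \<in> set s \<Longrightarrow> y \<in> set s \<Longrightarrow> x \<noteq> y \<Longrightarrow> D x y = D y x \<Longrightarrow> pairs_min D s \<delta> \<le> D x y"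
proof (induction s arbitrary: \<delta>)
  case (Cons v s)
  let ?\<delta> = "fold (\<lambda>u. min (D v u)) s \<delta>"
  consider "x \<in> set s" "y \<in> set s" | "x = v" "y \<in> set s" | "y = v" "x \<in> set s"
    using Cons.prems by auto
  then show ?case
  proof cases
    case 1
    then show ?thesis using Cons by simp
  next
    case 2
    then show ?thesis using order_trans[OF pairs_min_le fold_min_props(2)[of y s "D v" \<delta>]] by simp
  next
    case 3
    then show ?thesis using order_trans[OF pairs_min_le fold_min_props(2)[of x s "D v" \<delta>]] Cons.prems by simp
  qed
qed simp

lemma pairs_min_cases:
  "distinct s \<Longrightarrow> pairs_min D s \<delta> = \<delta> \<or> (\<exists>x\<in>set s. \<exists>y\<in>set s. x \<noteq> y \<and> pairs_min D s \<delta> = D x y)"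
proof (induction s arbitrary: \<delta>)
  case (Cons v s)
  let ?\<delta> = "fold (\<lambda>u. min (D v u)) s \<delta>"
  have "pairs_min D s ?\<delta> = ?\<delta> \<or> (\<exists>x\<in>set s. \<exists>y\<in>set s. x \<noteq> y \<and> pairs_min D s ?\<delta> = D x y)"
    using Cons by simp
  moreover have "?\<delta> \<in> insert \<delta> (D v ` set s)" by (rule fold_min_props(3))
  ultimately show ?case using Cons.prems by auto
qed simp

section \<open>Layout of the queue in memory and specifications of the program blocks\<close>

fun segments :: "(nat \<Rightarrow> int) \<Rightarrow> nat \<Rightarrow> nat list list \<Rightarrow> nat \<Rightarrow> bool" where
  "segments I h [] t \<longleftrightarrow> h = t"
| "segments I h (s # qs) t \<longleftrightarrow> I h = int (length s) \<and> (\<forall>i<length s. I (h + 1 + i) = int (s ! i)) \<and>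
     segments I (h + 1 + length s) qs t"

lemma segments_le: "segments I h qs t \<Longrightarrow> h \<le> t"
  by (induction qs arbitrary: h) fastforce+

lemma segments_cong:
  "segments I h qs t \<Longrightarrow> (\<And>m. h \<le> m \<Longrightarrow> m < t \<Longrightarrow> I' m = I m) \<Longrightarrow> segments I' h qs t"
proof (induction qs arbitrary: h)
  case (Cons s qs)
  have "h + 1 + length s \<le> t" using Cons.prems(1) segments_le by auto
  then show ?case using Cons by auto
qed simp

lemma segments_append: "segments I h qs t \<Longrightarrow> segments I t qs' t' \<Longrightarrow> segments I h (qs @ qs') t'"
  by (induction qs arbitrary: h) auto

lemma size_com_wp:
  assumes I: "I 1 = 1" "I 2 = 2" "I 3 = int L" "I 4 = int (2 * c)" "I 5 = int h" "I h = int n"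
    and K: "\<And>I' y K k. n \<le> 2 ^ K \<Longrightarrow> K = 0 \<or> 2 ^ K < 2 * n \<Longrightarrow> 8 * c * K \<le> 2 ^ k \<Longrightarrow> k = 0 \<or> 2 ^ k < 16 * c * K \<Longrightarrow>
      (\<And>m. m \<notin> {7, 8, 9, 10, 11, 12, 14, 22} \<Longrightarrow> I' m = I m) \<Longrightarrow> I' 7 = int n \<Longrightarrow> I' 9 = 2 ^ K \<Longrightarrow>
      I' 10 = 2 ^ k \<Longrightarrow> I' 12 = int (4 * c * K) \<Longrightarrow> I' 22 = int (2 * c * L ^ (k + 2)) \<Longrightarrow>
      x - (4 * real K + 4 * real k + 14) \<le> y \<Longrightarrow> Q I' R y"
  shows "wp D N size_com Q I R x"
proof -
  let ?rest = "\<lambda>Q. wp D N (Basic (IMul 12 4 8) ;; Basic (IMul 12 12 2) ;; Basic (IMul 14 12 2) ;;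
     Basic (IConst 10 1) ;; Basic (IMul 11 3 3) ;; shells_loop ;; Basic (IMul 22 4 11)) Q"
  have "wp D N bits_loop (?rest Q) (I(7 := int n, 8 := 0, 9 := 1)) R (x - 3)"
  proof (rule bits_loop_wp[where e = 0 and n = n])
    fix I' y K
    assume h: "n \<le> 2 ^ K" "K = 0 \<or> 2 ^ K < 2 * n"
      "\<And>m. m \<notin> {8, 9} \<Longrightarrow> I' m = (I(7 := int n, 8 := 0, 9 := 1)) m"
      "I' 9 = 2 ^ K" "I' 8 = int K" "x - 3 - (4 * (real K - real 0) + 2) \<le> y"
    let ?I = "I'(12 := int (4 * c * K), 14 := int (8 * c * K), 10 := 1, 11 := int L * int L)"
    have "wp D N shells_loop (wp D N (Basic (IMul 22 4 11)) Q) ?I R (y - 5)"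
    proof (rule shells_loop_wp[where e = 0 and n = "8 * c * K" and L = L])
      fix I'' y' k
      assume h2: "8 * c * K \<le> 2 ^ k" "k = 0 \<or> 2 ^ k < 2 * (8 * c * K)"
        "\<And>m. m \<notin> {10, 11} \<Longrightarrow> I'' m = ?I m" "I'' 10 = 2 ^ k" "I'' 11 = int (L ^ (k + 2))"
        "y - 5 - (4 * (real k - real 0) + 2) \<le> y'"
      have "Q (I''(22 := int (2 * c) * int (L ^ (k + 2)))) R (y' - 1)"
        by (rule K[of K k]) (use h h2 I in auto)
      then show "wp D N (Basic (IMul 22 4 11)) Q I'' R y'"
        using h2(3)[of 4] h(3)[of 4] h2(5) I by (simp add: wp_simps)
    qed (use h(3) I in \<open>auto simp: power2_eq_square\<close>)
    moreover have "I' 4 = int (2 * c)" "I' 2 = 2" "I' 3 = int L" using h(3) I by auto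
    ultimately show "?rest Q I' R y"
      using h(5) by (simp add: wp_simps algebra_simps)
  qed (use I in auto)
  then show ?thesis using I by (simp add: wp_simps size_com_def)
qed

lemma brute_com_wp:
  assumes I: "I 1 = 1" "I 5 = int h" "I 7 = int (length s)" "40 \<le> h"
    and s: "\<forall>i<length s. I (h + 1 + i) = int (s ! i)" "set s \<subseteq> {..<N}"
    and K: "\<And>I' R' y. (\<And>m. m \<notin> {5, 16, 17, 19, 25, 26} \<Longrightarrow> I' m = I m) \<Longrightarrow>
      I' 5 = int (h + 1 + length s) \<Longrightarrow> R' 1 = pairs_min D s (R 1) \<Longrightarrow>
      x - ((8 * real (length s) + 7) * real (length s) + 7) \<le> y \<Longrightarrow> Q I' R' y"
  shows "wp D N brute_com Q I R x"
proof -
  let ?I = "I(26 := int h + int (length s) + 1, 16 := int h + 1)"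
  have "wp D N pairs_loop (wp D N (Basic (IAdd 5 5 7) ;; Basic (IAdd 5 5 1)) Q) ?I R (x - 3)"
  proof (rule pairs_loop_wp[where a = "h + 1" and xs = s and n = "length s"])
    fix I' y and R' :: "nat \<Rightarrow> real"
    assume h: "\<And>m. m \<notin> {16, 17, 19, 25} \<Longrightarrow> I' m = ?I m" "R' 1 = pairs_min D s (R 1)"
      "x - 3 - ((8 * real (length s) + 7) * real (length s) + 2) \<le> y"
    have "I' 5 = int h" "I' 7 = int (length s)" "I' 1 = 1" using h(1) I by auto
    moreover have "Q (I'(5 := int h + int (length s) + 1)) R' (y - 2)"
      by (rule K) (use h in \<open>auto simp: algebra_simps\<close>)
    ultimately show "wp D N (Basic (IAdd 5 5 7) ;; Basic (IAdd 5 5 1)) Q I' R' y"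
      by (simp add: wp_simps)
  qed (use I s in auto)
  then show ?thesis using I by (simp add: wp_simps brute_com_def)
qed

lemma filter_com_wp:
  assumes I: "I 1 = 1" "I 5 = int h" "I 7 = int (length s)" "I 18 = int p" "p < N" "40 \<le> h"
    and s: "\<forall>i<length s. I (h + 1 + i) = int (s ! i)" "set s \<subseteq> {..<N}"
    and t: "I st = int t" "h + 1 + length s \<le> t" "st \<notin> {16, 17, 21, 26, cn}" "st < 40"
    and cn: "cn \<in> {23, 24}" and th: "th \<noteq> 6"
    and ys: "ys = filter (\<lambda>z. (R th < D p z) = b) s"
    and K: "\<And>I' R' y. (\<And>m. m \<notin> {16, 17, 21, 26, cn} \<Longrightarrow> m < t \<Longrightarrow> I' m = I m) \<Longrightarrow>
      I' t = int (length ys) \<Longrightarrow> (\<forall>i<length ys. I' (t + 1 + i) = int (ys ! i)) \<Longrightarrow>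
      I' 21 = int (t + 1 + length ys) \<Longrightarrow> I' cn = int (length ys) \<Longrightarrow>
      (\<And>z. z \<noteq> 6 \<Longrightarrow> R' z = R z) \<Longrightarrow> x - (9 * real (length s) + 8) \<le> y \<Longrightarrow> Q I' R' y"
  shows "wp D N (filter_com b th st cn) Q I R x"
proof -
  let ?I = "I(21 := int t + 1, 16 := int h + 1, 26 := int h + 1 + int (length s))"
  have "wp D N (filter_loop b th) (wp D N (Basic (ISub cn 21 st) ;; Basic (ISub cn cn 1) ;; Basic (IStore cn st)) Q)
      ?I R (x - 3)"
  proof (rule filter_loop_wp[where a = "h + 1" and xs = s and u = "t + 1" and p = p and ys = ys])
    fix I' y and R' :: "nat \<Rightarrow> real"
    assume h: "\<And>m. m \<notin> {16, 17, 21} \<Longrightarrow> m < t + 1 \<Longrightarrow> I' m = ?I m"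
      "\<forall>i<length ys. I' (t + 1 + i) = int (ys ! i)" "I' 21 = int (t + 1 + length ys)"
      "\<And>z. z \<noteq> 6 \<Longrightarrow> R' z = R z" "x - 3 - (9 * real (length s) + 2) \<le> y"
    have st: "I' st = int t" "I' 1 = 1" using h(1) I t by auto
    let ?J = "I'(cn := int (length ys), t := int (length ys))"
    have "Q ?J R' (y - 3)"
    proof (rule K)
      show "?J m = I m" if "m \<notin> {16, 17, 21, 26, cn}" "m < t" for m using h(1)[of m] that by auto
      show "\<forall>i<length ys. ?J (t + 1 + i) = int (ys ! i)" using h(2) cn t(2) I(6) by auto
    qed (use h cn I t in auto)
    then show "wp D N (Basic (ISub cn 21 st) ;; Basic (ISub cn cn 1) ;; Basic (IStore cn st)) Q I' R' y"
      using st h(3) cn t(3) by (auto simp: wp_simps)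
  qed (use I s t th ys in auto)
  then show ?thesis using I t cn by (simp add: wp_simps filter_com_def)
qed

lemma decode_com_wp:
  assumes I: "I 1 = 1" "I 5 = int h" "I 7 = int (length s)" "0 < length s" "I 9 = int P" "I 10 = int T" "I 13 = int z"
    and s: "\<forall>i<length s. I (h + 1 + i) = int (s ! i)" "set s \<subseteq> {..<N}" "40 \<le> h"
    and p: "p = s ! (z mod P mod length s)" and q: "q = s ! (z div P mod P mod length s)"
    and j: "j = z div P div P"
    and K: "\<And>I' R'. (\<And>m. m \<notin> {13, 17, 18, 19, 20} \<Longrightarrow> I' m = I m) \<Longrightarrow> I' 18 = int p \<Longrightarrow>
      R' 1 = R 1 \<Longrightarrow> R' 4 = shell D p q T j \<Longrightarrow> R' 5 = shell D p q T (Suc j) \<Longrightarrow> Q I' R' (x - 19)"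
  shows "wp D N decode_com Q I R x"
proof -
  have rd: "I (nat (int w mod int (length s) + int h + 1)) = int (s ! (w mod length s))" for w
  proof -
    have "nat (int w mod int (length s) + int h + 1) = h + 1 + w mod length s"
      by (simp add: zmod_int[symmetric] nat_add_distrib)
    then show ?thesis using s(1) I(4) by simp
  qed
  have lt: "s ! (w mod length s) < N" for w
    using s(2) I(4) by (metis lessThan_iff mod_less_divisor nth_mem subset_iff)
  let ?I1 = "I(17 := int (z mod P) mod int (length s) + int h + 1, 18 := int p, 13 := int (z div P))"
  let ?I2 = "?I1(17 := int (z div P mod P) mod int (length s) + int h + 1, 19 := int q, 20 := int j)"
  let ?R = "R(2 := D p q, 3 := D p q / real T, 6 := real j * (D p q / real T),
     4 := D p q + real j * (D p q / real T), 5 := D p q + real j * (D p q / real T) + D p q / real T)"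
  have "Q ?I2 ?R (x - 19)"
    by (rule K) (auto simp: shell_def distrib_right add_divide_distrib)
  moreover have "nat (int w mod int (length s) + int h + 1) \<notin> {13, 17, 18, 19, 20}" for w
  proof -
    have "nat (int w mod int (length s) + int h + 1) = h + 1 + w mod length s"
      by (simp add: zmod_int[symmetric] nat_add_distrib)
    then show ?thesis using s(3) by auto
  qed
  ultimately show ?thesis
    using I rd lt
    unfolding decode_com_def
    by (simp add: wp_simps zmod_int[symmetric] zdiv_int[symmetric] p q j)
qed

lemma commit_com_wp:
  assumes I: "I 1 = 1" "I 2 = 2" "I 4 = int (2 * c)" "I 5 = int h" "I 7 = int n" "I 12 = int m"
      "I 21 = int v" "I 23 = int b" "I 24 = int e"
    and a: "a + e = n" "a \<le> b"
    and acc: "\<And>I' y. n \<le> 2 * c * a \<Longrightarrow> 2 * b \<le> n \<Longrightarrow> m * (b - a) \<le> n \<Longrightarrow>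
      (\<And>m. m \<notin> {5, 6, 15, 17} \<Longrightarrow> I' m = I m) \<Longrightarrow> I' 5 = int (h + 1 + n) \<Longrightarrow> I' 6 = int v \<Longrightarrow>
      x - 15 \<le> y \<Longrightarrow> Q I' R y"
    and rej: "\<And>I' y. \<not> (n \<le> 2 * c * a \<and> 2 * b \<le> n \<and> m * (b - a) \<le> n) \<Longrightarrow>
      (\<And>m. m \<notin> {15, 17} \<Longrightarrow> I' m = I m) \<Longrightarrow> x - 15 \<le> y \<Longrightarrow> Q I' R y"
  shows "wp D N commit_com Q I R x"
proof -
  have eq: "int n - int e = int a" using a by auto
  have 1: "2 * int c * int a < int n \<longleftrightarrow> \<not> n \<le> 2 * c * a"
  proof -
    have "2 * int c * int a = int (2 * c * a)" by simp
    then show ?thesis by (simp only: of_nat_less_iff not_le)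
  qed
  have 2: "int n < int b * 2 \<longleftrightarrow> \<not> 2 * b \<le> n" by auto
  have 3: "int n < (int b - int a) * int m \<longleftrightarrow> \<not> m * (b - a) \<le> n"
  proof -
    have "(int b - int a) * int m = int (m * (b - a))" using a(2) by (simp add: of_nat_diff)
    then show ?thesis by (simp only: of_nat_less_iff not_le)
  qed
  let ?I1 = "I(15 := int a, 17 := 2 * int c * int a)"
  let ?I2 = "I(15 := int a, 17 := int b * 2)"
  let ?I3 = "I(15 := int a, 17 := (int b - int a) * int m)"
  have "Q ?I1 R (x - 3)" if "\<not> n \<le> 2 * c * a" by (rule rej) (use that in auto)
  moreover have "Q ?I2 R (x - 6)" if "\<not> 2 * b \<le> n" by (rule rej) (use that in auto)
  moreover have "Q ?I3 R (x - 10)" if "\<not> m * (b - a) \<le> n" by (rule rej) (use that in auto)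
  moreover have "Q (I(17 := (int b - int a) * int m, 5 := int h + int n + 1, 15 := 0, 6 := int v)) R (x - 15)"
    if "n \<le> 2 * c * a" "2 * b \<le> n" "m * (b - a) \<le> n"
    by (rule acc) (use that in auto)
  ultimately show ?thesis
    unfolding commit_com_def using I
    by (simp add: wp_simps eq 1 2 3)
qed

text \<open>\<open>F\<close> is the budget needed after a rejection and \<open>G\<close> the saving
  after an acceptance. As acceptance has probability at least \<open>1 / (16 * c\<^sup>2)\<close>,
  the expected saving is \<open>G\<close> times this and may be set against the cost of the
  attempt.\<close>

lemma (in doubling_metric) split_com_wp:
  assumes I: "I 1 = 1" "I 2 = 2" "I 4 = int (2 * c)" "I 5 = int h" "I 6 = int t" "I 7 = int (length s)"
      "I 9 = 2 ^ K" "I 10 = 2 ^ k" "I 12 = int (4 * c * K)"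
    and s: "\<forall>i<length s. I (h + 1 + i) = int (s ! i)" "distinct s" "set s \<subseteq> {..<N}"
    and h: "40 \<le> h" "h + 1 + length s \<le> t"
    and c: "2 * L ^ 4 \<le> c" "2 * c < length s"
    and K: "length s \<le> 2 ^ K" "2 ^ K \<le> 2 * length s" and k: "8 * c * K \<le> 2 ^ k"
    and G: "0 \<le> G" "F + 18 * real (length s) + 6 * (2 * real K + real k) + 60 - G / (16 * (real c)\<^sup>2) \<le> x"
    and acc: "\<And>I' R' y p q j v. p \<in> set s \<Longrightarrow> q \<in> set s \<Longrightarrow> j < 2 ^ k \<Longrightarrow>
      accept D c (4 * c * K) s p q (2 ^ k) j \<Longrightarrow>
      (\<And>m. m \<notin> {5, 6} \<Longrightarrow> m \<notin> {13..24} \<Longrightarrow> m \<noteq> 26 \<Longrightarrow> m < t \<Longrightarrow> I' m = I m) \<Longrightarrow>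
      I' 5 = int (h + 1 + length s) \<Longrightarrow> I' 6 = int v \<Longrightarrow>
      segments I' t [inner_part D s p (shell D p q (2 ^ k) (Suc j)), outer_part D s p (shell D p q (2 ^ k) j)] v \<Longrightarrow>
      R' 1 = R 1 \<Longrightarrow> F - G \<le> y \<Longrightarrow> Q I' R' y"
    and rej: "\<And>I' R' y. (\<And>m. m \<notin> {13..24} \<Longrightarrow> m \<noteq> 26 \<Longrightarrow> m < t \<Longrightarrow> I' m = I m) \<Longrightarrow>
      R' 1 = R 1 \<Longrightarrow> F \<le> y \<Longrightarrow> Q I' R' y"
  shows "wp D N split_com Q I R x"
proof -
  define n where "n = length s"
  define P T :: nat where "P = 2 ^ K" and "T = 2 ^ k"
  define p where "p z = s ! (z mod P mod n)" for z
  define q where "q z = s ! (z div P mod P mod n)" for z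
  define j where "j z = z div P div P" for z
  define S1 where "S1 z = inner_part D s (p z) (shell D (p z) (q z) T (Suc (j z)))" for z
  define S2 where "S2 z = outer_part D s (p z) (shell D (p z) (q z) T (j z))" for z
  define Z where "Z = {z\<in>{..<P * P * T}. accept D c (4 * c * K) s (p z) (q z) T (j z)}"
  have n: "0 < n" using c(2) unfolding n_def by linarith
  have "P * P * T \<le> 16 * c\<^sup>2 * card Z"
    unfolding Z_def p_def q_def j_def n_def
    by (rule many_accepted) (use s c K k in \<open>auto simp: P_def T_def\<close>)
  from of_nat_mono[OF this, where 'a = real]
  have Z: "real (P * P * T) \<le> 16 * (real c)\<^sup>2 * real (card Z)" by simp
  have PPT: "P * P * T = 2 ^ (2 * K + k)" by (simp add: P_def T_def power_add mult_2)
  have "0 < real (P * P * T)" by (simp add: P_def T_def)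
  with Z have c0: "0 < c" by (cases "c = 0") auto
  have pq: "p z \<in> set s" "q z \<in> set s" for z using n by (auto simp: p_def q_def n_def)
  have jT: "j z < T" if "z < P * P * T" for z
  proof -
    have "z < T * (P * P)" using that by (simp add: ac_simps)
    then have "z div (P * P) < T" by (simp add: less_mult_imp_div_less)
    then show ?thesis unfolding j_def by (simp add: div_mult2_eq)
  qed
  let ?commit = "wp D N commit_com Q"
  let ?second = "wp D N (filter_com True 4 22 24) ?commit"
  let ?first = "wp D N (filter_com False 5 6 23) (wp D N (Basic (IConst 15 0) ;; Basic (IAdd 22 21 15)) ?second)"
  \<comment> \<open>The 52 consists of 19 for decoding, 8 for each of the two filters, 2 for the
    copy between them and 15 for \<open>commit_com\<close>; each filter adds 9 per point.\<close>
  have after: "wp D N decode_com ?first I' R y"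
    if z: "z < P * P * T"
      and I': "\<And>m. m \<notin> {13, 14, 15, 21} \<Longrightarrow> I' m = I m" "I' 13 = int z"
      and y: "(if z \<in> Z then F - G else F) + 18 * real n + 52 \<le> y" for z I' y
  proof (rule decode_com_wp[where h = h and s = s and P = P and T = T and z = z and p = "p z" and q = "q z" and j = "j z"])
    fix I1 and R1 :: "nat \<Rightarrow> real"
    assume h1: "\<And>m. m \<notin> {13, 17, 18, 19, 20} \<Longrightarrow> I1 m = I' m" "I1 18 = int (p z)" "R1 1 = R 1"
      "R1 4 = shell D (p z) (q z) T (j z)" "R1 5 = shell D (p z) (q z) T (Suc (j z))"
    have I1: "I1 m = I m" if "m \<notin> {13..24}" for m using h1(1)[of m] I'(1)[of m] that by auto
    show "?first I1 R1 (y - 19)"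
    proof (rule filter_com_wp[where h = h and s = s and p = "p z" and t = t and ys = "S1 z"])
      fix I2 y2 and R2 :: "nat \<Rightarrow> real"
      assume h2: "\<And>m. m \<notin> {16, 17, 21, 26, 23} \<Longrightarrow> m < t \<Longrightarrow> I2 m = I1 m"
        "I2 t = int (length (S1 z))" "\<forall>i<length (S1 z). I2 (t + 1 + i) = int (S1 z ! i)"
        "I2 21 = int (t + 1 + length (S1 z))" "I2 23 = int (length (S1 z))"
        "\<And>z. z \<noteq> 6 \<Longrightarrow> R2 z = R1 z" "y - 19 - (9 * real (length s) + 8) \<le> y2"
      have I2: "I2 m = I m" if "m \<notin> {13..24}" "m \<noteq> 26" "m < t" for m using h2(1)[of m] I1[of m] that by auto
      define t' where "t' = t + 1 + length (S1 z)"
      let ?I = "I2(15 := 0, 22 := int t')"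
      have "?second ?I R2 (y2 - 2)"
      proof (rule filter_com_wp[where h = h and s = s and p = "p z" and t = t' and ys = "S2 z"])
        fix I3 y3 and R3 :: "nat \<Rightarrow> real"
        assume h3: "\<And>m. m \<notin> {16, 17, 21, 26, 24} \<Longrightarrow> m < t' \<Longrightarrow> I3 m = ?I m"
          "I3 t' = int (length (S2 z))" "\<forall>i<length (S2 z). I3 (t' + 1 + i) = int (S2 z ! i)"
          "I3 21 = int (t' + 1 + length (S2 z))" "I3 24 = int (length (S2 z))"
          "\<And>z. z \<noteq> 6 \<Longrightarrow> R3 z = R2 z" "y2 - 2 - (9 * real (length s) + 8) \<le> y3"
        have I3: "I3 m = I m" if "m \<notin> {13..24}" "m \<noteq> 26" "m < t" for m
          using h3(1)[of m] I2[of m] that by (auto simp: t'_def)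
        have R3: "R3 1 = R 1" using h3(6)[of 1] h2(6)[of 1] h1(3) by simp
        define v where "v = t' + 1 + length (S2 z)"
        define a where "a = length (inner_part D s (p z) (shell D (p z) (q z) T (j z)))"
        have budget: "(if z \<in> Z then F - G else F) \<le> y3 - 15"
          using y h2(7) h3(7) by (simp add: n_def split: if_splits)
        have ab: "a \<le> length (S1 z)"
        proof -
          have N: "p z < N" "q z < N" using pq s(3) by auto
          have "shell D (p z) (q z) T (j z) \<le> shell D (p z) (q z) T (Suc (j z))"
            unfolding shell_def using dist_nonneg[OF N] by (intro add_left_mono mult_right_mono) auto
          then show ?thesis unfolding a_def S1_def inner_part_def
            by (induction s) auto
        qed
        have segs: "segments I3 t [S1 z, S2 z] v"
          using h3(1)[of t] h3(1)[of "t + 1 + _"] h2(2,3) h3(2,3) h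
          by (auto simp: v_def t'_def)
        show "?commit I3 R3 y3"
        proof (rule commit_com_wp[where c = c and h = h and n = n and m = "4 * c * K" and v = v and b = "length (S1 z)"
              and e = "length (S2 z)" and a = a])
          show "a + length (S2 z) = n" unfolding a_def S2_def n_def by (rule length_parts)
          show "I3 23 = int (length (S1 z))" using h3(1)[of 23] h2(5) h by (simp add: t'_def)
          show "I3 21 = int v" using h3(4) by (simp add: v_def)
          have acc_eq: "accept D c (4 * c * K) s (p z) (q z) T (j z) \<longleftrightarrow>
              n \<le> 2 * c * a \<and> 2 * length (S1 z) \<le> n \<and> 4 * c * K * (length (S1 z) - a) \<le> n"
            by (simp add: accept_def Let_def a_def S1_def n_def)
          { fix I4 y4
            assume h4: "n \<le> 2 * c * a" "2 * length (S1 z) \<le> n" "4 * c * K * (length (S1 z) - a) \<le> n"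
              "\<And>m. m \<notin> {5, 6, 15, 17} \<Longrightarrow> I4 m = I3 m" "I4 5 = int (h + 1 + n)" "I4 6 = int v" "y3 - 15 \<le> y4"
            have "accept D c (4 * c * K) s (p z) (q z) T (j z)" using acc_eq h4 by blast
            then have "z \<in> Z" using z by (simp add: Z_def)
            show "Q I4 R3 y4"
            proof (rule acc[of "p z" "q z" "j z" I4 v])
              show "accept D c (4 * c * K) s (p z) (q z) (2 ^ k) (j z)" using \<open>z \<in> Z\<close> by (simp add: Z_def T_def)
              show "segments I4 t [inner_part D s (p z) (shell D (p z) (q z) (2 ^ k) (Suc (j z))),
                  outer_part D s (p z) (shell D (p z) (q z) (2 ^ k) (j z))] v"
                using segments_cong[OF segs, of I4] h4(4) h by (auto simp: S1_def S2_def T_def)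
              show "F - G \<le> y4" using budget h4(7) \<open>z \<in> Z\<close> by simp
              show "I4 m = I m" if "m \<notin> {5, 6}" "m \<notin> {13..24}" "m \<noteq> 26" "m < t" for m
                using h4(4)[of m] I3[of m] that by auto
            qed (use pq jT[OF z] h4 R3 in \<open>auto simp: T_def n_def\<close>) }
          { fix I4 y4
            assume h4: "\<not> (n \<le> 2 * c * a \<and> 2 * length (S1 z) \<le> n \<and> 4 * c * K * (length (S1 z) - a) \<le> n)"
              "\<And>m. m \<notin> {15, 17} \<Longrightarrow> I4 m = I3 m" "y3 - 15 \<le> y4"
            have "\<not> accept D c (4 * c * K) s (p z) (q z) T (j z)" using acc_eq h4 by blast
            then have "z \<notin> Z" by (simp add: Z_def)
            show "Q I4 R3 y4"
            proof (rule rej)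
              show "F \<le> y4" using budget h4(3) \<open>z \<notin> Z\<close> by simp
              show "I4 m = I m" if "m \<notin> {13..24}" "m \<noteq> 26" "m < t" for m
                using h4(2)[of m] I3[of m] that by auto
            qed (rule R3) }
        qed (use ab I I3 h h3(5) in \<open>auto simp: n_def\<close>)
      next
        have I18: "I2 18 = int (p z)" using h2(1)[of 18] h1(2) h by simp
        then show "?I 18 = int (p z)" by simp
        show "\<forall>i<length s. ?I (h + 1 + i) = int (s ! i)" using s(1) I2 h by auto
        show "p z < N" using pq s(3) by auto
        show "S2 z = filter (\<lambda>w. (R2 4 < D (p z) w) = True) s"
          using h2(6)[of 4] h1(4) by (simp add: S2_def outer_part_def)
      qed (use I I2 h s in \<open>auto simp: t'_def\<close>)
      moreover have "I2 21 = int t'" using h2(4) by (simp add: t'_def)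
      ultimately show "wp D N (Basic (IConst 15 0) ;; Basic (IAdd 22 21 15)) ?second I2 R2 y2"
        by (simp add: wp_simps)
    next
      show "\<forall>i<length s. I1 (h + 1 + i) = int (s ! i)" using s(1) I1 h by auto
      show "p z < N" using pq s(3) by auto
      show "S1 z = filter (\<lambda>w. (R1 5 < D (p z) w) = False) s"
        using h1(5) by (simp add: S1_def inner_part_def)
    qed (use I I1 h s h1 in auto)
  qed (use I I' s h n in \<open>auto simp: n_def p_def q_def j_def P_def T_def\<close>)
  define r where "r = 2 * K + k"
  let ?f = "\<lambda>z. (if z \<in> Z then F - G else F) + 18 * real n + 52"
  \<comment> \<open>\<open>coin_loop_wp\<close> fixes the budget as an exact mean, so the surplus
    \<open>e\<close> is given to all outcomes equally.\<close>
  define e where "e = x - 4 - 6 * real r - 2 - (\<Sum>z<2 ^ r. ?f z) / 2 ^ r"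
  have "(\<Sum>z<2 ^ r. ?f z) = 2 ^ r * (F + 18 * real n + 52) - G * real (card Z)"
  proof -
    have "(\<Sum>z<2 ^ r. ?f z) = (\<Sum>z<2 ^ r. (F + 18 * real n + 52) - (if z \<in> Z then G else 0))"
      by (intro sum.cong) auto
    also have "\<dots> = 2 ^ r * (F + 18 * real n + 52) - (\<Sum>z<2 ^ r. if z \<in> Z then G else 0)"
      by (simp add: sum_subtractf)
    also have "(\<Sum>z<2 ^ r. if z \<in> Z then G else 0) = (\<Sum>z\<in>{..<2 ^ r} \<inter> Z. G)"
      by (rule sum.inter_restrict[symmetric]) simp
    also have "{..<2 ^ r} \<inter> Z = Z" unfolding r_def PPT[symmetric] Z_def by auto
    finally show ?thesis by simp
  qed
  then have "(\<Sum>z<2 ^ r. ?f z) / 2 ^ r = F + 18 * real n + 52 - G * (real (card Z) / 2 ^ r)"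
    by (simp add: diff_divide_distrib)
  moreover have "1 / (16 * (real c)\<^sup>2) \<le> real (card Z) / 2 ^ r"
  proof -
    have "(2::real) ^ r \<le> 16 * (real c)\<^sup>2 * real (card Z)" using Z unfolding PPT r_def by simp
    then show ?thesis using c0 by (simp add: field_simps)
  qed
  then have "G * (1 / (16 * (real c)\<^sup>2)) \<le> G * (real (card Z) / 2 ^ r)" using G(1) by (rule mult_left_mono)
  ultimately have e0: "0 \<le> e"
    using G(2) unfolding e_def n_def[symmetric] by (simp add: r_def)
  have "wp D N coin_loop (wp D N decode_com ?first)
      (I(21 := 2 ^ r, 14 := 1, 13 := 0)) R (x - 4)"
  proof (rule coin_loop_wp[where e = 0 and z = 0 and r = r and f = "\<lambda>z. ?f z + e"])
    show "x - 4 = 6 * real r + 2 + (\<Sum>z<2 ^ r. ?f z + e) / 2 ^ r"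
      by (subst sum.distrib) (simp add: e_def add_divide_distrib)
    fix I' z
    assume h: "z < 2 ^ r" "\<And>m. m \<notin> {13, 14, 15} \<Longrightarrow> I' m = (I(21 := 2 ^ r, 14 := 1, 13 := 0)) m"
      "I' 13 = int (0 * 2 ^ r + z)"
    show "wp D N decode_com ?first I' R (?f z + e)"
      by (rule after) (use h e0 in \<open>auto simp: PPT r_def\<close>)
  qed (use I in auto)
  moreover have "(2::int) ^ K * 2 ^ K * 2 ^ k = 2 ^ r" by (simp add: r_def power_add mult_2)
  ultimately show ?thesis
    by (simp add: split_com_def coins_com_def wp.simps(2,3) I(7,8) del: One_nat_def)
qed

subsection \<open>The potential argument\<close>

definition bounds_ok :: "nat \<Rightarrow> nat \<Rightarrow> nat \<Rightarrow> nat \<Rightarrow> bool" where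
  "bounds_ok c n K k \<longleftrightarrow> n \<le> 2 ^ K \<and> (K = 0 \<or> 2 ^ K < 2 * n) \<and> 8 * c * K \<le> 2 ^ k \<and> (k = 0 \<or> 2 ^ k < 16 * c * K)"

text \<open>Linear bounds suffice because every attempt scans the whole set anyway; they follow from
  \<open>i < 2 ^ i\<close>.\<close>

lemma bounds_ok_linear:
  assumes "bounds_ok c n K k"
  shows "K \<le> n" "k \<le> 16 * c * n"
proof -
  show K: "K \<le> n"
  proof (cases K)
    case (Suc K')
    have "K' < 2 ^ K'" by (rule less_exp)
    moreover have "2 ^ K' < n" using assms Suc by (auto simp: bounds_ok_def)
    ultimately show ?thesis using Suc by linarith
  qed simp
  have "k < 2 ^ k" by (rule less_exp)
  moreover have "k = 0 \<or> 2 ^ k < 16 * c * K" using assms by (simp add: bounds_ok_def)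
  ultimately have "k \<le> 16 * c * K" by linarith
  also have "\<dots> \<le> 16 * c * n" using K by simp
  finally show "k \<le> 16 * c * n" .
qed

text \<open>A set is searched by brute force only if its size is at most polylogarithmic in itself,
  which bounds it by a constant. So \<open>B\<close> depends on \<open>a\<close> and
  \<open>c\<close> alone.\<close>

lemma brute_force_bounded:
  fixes a c :: nat
  assumes "0 < c"
  obtains B :: real where
    "\<And>n K k. bounds_ok c n K k \<Longrightarrow> n \<le> 2 * c * (2 ^ a) ^ (k + 2) \<Longrightarrow>
       (8 * real n + 7) * real n + 4 * real K + 4 * real k + 30 \<le> B"
proof -
  obtain n0 where n0: "\<And>n K k. n0 \<le> n \<Longrightarrow> n \<le> 2 ^ K \<Longrightarrow> 2 ^ K < 2 * n \<Longrightarrow> 2 ^ k \<le> 16 * c * K \<Longrightarrow>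
      2 * c * (2 ^ a)\<^sup>2 * (2 ^ a) ^ k < n"
    using polylog_eventually_small[of "16 * c" "2 * c * (2 ^ a)\<^sup>2" a] by blast
  \<comment> \<open>Size at least 2 excludes \<open>K = 0\<close>, so that
    \<open>2 ^ K < 2 * n\<close> becomes available.\<close>
  define n1 where "n1 = max n0 2"
  show ?thesis
  proof (rule that)
    fix n K k assume h: "bounds_ok c n K k" "n \<le> 2 * c * (2 ^ a) ^ (k + 2)"
    have "n < n1"
    proof (rule ccontr)
      assume "\<not> n < n1"
      then have n: "n0 \<le> n" "2 \<le> n" by (auto simp: n1_def)
      have K: "0 < K" using h(1) n by (cases K) (auto simp: bounds_ok_def)
      have "2 * c * (2 ^ a)\<^sup>2 * (2 ^ a) ^ k < n"
        by (rule n0[of n K k]) (use h(1) n K assms in \<open>auto simp: bounds_ok_def\<close>)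
      then show False using h(2) by (simp add: power_add power2_eq_square ac_simps)
    qed
    moreover note bounds_ok_linear[OF h(1)]
    ultimately have "n \<le> n1" "K \<le> n1" "k \<le> 16 * c * n1"
      by (auto intro: order_trans[of k "16 * c * n"])
    then have "real n \<le> real n1" "real K \<le> real n1" "real k \<le> real (16 * c * n1)"
      by (simp_all only: of_nat_le_iff)
    then show "(8 * real n + 7) * real n + 4 * real K + 4 * real k + 30
        \<le> (8 * real n1 + 7) * real n1 + 4 * real n1 + 4 * real (16 * c * n1) + 30"
      by (intro add_mono mult_mono) auto
  qed
qed

locale closest_pair_search = doubling_metric +
  fixes c :: nat and B :: real
  assumes c: "c = 2 * L ^ 4" and two_points: "2 \<le> N"
    and B: "\<And>n K k. bounds_ok c n K k \<Longrightarrow> n \<le> 2 * c * L ^ (k + 2) \<Longrightarrow>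
       (8 * real n + 7) * real n + 4 * real K + 4 * real k + 30 \<le> B"
begin

lemma c_ge: "2 \<le> c"
proof -
  have "1 \<le> L ^ 4" using L_pos two_points by simp
  then show ?thesis by (simp add: c)
qed

lemma B_ge: "30 \<le> B"
  using B[of 0 0 0] by (simp add: bounds_ok_def)

lemma closest_pair_le:
  assumes "x < N" "y < N" "x \<noteq> y"
  shows "closest_pair D N \<le> D x y"
proof -
  have "finite {D x y | x y. x < N \<and> y < N \<and> x \<noteq> y}"
    by (rule finite_subset[of _ "(\<lambda>(x, y). D x y) ` ({..<N} \<times> {..<N})"]) auto
  then show ?thesis unfolding closest_pair_def using assms by (intro Min_le) auto
qed

lemma closest_pair_attained: "\<exists>x<N. \<exists>y<N. x \<noteq> y \<and> D x y = closest_pair D N"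
proof -
  have "finite {D x y | x y. x < N \<and> y < N \<and> x \<noteq> y}"
    by (rule finite_subset[of _ "(\<lambda>(x, y). D x y) ` ({..<N} \<times> {..<N})"]) auto
  moreover have "D 0 1 \<in> {D x y | x y. x < N \<and> y < N \<and> x \<noteq> y}" using two_points by fastforce
  ultimately have "closest_pair D N \<in> {D x y | x y. x < N \<and> y < N \<and> x \<noteq> y}"
    unfolding closest_pair_def by (intro Min_in) auto
  then obtain x y where "closest_pair D N = D x y" "x < N" "y < N" "x \<noteq> y" by blast
  then show ?thesis by (intro exI[of _ x] conjI exI[of _ y]) auto
qed

definition candidates :: "nat list list \<Rightarrow> real \<Rightarrow> bool" where
  "candidates qs \<delta> \<longleftrightarrow> (\<forall>s\<in>set qs. distinct s \<and> set s \<subseteq> {..<N}) \<and> closest_pair D N \<le> \<delta> \<and>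
     (\<delta> = closest_pair D N \<or>
      (\<exists>s\<in>set qs. \<exists>x\<in>set s. \<exists>y\<in>set s. x \<noteq> y \<and> D x y = closest_pair D N))"

lemma candidates_brute:
  assumes "candidates (s # qs) \<delta>"
  shows "candidates qs (pairs_min D s \<delta>)"
proof -
  have s: "distinct s" "set s \<subseteq> {..<N}" and \<delta>: "closest_pair D N \<le> \<delta>"
    using assms by (auto simp: candidates_def)
  have "closest_pair D N \<le> pairs_min D s \<delta>"
    using pairs_min_cases[OF s(1), of D \<delta>]
  proof (elim disjE bexE conjE)
    fix x y assume "x \<in> set s" "y \<in> set s" "x \<noteq> y" "pairs_min D s \<delta> = D x y"
    then show ?thesis using closest_pair_le[of x y] s(2) by auto
  qed (use \<delta> in simp)
  moreover have "pairs_min D s \<delta> \<le> closest_pair D N"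
    if "\<delta> = closest_pair D N \<or> (\<exists>x\<in>set s. \<exists>y\<in>set s. x \<noteq> y \<and> D x y = closest_pair D N)"
    using that
  proof (elim disjE bexE conjE)
    assume "\<delta> = closest_pair D N"
    then show ?thesis using pairs_min_le[of D s \<delta>] by simp
  next
    fix x y assume xy: "x \<in> set s" "y \<in> set s" "x \<noteq> y" "D x y = closest_pair D N"
    then have "D x y = D y x" using s(2) by (intro dist_sym) auto
    then show ?thesis using pairs_min_le_dist[OF xy(1-3)] xy(4) by simp
  qed
  ultimately show ?thesis using assms unfolding candidates_def by auto
qed

lemma candidates_split:
  assumes "candidates (s # qs) \<delta>" "p \<in> set s" "q \<in> set s" "2 * c * L ^ (k + 2) < length s" "j < 2 ^ k"
    and acc: "accept D c m s p q (2 ^ k) j"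
  shows "candidates (qs @ [inner_part D s p (shell D p q (2 ^ k) (Suc j)), outer_part D s p (shell D p q (2 ^ k) j)]) \<delta>"
    (is "candidates (qs @ [?S1, ?S2]) \<delta>")
proof -
  have s: "distinct s" "set s \<subseteq> {..<N}" using assms by (auto simp: candidates_def)
  have "\<exists>s\<in>{?S1, ?S2}. \<exists>x\<in>set s. \<exists>y\<in>set s. x \<noteq> y \<and> D x y = closest_pair D N"
    if xy: "x \<in> set s" "y \<in> set s" "x \<noteq> y" "D x y = closest_pair D N" for x y
  proof -
    have "{x, y} \<subseteq> set ?S1 \<or> {x, y} \<subseteq> set ?S2"
    proof (rule accept_pair[OF s assms(2-4) refl assms(5) acc xy(1,2)])
      fix u v assume "u \<in> set s" "v \<in> set s" "u \<noteq> v"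
      then show "D x y \<le> D u v" unfolding xy(4) using s(2) by (intro closest_pair_le) auto
    qed
    then show ?thesis using xy by blast
  qed
  moreover have "distinct ?S1 \<and> set ?S1 \<subseteq> {..<N}" "distinct ?S2 \<and> set ?S2 \<subseteq> {..<N}"
    using s by (auto simp: inner_part_def outer_part_def)
  ultimately show ?thesis using assms(1) unfolding candidates_def set_append
    by (simp only: list.set ball_Un bex_Un ball_simps bex_simps) blast
qed

text \<open>Calibrated for \<open>potential_drop\<close>: an accepted split releases at least
  \<open>4800 * c ^ 3 * n\<close>; times the probability bound \<open>1 / (16 * c\<^sup>2)\<close>
  this is \<open>300 * c * n\<close>, enough for one attempt.\<close>

definition slope :: real where
  "slope = 4 * c * (4800 * real c ^ 3 + B)"

text \<open>The summand \<open>B\<close> pays for a brute-force search. A split turns one set into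
  two and so needs another \<open>B\<close>, which the gain in the first summand has to
  cover.\<close>

definition weight :: "nat \<Rightarrow> real" where
  "weight n = slope * (real n * log 2 (real n)) + B"

definition potential :: "nat list list \<Rightarrow> real" where
  "potential qs = 5 + (\<Sum>s\<leftarrow>qs. weight (length s))"

lemma slope_nonneg: "0 \<le> slope"
  using B_ge by (simp add: slope_def)

lemma weight_ge: "B \<le> weight n"
proof -
  have "0 \<le> real n * log 2 (real n)" by (cases n) auto
  then show ?thesis using slope_nonneg by (simp add: weight_def)
qed

lemma potential_nonneg: "5 \<le> potential qs"
proof -
  have "0 \<le> weight n" for n using B_ge weight_ge[of n] by linarith
  then have "0 \<le> (\<Sum>s\<leftarrow>qs. weight (length s))" by (intro sum_list_nonneg) auto
  then show ?thesis by (simp add: potential_def)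
qed

lemma potential_split:
  assumes acc: "accept D c (4 * c * K) s p q T j" and K: "length s \<le> 2 ^ K" "0 < length s"
    and pq: "p < N" "q < N"
  shows "potential (qs @ [inner_part D s p (shell D p q T (Suc j)), outer_part D s p (shell D p q T j)])
    \<le> potential (s # qs) - (slope * real (length s) / (4 * real c) - B)"
proof -
  let ?f = "\<lambda>n::nat. real n * log 2 (real n)"
  let ?S1 = "inner_part D s p (shell D p q T (Suc j))" and ?S2 = "outer_part D s p (shell D p q T j)"
  have "?f (length ?S1) + ?f (length ?S2) \<le> ?f (length s) - real (length s) / (4 * real c)"
    by (rule accept_potential[OF acc K refl]) (rule dist_nonneg[OF pq])
  then have "slope * (?f (length ?S1) + ?f (length ?S2)) \<le> slope * (?f (length s) - real (length s) / (4 * real c))"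
    using slope_nonneg by (rule mult_left_mono)
  then show ?thesis by (simp add: potential_def weight_def algebra_simps)
qed

text \<open>The left-hand side is the cost of one attempt:
  \<open>18 * n + 12 * K + 6 * k + 60\<close> for \<open>split_com\<close>,
  \<open>4 * K + 4 * k + 14\<close> for \<open>size_com\<close>, and 3 for the test of the main
  loop, the choice between splitting and brute force, and the jump back.\<close>

lemma potential_drop:
  assumes "bounds_ok c n K k" "0 < n"
  shows "18 * real n + 16 * real K + 10 * real k + 77 \<le> (slope * real n / (4 * real c) - B) / (16 * (real c)\<^sup>2)"
    and "0 \<le> slope * real n / (4 * real c) - B"
proof -
  have c0: "2 \<le> real c" using c_ge by simp
  have n: "1 \<le> real n" using assms(2) by simp
  have "slope * real n / (4 * real c) = (4800 * real c ^ 3 + B) * real n" using c0 by (simp add: slope_def)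
  also have "\<dots> = 4800 * real c ^ 3 * real n + B * real n" by (simp add: algebra_simps)
  also have "\<dots> \<ge> 4800 * real c ^ 3 * real n + B"
    using mult_left_mono[OF n, of B] B_ge by simp
  finally have *: "4800 * real c ^ 3 * real n \<le> slope * real n / (4 * real c) - B" by simp
  then show "0 \<le> slope * real n / (4 * real c) - B" by (rule order_trans[rotated]) simp
  have cn: "2 * real n \<le> real c * real n" using c0 by (intro mult_right_mono) auto
  have "real K \<le> real n" "real k \<le> real (16 * c * n)"
    using bounds_ok_linear[OF assms(1)] by (simp_all only: of_nat_le_iff)
  moreover have "real (16 * c * n) = 16 * (real c * real n)" by simp
  ultimately have "18 * real n + 16 * real K + 10 * real k + 77 \<le> 300 * (real c * real n)"
    using cn n by linarith
  also have "\<dots> = 4800 * real c ^ 3 * real n / (16 * (real c)\<^sup>2)"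
    using c0 by (simp add: field_simps power2_eq_square power3_eq_cube)
  also have "\<dots> \<le> (slope * real n / (4 * real c) - B) / (16 * (real c)\<^sup>2)"
    using * by (rule divide_right_mono) simp
  finally show "18 * real n + 16 * real K + 10 * real k + 77 \<le> (slope * real n / (4 * real c) - B) / (16 * (real c)\<^sup>2)" .
qed

definition state_ok :: "(nat \<Rightarrow> int) \<Rightarrow> (nat \<Rightarrow> real) \<Rightarrow> nat list list \<Rightarrow> nat \<Rightarrow> nat \<Rightarrow> bool" where
  "state_ok I R qs h t \<longleftrightarrow> I 1 = 1 \<and> I 2 = 2 \<and> I 3 = int L \<and> I 4 = int (2 * c) \<and> I 5 = int h \<and> I 6 = int t \<and>
     40 \<le> h \<and> segments I h qs t \<and> candidates qs (R 1)"

text \<open>The budget differs from the potential by the test just executed (\<open>- 1\<close>) and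
  the jump back to it (\<open>+ 1\<close>). After a rejection the queue is unchanged, so the
  accepted outcomes pay for the attempt.\<close>

lemma body_com_wp:
  assumes ok: "state_ok I R (s # qs) h t" and x: "potential (s # qs) - 1 \<le> x"
    and Q: "\<And>I' R' y qs' h' t'. state_ok I' R' qs' h' t' \<Longrightarrow> potential qs' + 1 \<le> y \<Longrightarrow> Q I' R' y"
  shows "wp D N body_com Q I R x"
proof -
  define n where "n = length s"
  have I: "I 1 = 1" "I 2 = 2" "I 3 = int L" "I 4 = int (2 * c)" "I 5 = int h" "I 6 = int t" "40 \<le> h"
    "I h = int n" "\<forall>i<length s. I (h + 1 + i) = int (s ! i)" "segments I (h + 1 + n) qs t"
    "candidates (s # qs) (R 1)"
    using ok by (auto simp: state_ok_def n_def)
  have t: "h + 1 + n \<le> t" using I(10) by (rule segments_le)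
  have s: "distinct s" "set s \<subseteq> {..<N}" using I(11) by (auto simp: candidates_def)
  have "wp D N size_com (wp D N (IfI 22 7 split_com brute_com) Q) I R x"
  proof (rule size_com_wp[where L = L and c = c and h = h and n = n])
    fix I1 y K k
    assume h1: "n \<le> 2 ^ K" "K = 0 \<or> 2 ^ K < 2 * n" "8 * c * K \<le> 2 ^ k" "k = 0 \<or> 2 ^ k < 16 * c * K"
      "\<And>m. m \<notin> {7, 8, 9, 10, 11, 12, 14, 22} \<Longrightarrow> I1 m = I m" "I1 7 = int n" "I1 9 = 2 ^ K" "I1 10 = 2 ^ k"
      "I1 12 = int (4 * c * K)" "I1 22 = int (2 * c * L ^ (k + 2))" "x - (4 * real K + 4 * real k + 14) \<le> y"
    have bok: "bounds_ok c n K k" using h1 by (simp add: bounds_ok_def)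
    have I1: "I1 1 = 1" "I1 2 = 2" "I1 3 = int L" "I1 4 = int (2 * c)" "I1 5 = int h" "I1 6 = int t"
      "\<forall>i<length s. I1 (h + 1 + i) = int (s ! i)" using h1(5) I by auto
    have mem: "I1 m = I m" if "40 \<le> m" for m using h1(5) that by auto
    show "wp D N (IfI 22 7 split_com brute_com) Q I1 R y"
    proof (cases "2 * c * L ^ (k + 2) < n")
      case True
      have n0: "0 < n" using True by simp
      let ?G = "slope * real n / (4 * real c) - B"
      have "wp D N split_com Q I1 R (y - 1)"
      proof (rule split_com_wp[where c = c and h = h and t = t and s = s and K = K and k = k and
            F = "potential (s # qs) + 1" and G = ?G])
        show "0 \<le> ?G" by (rule potential_drop[OF bok n0])
        show "potential (s # qs) + 1 + 18 * real (length s) + 6 * (2 * real K + real k) + 60 -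
            ?G / (16 * (real c)\<^sup>2) \<le> y - 1"
          using potential_drop(1)[OF bok n0] h1(11) x by (simp add: n_def)
        have "1 \<le> L ^ (k + 2)" using L_pos two_points by simp
        then have "2 * c * 1 \<le> 2 * c * L ^ (k + 2)" by (intro mult_left_mono) auto
        then show "2 * c < length s" using True unfolding n_def by linarith
        have "2 ^ K \<le> 2 * n" using h1(2) n0 by (cases "K = 0") auto
        then show "2 ^ K \<le> 2 * length s" unfolding n_def .
      next
        fix I' y' p q j v and R' :: "nat \<Rightarrow> real"
        assume a: "p \<in> set s" "q \<in> set s" "j < 2 ^ k" "accept D c (4 * c * K) s p q (2 ^ k) j"
          "\<And>m. m \<notin> {5, 6} \<Longrightarrow> m \<notin> {13..24} \<Longrightarrow> m \<noteq> 26 \<Longrightarrow> m < t \<Longrightarrow> I' m = I1 m"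
          "I' 5 = int (h + 1 + length s)" "I' 6 = int v"
          "segments I' t [inner_part D s p (shell D p q (2 ^ k) (Suc j)), outer_part D s p (shell D p q (2 ^ k) j)] v"
          "R' 1 = R 1" "potential (s # qs) + 1 - ?G \<le> y'"
        let ?qs = "qs @ [inner_part D s p (shell D p q (2 ^ k) (Suc j)), outer_part D s p (shell D p q (2 ^ k) j)]"
        show "Q I' R' y'"
        proof (rule Q[of _ _ ?qs "h + 1 + n" v])
          have "segments I' (h + 1 + n) qs t"
            by (rule segments_cong[OF I(10)]) (use a(5) mem I(7) in auto)
          then have "segments I' (h + 1 + n) ?qs v" using a(8) by (rule segments_append)
          moreover have "candidates ?qs (R' 1)"
            unfolding a(9) by (rule candidates_split[OF I(11) a(1,2) _ a(3,4)]) (use True in \<open>simp add: n_def\<close>)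
          ultimately show "state_ok I' R' ?qs (h + 1 + n) v"
            using a(5-7) I1 I(7) t by (simp add: state_ok_def n_def)
          have "potential ?qs \<le> potential (s # qs) - ?G"
            unfolding n_def
            by (rule potential_split[OF a(4)]) (use h1(1) n0 a(1,2) s in \<open>auto simp: n_def\<close>)
          then show "potential ?qs + 1 \<le> y'" using a(10) by simp
        qed
      next
        fix I' y' and R' :: "nat \<Rightarrow> real"
        assume a: "\<And>m. m \<notin> {13..24} \<Longrightarrow> m \<noteq> 26 \<Longrightarrow> m < t \<Longrightarrow> I' m = I1 m" "R' 1 = R 1"
          "potential (s # qs) + 1 \<le> y'"
        show "Q I' R' y'"
        proof (rule Q[of _ _ "s # qs" h t])
          have "segments I' h (s # qs) t"
            by (rule segments_cong[of I]) (use ok a(1) mem I(7) in \<open>auto simp: state_ok_def\<close>)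
          then show "state_ok I' R' (s # qs) h t"
            using a I1 I(7,11) t unfolding state_ok_def by simp
        qed (rule a(3))
      qed (use I I1 h1 s t c in \<open>auto simp: n_def\<close>)
      moreover have "I1 22 < I1 7" unfolding h1(6,10) using True by (simp only: of_nat_less_iff)
      ultimately show ?thesis by (simp add: wp_simps)
    next
      case False
      have "wp D N brute_com (\<lambda>I R x. Q I R (x - 1)) I1 R (y - 1)"
      proof (rule brute_com_wp[where h = h and s = s])
        fix I' y' and R' :: "nat \<Rightarrow> real"
        assume a: "\<And>m. m \<notin> {5, 16, 17, 19, 25, 26} \<Longrightarrow> I' m = I1 m" "I' 5 = int (h + 1 + length s)"
          "R' 1 = pairs_min D s (R 1)" "y - 1 - ((8 * real (length s) + 7) * real (length s) + 7) \<le> y'"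
        show "Q I' R' (y' - 1)"
        proof (rule Q[of _ _ qs "h + 1 + n" t])
          have "segments I' (h + 1 + n) qs t"
            by (rule segments_cong[OF I(10)]) (use a(1) mem I(7) in auto)
          then show "state_ok I' R' qs (h + 1 + n) t"
            using a I1 I(7) t candidates_brute[OF I(11)] unfolding state_ok_def by (simp add: n_def)
          have "(8 * real n + 7) * real n + 4 * real K + 4 * real k + 30 \<le> B"
            using bok False by (intro B) auto
          then have "(8 * real n + 7) * real n + 4 * real K + 4 * real k + 30 + potential qs \<le> potential (s # qs)"
            using weight_ge[of n] by (simp add: potential_def n_def)
          then show "potential qs + 1 \<le> y' - 1"
            using a(4) h1(11) x by (simp add: n_def)
        qed
      qed (use I I1 h1 s in \<open>auto simp: n_def\<close>)
      moreover have "\<not> I1 22 < I1 7" unfolding h1(6,10) using False by (simp only: of_nat_less_iff not_False_eq_True)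
      ultimately show ?thesis by (simp add: wp_simps)
    qed
  qed (use I in auto)
  then show ?thesis by (simp add: body_com_def wp_simps)
qed

lemma init_com_wp:
  assumes L: "L = 2 ^ nat \<lceil>d\<rceil>"
    and Q: "\<And>I' R' y. state_ok I' R' [[0..<N]] 40 (41 + N) \<Longrightarrow>
      x - (5 * real (nat \<lceil>d\<rceil>) + 5 * real N + 30) \<le> y \<Longrightarrow> Q I' R' y"
  shows "wp D N init_com Q ((\<lambda>_. 0)(0 := int N)) ((\<lambda>_. 0)(0 := d)) x"
proof -
  let ?I = "(\<lambda>_. 0)(0 := int N, 1 := 1, 2 := 2, 3 := 1, 15 := 0)" and ?R = "(\<lambda>_. 0)(0 := d, 6 := 0)"
  let ?rest = "wp D N (Basic (IMul 4 3 3) ;; Basic (IMul 4 4 4) ;; Basic (IMul 4 4 2) ;; Basic (IMul 4 4 2) ;;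
     Basic (IConst 16 0) ;; Basic (Query 1 16 1) ;;
     Basic (IConst 5 40) ;; Basic (IStore 0 5) ;; Basic (IConst 6 41) ;; points_loop) Q"
  have "wp D N dim_loop ?rest ?I ?R (x - 5)"
  proof (rule dim_loop_wp[where e = 0 and d = d])
    fix I1 :: "nat \<Rightarrow> int" and R1 :: "nat \<Rightarrow> real" and y
    assume h: "\<And>m. m \<notin> {3, 15} \<Longrightarrow> I1 m = ?I m" "I1 3 = 2 ^ nat \<lceil>d\<rceil>"
      "x - 5 - (5 * (real (nat \<lceil>d\<rceil>) - real 0) + 2) \<le> y"
    have I1: "I1 0 = int N" "I1 1 = 1" "I1 2 = 2" "I1 3 = int L" using h(1,2) L by auto
    let ?I2 = "I1(4 := int L * int L * (int L * int L) * 2 * 2, 16 := 0, 5 := 40, 40 := int N, 6 := 41)"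
    have "wp D N points_loop Q ?I2 (R1(1 := D 0 1)) (y - 9)"
    proof (rule points_loop_wp[where e = 0])
      fix I' y'
      assume a: "\<And>m. m \<notin> {6, 16} \<Longrightarrow> m < 41 + 0 \<Longrightarrow> I' m = ?I2 m" "I' 6 = int (41 + N)"
        "\<And>i. 0 \<le> i \<Longrightarrow> i < N \<Longrightarrow> I' (41 + i) = int i" "y - 9 - (5 * (real N - real 0) + 2) \<le> y'"
      show "Q I' (R1(1 := D 0 1)) y'"
      proof (rule Q)
        obtain x y where "x < N" "y < N" "x \<noteq> y" "D x y = closest_pair D N"
          using closest_pair_attained by blast
        then have "\<exists>x\<in>set [0..<N]. \<exists>y\<in>set [0..<N]. x \<noteq> y \<and> D x y = closest_pair D N"
          by (intro bexI[of _ x] bexI[of _ y]) auto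
        then have "candidates [[0..<N]] (D 0 1)"
          using closest_pair_le[of 0 1] two_points unfolding candidates_def by auto
        moreover have "I' 4 = int (2 * c)"
          using a(1)[of 4] by (simp add: c power4_eq_xxxx)
        ultimately show "state_ok I' (R1(1 := D 0 1)) [[0..<N]] 40 (41 + N)"
          using a(1)[of 1] a(1)[of 2] a(1)[of 3] a(1)[of 5] a(1)[of 40] a(2,3) I1
          by (simp add: state_ok_def)
      qed (use a h in simp)
    qed (use I1 in auto)
    then show "?rest I1 R1 y" using I1 two_points by (simp add: wp_simps)
  qed auto
  then show ?thesis by (simp add: init_com_def wp_simps)
qed

lemma exp_cost_bound_prog:
  assumes L: "L = 2 ^ nat \<lceil>d\<rceil>"
  shows "exp_cost closest_pair_prog D N (closest_pair D N) n (init_cfg N d)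
    \<le> ennreal (potential [[0..<N]] + (5 * real (nat \<lceil>d\<rceil>) + 5 * real N + 30))"
proof -
  define a where "a = com_size init_com"
  define b where "b = com_size body_com"
  let ?prog = closest_pair_prog
  let ?le = "cost_le ?prog D N (closest_pair D N)"
  have prog: "?prog = compile 0 init_com @ [JmpILess 5 6 (a + 2), Halt 1] @ compile (a + 2) body_com @ [Jmp a]"
    by (simp add: closest_pair_prog_def a_def Let_def)
  have code: "code_at ?prog 0 (compile 0 init_com)" "a < length ?prog" "?prog ! a = JmpILess 5 6 (a + 2)"
    "Suc a < length ?prog" "?prog ! Suc a = Halt 1" "code_at ?prog (a + 2) (compile (a + 2) body_com)"
    "a + 2 + b < length ?prog" "?prog ! (a + 2 + b) = Jmp a"
    using code_at_prefix[of "[]" "compile 0 init_com"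
        "[JmpILess 5 6 (a + 2), Halt 1] @ compile (a + 2) body_com @ [Jmp a]"]
      code_at_prefix[of "compile 0 init_com @ [JmpILess 5 6 (a + 2), Halt 1]" "compile (a + 2) body_com" "[Jmp a]"]
      a_def b_def
    unfolding prog by (auto simp: nth_append)
  \<comment> \<open>The test at the head consumes one unit of fuel, so each return to the head is
    covered by the induction hypothesis, however many attempts are rejected. The same budget serves
    every amount of fuel.\<close>
  have head: "?le n a I R (potential qs)" if "state_ok I R qs h t" for n I R qs h t
    using that
  proof (induction n arbitrary: I R qs h t)
    case 0
    then show ?case using potential_nonneg[of qs] by (simp add: cost_le_def)
  next
    case (Suc n)
    show ?case
    proof (cases qs)
      case Nil
      then have "I 5 = I 6" "R 1 = closest_pair D N" using Suc.prems by (auto simp: state_ok_def candidates_def)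
      have "exp_cost ?prog D N (closest_pair D N) n (Cfg (Suc a) I R k) \<le> 1" for k
        using code(4,5) \<open>R 1 = closest_pair D N\<close> by (cases n) (auto simp: ennreal_average_same)
      then have "?le n (Suc a) I R 1" by (simp add: cost_le_def)
      then have "?le n (Suc a) I R (potential qs - 1)"
        by (rule cost_le_weaken) (use potential_nonneg[of qs] in simp)
      then show ?thesis
        by (rule cost_le_step[rotated]) (use code(2,3) \<open>I 5 = I 6\<close> in simp)
    next
      case (Cons s qs')
      then have lt: "I 5 < I 6"
        using Suc.prems segments_le[of I "h + 1 + length s" qs' t] by (auto simp: state_ok_def)
      have "?le n (a + 2) I R (potential qs - 1)"
      proof (rule wp_sound[OF _ code(6)])
        show "wp D N body_com (\<lambda>I R x. ?le n (a + 2 + b) I R x) I R (potential qs - 1)"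
        proof (rule body_com_wp[of I R s qs' h t])
          fix I' R' y qs'' h' t'
          assume "state_ok I' R' qs'' h' t'" "potential qs'' + 1 \<le> y"
          then show "?le n (a + 2 + b) I' R' y"
            by (intro cost_le_Jmp[OF code(7,8)] cost_le_weaken[OF Suc.IH]) auto
        qed (use Suc.prems Cons in auto)
      qed (simp add: b_def)
      then show ?thesis
        by (rule cost_le_step[rotated]) (use code(2,3) lt in simp)
    qed
  qed
  let ?x = "potential [[0..<N]] + (5 * real (nat \<lceil>d\<rceil>) + 5 * real N + 30)"
  have "?le n 0 ((\<lambda>_. 0)(0 := int N)) ((\<lambda>_. 0)(0 := d)) ?x"
  proof (rule wp_sound[OF _ code(1)])
    show "wp D N init_com (\<lambda>I R x. ?le n a I R x) ((\<lambda>_. 0)(0 := int N)) ((\<lambda>_. 0)(0 := d)) ?x"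
      by (rule init_com_wp[OF L], rule cost_le_weaken[OF head]) auto
  qed (simp add: a_def)
  then show ?thesis unfolding cost_le_def init_cfg_def by blast
qed

end

theorem theorem1:
  shows "\<exists>prog :: instr list. \<forall>d :: real. \<exists>C :: real.
     \<forall>(N :: nat) (D :: nat \<Rightarrow> nat \<Rightarrow> real).
       N \<ge> 2 \<and> is_metric D N \<and> doubling_dim D N = d \<longrightarrow>
         (AE cs in coins. run_output prog D N d cs = Some (closest_pair D N)) \<and>
         expected_time prog D N d \<le> ennreal (C * real N * ln (real N))"
proof (intro exI[of _ closest_pair_prog] allI)
  fix d :: real
  define a where "a = nat \<lceil>d\<rceil>"
  define L :: nat where "L = 2 ^ a"
  define c where "c = 2 * L ^ 4"
  have "0 < c" by (simp add: c_def L_def)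
  obtain B :: real where B: "\<And>n K k. bounds_ok c n K k \<Longrightarrow> n \<le> 2 * c * L ^ (k + 2) \<Longrightarrow>
       (8 * real n + 7) * real n + 4 * real K + 4 * real k + 30 \<le> B"
    using brute_force_bounded[OF \<open>0 < c\<close>, of a] unfolding L_def by blast
  define A where "A = 4 * c * (4800 * real c ^ 3 + B)"
  \<comment> \<open>The first summand absorbs the constants since \<open>1 \<le> N * ln N\<close>,
    the second the linear term since \<open>N * ln 2 \<le> N * ln N\<close>, and the third changes
    the base of the logarithm. All depend on \<open>d\<close> only.\<close>
  define C where "C = (5 * real a + 35 + B) + 5 / ln 2 + A / ln 2"
  show "\<exists>C. \<forall>N D. N \<ge> 2 \<and> is_metric D N \<and> doubling_dim D N = d \<longrightarrow>
         (AE cs in coins. run_output closest_pair_prog D N d cs = Some (closest_pair D N)) \<and>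
         expected_time closest_pair_prog D N d \<le> ennreal (C * real N * ln (real N))"
  proof (intro exI[of _ C] allI impI)
    fix N D assume h: "N \<ge> 2 \<and> is_metric D N \<and> doubling_dim D N = d"
    then have N: "2 \<le> N" "0 < N" "is_metric D N" "doubling_dim D N = d" by auto
    note dc = two_powr_doubling_dim[OF N(3,2)]
    have "real (doubling_const D N) \<le> real L"
    proof -
      have "2 powr d \<le> 2 powr real a" by (simp add: a_def) linarith
      then show ?thesis using dc(1) N(4) by (simp add: L_def powr_realpow)
    qed
    then have "doubling_const D N \<le> L" by simp
    interpret closest_pair_search D N L c B
    proof
      show "is_metric D N" by (rule N)
      show "\<exists>Q\<subseteq>{..<N}. card Q \<le> L \<and> ball_idx D N p R \<subseteq> (\<Union>q\<in>Q. ball_idx D N q (R / 2))"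
        if "p < N" "0 < R" for p R
        using dc(3) that \<open>doubling_const D N \<le> L\<close> by (meson order_trans)
    qed (use N B c_def in auto)
    let ?bound = "potential [[0..<N]] + (5 * real (nat \<lceil>d\<rceil>) + 5 * real N + 30)"
    have cost: "exp_cost closest_pair_prog D N (closest_pair D N) n (init_cfg N d) \<le> ennreal ?bound" for n
      by (rule exp_cost_bound_prog) (simp add: L_def a_def)
    have "?bound \<le> C * real N * ln (real N)"
    proof -
      let ?y = "real N * ln (real N)"
      have "ln 2 \<le> ln (real N)" using N by simp
      then have y: "real N * ln 2 \<le> ?y" by (rule mult_left_mono) simp
      have "2 * ln 2 \<le> real N * ln 2" using N by (intro mult_right_mono) auto
      moreover have "1 \<le> 2 * ln (2::real)" using ln2_ge_two_thirds by simp
      ultimately have "1 \<le> ?y" using y by linarith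
      then have 1: "(5 * real a + 35 + B) * 1 \<le> (5 * real a + 35 + B) * ?y"
        using B_ge by (intro mult_left_mono) auto
      have 2: "5 * real N \<le> 5 / ln 2 * ?y"
        using y by (simp add: field_simps)
      have 3: "A * (real N * log 2 (real N)) = A / ln 2 * ?y"
        by (simp add: log_def)
      have "?bound = (5 * real a + 35 + B) + 5 * real N + A * (real N * log 2 (real N))"
        by (simp add: potential_def weight_def A_def slope_def a_def)
      also have "\<dots> \<le> (5 * real a + 35 + B) * ?y + 5 / ln 2 * ?y + A / ln 2 * ?y"
        unfolding 3 using 1 2 by (intro add_mono order_refl) (simp_all only: mult_1_right)
      also have "\<dots> = C * real N * ln (real N)" by (simp add: C_def algebra_simps)
      finally show ?thesis .
    qed
    then have cost': "exp_cost closest_pair_prog D N (closest_pair D N) n (init_cfg N d)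
        \<le> ennreal (C * real N * ln (real N))" for n
      using cost[of n] ennreal_leI order_trans by blast
    show "(AE cs in coins. run_output closest_pair_prog D N d cs = Some (closest_pair D N)) \<and>
         expected_time closest_pair_prog D N d \<le> ennreal (C * real N * ln (real N))"
      using exp_cost_bound[OF cost'] by blast
  qed
qed

end
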